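(* Let $K\subset\mathbb R^3$ be a tetrahedron and let $k\in\{1,2\}$. The degrees of freedom $$\int_{e} v\cdot t\, q\,\mathrm ds\quad \forall\, q\in\mathbb P_k(e),\ e\in\mathcal E(K),$$ $$\int_F (v\times n)\cdot q\,\mathrm dS\quad\forall\, q\in RM_{k-2}(F),\ F\in\mathcal F(K),$$ $$\int_F \big((\operatorname{curl} v)\times n\big)\cdot q\,\mathrm dS\quad\forall\, q\in RT(F),\ F\in\mathcal F(K),$$ are unisolvent for the space $W_k(K)=V_k^{ND}(K)\oplus b_K\mathbb P_1(K;\mathbb R^3)$; that is, the number of degrees of freedom (counted by choosing bases of the test spaces) equals $\dim W_k(K)$, and $v\in W_k(K)$ is uniquely determined by the values of these degrees of freedom.
   Context: $\mathcal E(K)$ and $\mathcal F(K)$ are the sets of edges and faces of $K$; $t$ is a unit tangent vector of the edge $e$ and $n$ a unit normal vector of the face $F$. $\mathbb P_m(D)$ is the space of polynomials of total degree at most $m$ on $D$ ($\{0\}$ if $m<0$), and $\mathbb P_m(D;\mathbb R^d)$ is its $\mathbb R^d$-valued version. $b_K=\lambda_1\lambda_2\lambda_3\lambda_4$, where $\lambda_1,\dots,\lambda_4$ are the barycentric coordinates of $K$. With $x$ the position vector, $$V_k^{ND}(K):=\nabla\mathbb P_{k+1}(K)\oplus x\times\mathbb P_1(K;\mathbb R^3),\qquad W_k(K):=V_k^{ND}(K)\oplus b_K\mathbb P_1(K;\mathbb R^3).$$ On a face $F$, vector fields with values in $\mathbb R^2$ are identified with fields tangential to $F$, and $x$ denotes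 the in-plane position vector; $x^\perp:=(n\times x)|_F$, $RM_{k-2}(F):=\mathbb P_0(F;\mathbb R^2)\oplus x^\perp\mathbb P_{k-2}(F)$ and $RT(F):=\mathbb P_0(F;\mathbb R^2)\oplus x\,\mathbb P_0(F)$. *)

theory Defs
  imports "HOL-Analysis.Analysis" "HOL-Library.Function_Algebras"
begin

instantiation "fun" :: (type, real_vector) real_vector
begin

definition scaleR_fun :: "real \<Rightarrow> ('a \<Rightarrow> 'b) \<Rightarrow> 'a \<Rightarrow> 'b"
  where "scaleR_fun c f = (\<lambda>x. c *\<^sub>R f x)"

instance
  by standard (auto simp: scaleR_fun_def fun_eq_iff scaleR_add_right scaleR_add_left)

end

(* A function on a set D is represented by its extension by 0 to the whole space, so that the
   functions on D form a real vector space in which two of them are equal iff they agree on D. *)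
definition on_set :: "'a set \<Rightarrow> ('a \<Rightarrow> 'b::zero) \<Rightarrow> 'a \<Rightarrow> 'b"
  where "on_set D f = (\<lambda>x. if x \<in> D then f x else 0)"

(* Polynomials on an edge or a face, in its own coordinates, are exactly the restrictions of the
   polynomials of the same total degree in the ambient coordinates. For m < 0 there are no
   monomials and the span is {0}. *)
definition poly_on :: "int \<Rightarrow> (real^3) set \<Rightarrow> (real^3 \<Rightarrow> real) set"
  where "poly_on m D =
    span {on_set D (\<lambda>x. \<Prod>i\<in>UNIV. (x $ i) ^ \<alpha> i) | \<alpha> :: 3 \<Rightarrow> nat. int (\<Sum>i\<in>UNIV. \<alpha> i) \<le> m}"

definition vpoly_on :: "int \<Rightarrow> (real^3) set \<Rightarrow> (real^3 \<Rightarrow> real^3) set"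
  where "vpoly_on m D = {p. \<forall>i. (\<lambda>x. p x $ i) \<in> poly_on m D}"

(* Derivatives are taken within K, so that they also make sense on the boundary of K for
   functions that are only given on K. *)
definition partial_in :: "(real^3) set \<Rightarrow> 3 \<Rightarrow> (real^3 \<Rightarrow> real) \<Rightarrow> real^3 \<Rightarrow> real"
  where "partial_in K i f x = frechet_derivative f (at x within K) (axis i 1)"

definition grad_in :: "(real^3) set \<Rightarrow> (real^3 \<Rightarrow> real) \<Rightarrow> real^3 \<Rightarrow> real^3"
  where "grad_in K f = on_set K (\<lambda>x. \<chi> i. partial_in K i f x)"

definition curl_in :: "(real^3) set \<Rightarrow> (real^3 \<Rightarrow> real^3) \<Rightarrow> real^3 \<Rightarrow> real^3"
  where "curl_in K v = on_set K (\<lambda>x. vector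
    [partial_in K 2 (\<lambda>y. v y $ 3) x - partial_in K 3 (\<lambda>y. v y $ 2) x,
     partial_in K 3 (\<lambda>y. v y $ 1) x - partial_in K 1 (\<lambda>y. v y $ 3) x,
     partial_in K 1 (\<lambda>y. v y $ 2) x - partial_in K 2 (\<lambda>y. v y $ 1) x])"

definition vertices :: "(real^3) set \<Rightarrow> (real^3) set"
  where "vertices K = {a. a extreme_point_of K}"

definition barycentric :: "(real^3) set \<Rightarrow> real^3 \<Rightarrow> real^3 \<Rightarrow> real"
  where "barycentric K a x =
    (THE c. \<exists>u. sum u (vertices K) = 1 \<and> (\<Sum>b\<in>vertices K. u b *\<^sub>R b) = x \<and> c = u a)"

definition bubble :: "(real^3) set \<Rightarrow> real^3 \<Rightarrow> real"
  where "bubble K = on_set K (\<lambda>x. \<Prod>a\<in>vertices K. barycentric K a x)"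

(* Below, + between sets of functions is the sum of subspaces. That these sums are direct is a
   property of the summands; it is not needed to define the spaces. *)
definition V_ND :: "int \<Rightarrow> (real^3) set \<Rightarrow> (real^3 \<Rightarrow> real^3) set"
  where "V_ND k K =
    grad_in K ` poly_on (k + 1) K + (\<lambda>p x. cross3 x (p x)) ` vpoly_on 1 K"

definition W :: "int \<Rightarrow> (real^3) set \<Rightarrow> (real^3 \<Rightarrow> real^3) set"
  where "W k K = V_ND k K + (\<lambda>p x. bubble K x *\<^sub>R p x) ` vpoly_on 1 K"

definition unit_tangent :: "(real^3) set \<Rightarrow> real^3 \<Rightarrow> bool"
  where "unit_tangent e t \<longleftrightarrow> norm t = 1 \<and> (\<exists>x\<in>e. \<exists>y\<in>e. \<exists>c. t = c *\<^sub>R (y - x))"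

definition unit_normal :: "(real^3) set \<Rightarrow> real^3 \<Rightarrow> bool"
  where "unit_normal F n \<longleftrightarrow> norm n = 1 \<and> (\<forall>x\<in>F. \<forall>y\<in>F. n \<bullet> (y - x) = 0)"

(* Fields on F with values in R^2 are tangential fields on F with values in R^3. *)
definition tpoly_on :: "int \<Rightarrow> (real^3) set \<Rightarrow> real^3 \<Rightarrow> (real^3 \<Rightarrow> real^3) set"
  where "tpoly_on m F n = {p \<in> vpoly_on m F. \<forall>x\<in>F. p x \<bullet> n = 0}"

definition RM :: "int \<Rightarrow> (real^3) set \<Rightarrow> real^3 \<Rightarrow> (real^3 \<Rightarrow> real^3) set"
  where "RM m F n = tpoly_on 0 F n + (\<lambda>q x. q x *\<^sub>R cross3 n x) ` poly_on m F"

(* The in-plane position vector is the tangential part of x, i.e. the origin of the plane of F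
   is the foot of the perpendicular from 0. As the constant tangential fields are included,
   another origin in that plane gives the same space. *)
definition RT :: "(real^3) set \<Rightarrow> real^3 \<Rightarrow> (real^3 \<Rightarrow> real^3) set"
  where "RT F n = tpoly_on 0 F n + (\<lambda>q x. q x *\<^sub>R (x - (x \<bullet> n) *\<^sub>R n)) ` poly_on 0 F"

(* Line and surface integrals through the affine parametrisation by the unit interval and the
   unit triangle; the values do not depend on the order in which the end points of the segment e,
   respectively the vertices of the nondegenerate triangle F, are chosen. *)
definition edge_integral :: "(real^3) set \<Rightarrow> (real^3 \<Rightarrow> real) \<Rightarrow> real"
  where "edge_integral e f =
    (let (a, b) = (SOME (a, b). e = closed_segment a b)
     in dist a b * integral {0..1} (\<lambda>s. f (linepath a b s)))"

definition face_integral :: "(real^3) set \<Rightarrow> (real^3 \<Rightarrow> real) \<Rightarrow> real"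
  where "face_integral F f =
    (let (a, b, c) = (SOME (a, b, c). F = convex hull {a, b, c})
     in norm (cross3 (b - a) (c - a)) *
        integral {(s, r). 0 \<le> s \<and> 0 \<le> r \<and> s + r \<le> 1}
          (\<lambda>(s, r). f (a + s *\<^sub>R (b - a) + r *\<^sub>R (c - a))))"

end

(* On the boundary of K the bubble part of v vanishes, so the edge and the first face functionals only
   see the edge element part u, a quadratic field with the Bernstein coefficients U(p,q), p and q
   vertices. Testing with u itself on the edges gives U(p,q).(q-p) = 0, in particular U(p,p) = 0. On a
   face abc the tangential moments against constants leave one free number, the common value of
   U(a,b).(c-a) and its permutations; it is killed by the moment against the position vector (k = 2),
   or because u would otherwise contain the gradient of the cubic face bubble (k = 1). Hence u = 0.

   For v = b_K w with w affine, curl v = b_F grad(lambda_d) x w on the face F opposite to d, so the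
   last functionals are the b_F-weighted tangential moments of w against RT(F). In terms of the vertex
   values of w they say that the sum of w over the vertices of F is normal to F and that the sum of
   w(p).(p - a) over the vertices p of F vanishes for each vertex a of F; these equations for the four
   faces force the four sums, hence w, to vanish.

   The same injectivity shows that an explicit linear parametrisation of W_k(K) by 32 (k = 1) or
   42 (k = 2) coefficients is bijective. *)
theory Submission imports Defs begin

section \<open>Polynomials\<close>

text \<open>The free number on a face is the multiple of the tangential gradient of the cubic face
  bubble. This gradient has no tangential part on the edges, and its mean is zero because the bubble
  vanishes on the boundary of the face. Against the position vector, integration by parts gives -2
  times the integral of the bubble, which is not zero; hence a single further moment suffices for k
  = 2. For k = 1 there is an obstruction instead: along a line, the tangential component of a field
  of the space has degree 1, since x \<times> p contributes no quadratic term, whereas along a + b -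
  2 c the derivative of the bubble has degree 2.

  Bernstein coefficients suit the functionals because U(p,q) vanishes as soon as its products with
  the three edge vectors at p do, and any three vertices lie on a common face.

  Integrals are additive only for integrable integrands, and fields on K are cut off outside K. The
  argument therefore runs with polynomial fields on the whole space, whose continuity allows the
  functionals of two fields to be subtracted.\<close>

lemma linear_on_set: "linear (on_set D :: ('a \<Rightarrow> 'b::real_vector) \<Rightarrow> _)"
  by (rule linearI) (auto simp: on_set_def fun_eq_iff scaleR_fun_def)

lemma on_set_cong: "(\<And>x. x \<in> D \<Longrightarrow> f x = g x) \<Longrightarrow> on_set D f = on_set D g"
  by (auto simp: on_set_def)

definition monomials :: "int \<Rightarrow> (real^3 \<Rightarrow> real) set"
  where "monomials m = {(\<lambda>x. \<Prod>i\<in>UNIV. (x $ i) ^ \<alpha> i) | \<alpha> :: 3 \<Rightarrow> nat. int (\<Sum>i\<in>UNIV. \<alpha> i) \<le> m}"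

lemma nat_triple_le_1:
  assumes "a + b + c \<le> (1::nat)"
  shows "(a, b, c) \<in> {(0,0,0),(1,0,0),(0,1,0),(0,0,1)}"
  using assms by (simp; presburger)

lemma nat_triple_le_2:
  assumes "a + b + c \<le> (2::nat)"
  shows "(a, b, c) \<in> {(0,0,0),(1,0,0),(0,1,0),(0,0,1),(2,0,0),(0,2,0),(0,0,2),(0,1,1),(1,0,1),(1,1,0)}"
proof -
  consider "a = 0" | "a = 1" | "a = 2"
    using assms by linarith
  then show ?thesis
  proof cases
    case 1
    then show ?thesis using assms by (simp; presburger)
  next
    case 2
    then show ?thesis using assms by (simp; presburger)
  next
    case 3
    then show ?thesis using assms by simp
  qed
qed

lemma prod_3: "prod f (UNIV :: 3 set) = f 1 * f 2 * f 3"
  unfolding UNIV_3 by (simp add: mult.assoc)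

lemma monomialsE:
  assumes "h \<in> monomials m"
  obtains \<alpha> :: "3 \<Rightarrow> nat" where "h = (\<lambda>x. \<Prod>i\<in>UNIV. (x $ i) ^ \<alpha> i)" "sum \<alpha> UNIV \<le> nat m" "0 \<le> m"
proof -
  from assms obtain \<alpha> :: "3 \<Rightarrow> nat" where h: "h = (\<lambda>x. \<Prod>i\<in>UNIV. (x $ i) ^ \<alpha> i)" "int (sum \<alpha> UNIV) \<le> m"
    unfolding monomials_def mem_Collect_eq by (elim exE conjE)
  have "0 \<le> m"
    using order_trans[OF of_nat_0_le_iff h(2)] .
  moreover have "sum \<alpha> UNIV \<le> nat m"
    using nat_mono[OF h(2)] unfolding nat_int .
  ultimately show ?thesis
    by (intro that[of \<alpha>] h(1))
qed

definition pol :: "int \<Rightarrow> (real^3 \<Rightarrow> real) set"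
  where "pol m = span (monomials m)"

definition vpol :: "int \<Rightarrow> (real^3 \<Rightarrow> real^3) set"
  where "vpol m = {p. \<forall>i. (\<lambda>x. p x $ i) \<in> pol m}"

text \<open>Restriction to D is linear and so commutes with the span. Polynomials can then be
  treated on the whole space, with D entering through \<open>on_set\<close>.\<close>

lemma poly_on_eq: "poly_on m D = on_set D ` pol m"
proof -
  have "poly_on m D = span (on_set D ` monomials m)"
    unfolding poly_on_def monomials_def by (rule arg_cong[where f = span]) auto
  then show ?thesis
    unfolding pol_def by (simp add: linear_span_image[OF linear_on_set])
qed

lemma vpoly_on_eq: "vpoly_on m D = on_set D ` vpol m"
proof (intro equalityI subsetI)
  fix p assume "p \<in> vpoly_on m D"
  then have "\<forall>i. \<exists>f\<in>pol m. (\<lambda>x. p x $ i) = on_set D f"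
    by (auto simp: vpoly_on_def poly_on_eq)
  then obtain f where f: "\<And>i. f i \<in> pol m" "\<And>i. (\<lambda>x. p x $ i) = on_set D (f i)"
    by metis
  have "p x = on_set D (\<lambda>x. \<chi> i. f i x) x" for x
    using fun_cong[OF f(2), of x] by (auto simp: vec_eq_iff on_set_def)
  moreover have "(\<lambda>x. \<chi> i. f i x) \<in> vpol m"
    using f by (simp add: vpol_def)
  ultimately show "p \<in> on_set D ` vpol m" by blast
next
  fix p assume "p \<in> on_set D ` vpol m"
  then obtain f where f: "f \<in> vpol m" "p = on_set D f" by blast
  have "(\<lambda>x. p x $ i) = on_set D (\<lambda>x. f x $ i)" for i
    by (auto simp: f on_set_def fun_eq_iff)
  with f show "p \<in> vpoly_on m D"
    by (auto simp: vpoly_on_def poly_on_eq vpol_def)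
qed

lemma subspace_pol: "subspace (pol m)"
  by (simp add: pol_def)

lemma pol_add: "f \<in> pol m \<Longrightarrow> g \<in> pol m \<Longrightarrow> (\<lambda>x. f x + g x) \<in> pol m"
  using subspace_add[OF subspace_pol, of f m g] by (simp add: plus_fun_def)

lemma pol_scale: "f \<in> pol m \<Longrightarrow> (\<lambda>x. c * f x) \<in> pol m"
  using subspace_scale[OF subspace_pol, of f m c] by (simp add: scaleR_fun_def)

lemma pol_mono: "m \<le> n \<Longrightarrow> pol m \<subseteq> pol n"
  unfolding pol_def monomials_def by (rule span_mono) auto

lemma pol_monom: "int (\<Sum>i\<in>UNIV. \<alpha> i) \<le> m \<Longrightarrow> (\<lambda>x. \<Prod>i\<in>UNIV. (x $ i) ^ \<alpha> i) \<in> pol m" for \<alpha> :: "3 \<Rightarrow> nat"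
  unfolding pol_def monomials_def by (rule span_base) auto

lemma pol_const: "0 \<le> m \<Longrightarrow> (\<lambda>x. c) \<in> pol m"
  using pol_scale[OF pol_monom[of "\<lambda>_. 0" m], of c] by simp

lemma pol_coord:
  assumes "1 \<le> m"
  shows "(\<lambda>x. x $ j) \<in> pol m"
proof -
  have "(\<lambda>x::real^3. \<Prod>i\<in>UNIV. (x $ i) ^ (if i = j then 1 else 0)) = (\<lambda>x. x $ j)"
    by (simp add: fun_eq_iff if_distrib[of "\<lambda>n. _ ^ n"] prod.delta cong: if_cong)
  with pol_monom[of "\<lambda>i. if i = j then 1 else 0" m] assms show ?thesis by simp
qed

lemma pol_mult:
  assumes "f \<in> pol m" "g \<in> pol n"
  shows "(\<lambda>x. f x * g x) \<in> pol (m + n)"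
proof -
  have *: "(\<lambda>x. f x * g x) \<in> pol (m + n)" if f: "f \<in> monomials m" and g: "g \<in> pol n" for f
    using g unfolding pol_def[of n]
  proof (induction rule: span_induct_alt)
    case base
    then show ?case using pol_scale[OF subspace_0[OF subspace_pol, of "m+n"], of 0] by (simp add: zero_fun_def)
  next
    case (step c h g)
    obtain \<alpha> \<beta> :: "3 \<Rightarrow> nat" where \<alpha>: "f = (\<lambda>x. \<Prod>i\<in>UNIV. (x $ i) ^ \<alpha> i)" "int (\<Sum>i\<in>UNIV. \<alpha> i) \<le> m"
      and \<beta>: "h = (\<lambda>x. \<Prod>i\<in>UNIV. (x $ i) ^ \<beta> i)" "int (\<Sum>i\<in>UNIV. \<beta> i) \<le> n"
      using f step.hyps by (auto simp: monomials_def)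
    have "(\<lambda>x. f x * h x) \<in> pol (m + n)"
      using pol_monom[of "\<lambda>i. \<alpha> i + \<beta> i" "m+n"] \<alpha>(2) \<beta>(2)
      by (simp add: \<alpha>(1) \<beta>(1) power_add prod.distrib sum.distrib)
    from pol_add[OF pol_scale[OF this, of c] step.IH]
    show ?case by (simp add: scaleR_fun_def algebra_simps)
  qed
  show ?thesis
    using assms(1) unfolding pol_def[of m]
  proof (induction rule: span_induct_alt)
    case base
    then show ?case using pol_scale[OF subspace_0[OF subspace_pol, of "m+n"], of 0] by (simp add: zero_fun_def)
  next
    case (step c h f)
    from pol_add[OF pol_scale[OF *[OF step.hyps assms(2)], of c] step.IH]
    show ?case by (simp add: scaleR_fun_def algebra_simps)
  qed
qed

lemma pol_sum:
  assumes "0 \<le> m" "\<And>i. i \<in> I \<Longrightarrow> f i \<in> pol m"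
  shows "(\<lambda>x. \<Sum>i\<in>I. f i x) \<in> pol m"
  using assms(2) by (induction I rule: infinite_finite_induct) (auto intro: pol_add pol_const assms(1))

lemma pol_inner: "1 \<le> m \<Longrightarrow> (\<lambda>x. w \<bullet> x) \<in> pol m"
  unfolding inner_vec_def by (intro pol_sum) (auto intro!: pol_scale pol_coord)

section \<open>Normal forms for degree at most 2\<close>

lemma pol_0: "pol 0 = range (\<lambda>c x. c)"
proof (intro equalityI subsetI)
  fix f assume "f \<in> pol 0"
  then show "f \<in> range (\<lambda>c x. c)"
    unfolding pol_def
  proof (induction rule: span_induct_alt)
    case base
    then show ?case by (auto simp: zero_fun_def)
  next
    case (step c h g)
    obtain \<alpha> :: "3 \<Rightarrow> nat" where h: "h = (\<lambda>x. \<Prod>i\<in>UNIV. (x $ i) ^ \<alpha> i)" "sum \<alpha> UNIV \<le> nat 0"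
      using step.hyps(1) by (rule monomialsE)
    then have "h = (\<lambda>x. 1)" by simp
    then show ?case using step.IH by (force simp: scaleR_fun_def fun_eq_iff)
  qed
qed (auto simp: pol_const)

lemma pol_neg: "m < 0 \<Longrightarrow> pol m = {0}"
proof -
  assume "m < 0"
  then have "monomials m = {}" by (auto simp: monomials_def simp del: of_nat_sum)
  then show ?thesis by (simp add: pol_def)
qed

text \<open>Together with \<open>crv\<close> this packs the six quadratic monomials into two
  vectors, so that a quadratic form has two coefficient vectors and a quadratic field two
  coefficient matrices.\<close>

definition sqv :: "real^3 \<Rightarrow> real^3"
  where "sqv x = vector [x$1 * x$1, x$2 * x$2, x$3 * x$3]"

definition crv :: "real^3 \<Rightarrow> real^3"
  where "crv x = vector [x$2 * x$3, x$1 * x$3, x$1 * x$2]"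

lemma pol_2:
  "pol 2 = {(\<lambda>x. c + w \<bullet> x + y \<bullet> sqv x + z \<bullet> crv x) | c w y z. True}" (is "_ = ?R")
proof (intro equalityI subsetI)
  fix f assume "f \<in> pol 2"
  then show "f \<in> ?R"
    unfolding pol_def
  proof (induction rule: span_induct_alt)
    case base
    have "0 = (\<lambda>x. 0 + 0 \<bullet> x + 0 \<bullet> sqv x + 0 \<bullet> crv x)" by (auto simp: fun_eq_iff)
    then show ?case by blast
  next
    case (step s h g)
    then obtain c w y z where g: "g = (\<lambda>x. c + w \<bullet> x + y \<bullet> sqv x + z \<bullet> crv x)" by blast
    obtain \<alpha> :: "3 \<Rightarrow> nat" where h: "h = (\<lambda>x. \<Prod>i\<in>UNIV. (x $ i) ^ \<alpha> i)" "sum \<alpha> UNIV \<le> nat 2"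
      using step.hyps(1) by (rule monomialsE)
    have *: "h = (\<lambda>x. x$1 ^ \<alpha> 1 * x$2 ^ \<alpha> 2 * x$3 ^ \<alpha> 3)" "\<alpha> 1 + \<alpha> 2 + \<alpha> 3 \<le> 2"
      using h(2) by (simp_all add: h(1) prod_3 sum_3)
    have tri: "(\<alpha> 1, \<alpha> 2, \<alpha> 3) \<in> {(0,0,0),(1,0,0),(0,1,0),(0,0,1),(2,0,0),(0,2,0),(0,0,2),(0,1,1),(1,0,1),(1,1,0)}"
      using nat_triple_le_2[OF *(2)] .
    have e1: "\<exists>c w y z. (\<lambda>x. 1) = (\<lambda>x. c + w \<bullet> x + y \<bullet> sqv x + z \<bullet> crv x)"
      by (rule exI[of _ 1], rule exI[of _ 0], rule exI[of _ 0], rule exI[of _ 0]) simp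
    have e2: "\<exists>c w y z. (\<lambda>x. x $ i) = (\<lambda>x. c + w \<bullet> x + y \<bullet> sqv x + z \<bullet> crv x)" for i
      by (rule exI[of _ 0], rule exI[of _ "axis i 1"], rule exI[of _ 0], rule exI[of _ 0]) (simp add: inner_axis')
    have e3: "\<exists>c w y z. (\<lambda>x. sqv x $ i) = (\<lambda>x. c + w \<bullet> x + y \<bullet> sqv x + z \<bullet> crv x)" for i
      by (rule exI[of _ 0], rule exI[of _ 0], rule exI[of _ "axis i 1"], rule exI[of _ 0]) (simp add: inner_axis')
    have e4: "\<exists>c w y z. (\<lambda>x. crv x $ i) = (\<lambda>x. c + w \<bullet> x + y \<bullet> sqv x + z \<bullet> crv x)" for i
      by (rule exI[of _ 0], rule exI[of _ 0], rule exI[of _ 0], rule exI[of _ "axis i 1"]) (simp add: inner_axis')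
    have "\<exists>c w y z. h = (\<lambda>x. c + w \<bullet> x + y \<bullet> sqv x + z \<bullet> crv x)"
      using tri e1 e2[of 1] e2[of 2] e2[of 3] e3[of 1] e3[of 2] e3[of 3] e4[of 1] e4[of 2] e4[of 3]
      unfolding *(1) by (elim insertE emptyE Pair_inject) (simp_all add: power2_eq_square sqv_def crv_def)
    then obtain c' w' y' z' where h': "h = (\<lambda>x. c' + w' \<bullet> x + y' \<bullet> sqv x + z' \<bullet> crv x)" by blast
    have "s *\<^sub>R h + g = (\<lambda>x. (s * c' + c) + (s *\<^sub>R w' + w) \<bullet> x + (s *\<^sub>R y' + y) \<bullet> sqv x + (s *\<^sub>R z' + z) \<bullet> crv x)"
      by (simp add: g h' fun_eq_iff scaleR_fun_def inner_simps algebra_simps)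
    then show ?case
      by (intro CollectI exI conjI TrueI)
  qed
next
  fix f assume "f \<in> ?R"
  then obtain c w y z where f: "f = (\<lambda>x. c + w \<bullet> x + y \<bullet> sqv x + z \<bullet> crv x)" by blast
  have sq: "(\<lambda>x. x$i * x$j) \<in> pol 2" for i j
    using pol_mult[OF pol_coord[of 1 i] pol_coord[of 1 j]] by simp
  have "(\<lambda>x. c + w \<bullet> x + (\<Sum>i\<in>UNIV. y $ i * sqv x $ i) + (\<Sum>i\<in>UNIV. z $ i * crv x $ i)) \<in> pol 2"
  proof (intro pol_add pol_const pol_inner pol_sum pol_scale)
    show "(\<lambda>x. sqv x $ i) \<in> pol 2" "(\<lambda>x. crv x $ i) \<in> pol 2" for i
      using exhaust_3[of i] by (auto simp: sqv_def crv_def sq)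
  qed auto
  then show "f \<in> pol 2"
    by (simp add: f inner_vec_def)
qed

lemma pol_1: "pol 1 = {(\<lambda>x. c + w \<bullet> x) | c w. True}" (is "_ = ?R")
proof (intro equalityI subsetI)
  fix f assume "f \<in> pol 1"
  then show "f \<in> ?R"
    unfolding pol_def
  proof (induction rule: span_induct_alt)
    case base
    have "0 = (\<lambda>x::real^3. 0 + 0 \<bullet> x)" by (auto simp: fun_eq_iff)
    then show ?case by blast
  next
    case (step s h g)
    then obtain c w where g: "g = (\<lambda>x. c + w \<bullet> x)" by blast
    obtain \<alpha> :: "3 \<Rightarrow> nat" where h: "h = (\<lambda>x. \<Prod>i\<in>UNIV. (x $ i) ^ \<alpha> i)" "sum \<alpha> UNIV \<le> nat 1"
      using step.hyps(1) by (rule monomialsE)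
    have *: "h = (\<lambda>x. x$1 ^ \<alpha> 1 * x$2 ^ \<alpha> 2 * x$3 ^ \<alpha> 3)" "\<alpha> 1 + \<alpha> 2 + \<alpha> 3 \<le> 1"
      using h(2) by (simp_all add: h(1) prod_3 sum_3)
    have tri: "(\<alpha> 1, \<alpha> 2, \<alpha> 3) \<in> {(0,0,0),(1,0,0),(0,1,0),(0,0,1)}"
      using nat_triple_le_1[OF *(2)] .
    have e1: "\<exists>c w. (\<lambda>x. 1) = (\<lambda>x. c + w \<bullet> x)"
      by (rule exI[of _ 1], rule exI[of _ 0]) simp
    have e2: "\<exists>c w. (\<lambda>x. x $ i) = (\<lambda>x. c + w \<bullet> x)" for i
      by (rule exI[of _ 0], rule exI[of _ "axis i 1"]) (simp add: inner_axis')
    have "\<exists>c w. h = (\<lambda>x. c + w \<bullet> x)"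
      using tri e1 e2[of 1] e2[of 2] e2[of 3]
      unfolding *(1) by (elim insertE emptyE Pair_inject) simp_all
    then obtain c' w' where h': "h = (\<lambda>x. c' + w' \<bullet> x)" by blast
    have "s *\<^sub>R h + g = (\<lambda>x. (s * c' + c) + (s *\<^sub>R w' + w) \<bullet> x)"
      by (simp add: g h' fun_eq_iff scaleR_fun_def inner_simps algebra_simps)
    then show ?case
      by (intro CollectI exI conjI TrueI)
  qed
next
  fix f assume "f \<in> ?R"
  then show "f \<in> pol 1"
    by (auto intro!: pol_add pol_const pol_inner)
qed

section \<open>Edge element spaces as spaces of polynomial fields\<close>

lemma pol_diff: "f \<in> pol m \<Longrightarrow> g \<in> pol m \<Longrightarrow> (\<lambda>x. f x - g x) \<in> pol m"
  using pol_add[OF _ pol_scale[of g m "- 1"], of f] by simp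

lemma subspace_vpol: "subspace (vpol m)"
proof (rule subspaceI)
  show "0 \<in> vpol m"
    using subspace_0[OF subspace_pol, of m] by (simp add: vpol_def zero_fun_def)
qed (auto simp: vpol_def scaleR_fun_def intro: pol_add pol_scale)

lemma vpol_mono: "m \<le> n \<Longrightarrow> vpol m \<subseteq> vpol n"
  using pol_mono by (fastforce simp: vpol_def)

lemma cross3_vpol:
  assumes "p \<in> vpol m" "q \<in> vpol n"
  shows "(\<lambda>x. cross3 (p x) (q x)) \<in> vpol (m + n)"
proof -
  have *: "(\<lambda>x. p x $ i * q x $ j - q x $ i' * p x $ j') \<in> pol (m + n)" for i j i' j'
  proof (rule pol_diff)
    show "(\<lambda>x. p x $ i * q x $ j) \<in> pol (m + n)"
      using assms by (intro pol_mult) (auto simp: vpol_def)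
    show "(\<lambda>x. q x $ i' * p x $ j') \<in> pol (m + n)"
      using assms by (subst add.commute, intro pol_mult) (auto simp: vpol_def)
  qed
  have "(\<lambda>x. cross3 (p x) (q x) $ i) \<in> pol (m + n)" for i
    using exhaust_3[of i] *[of 2 3 2 3] *[of 3 1 3 1] *[of 1 2 1 2]
    by (auto simp: cross_components)
  then show ?thesis by (simp add: vpol_def)
qed

lemma ident_vpol: "(\<lambda>x. x) \<in> vpol 1"
  by (simp add: vpol_def pol_coord)

lemma const_vpol: "0 \<le> m \<Longrightarrow> (\<lambda>x. c) \<in> vpol m"
  by (simp add: vpol_def pol_const)

lemma vpol_1: "vpol 1 = {(\<lambda>x. c + M *v x) | c (M :: real^3^3). True}"
proof (intro equalityI subsetI)
  fix p assume "p \<in> vpol 1"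
  then have "\<forall>i. \<exists>c w. (\<lambda>x. p x $ i) = (\<lambda>x. c + w \<bullet> x)"
    by (simp add: vpol_def pol_1)
  then obtain c w where cw: "\<And>i. (\<lambda>x. p x $ i) = (\<lambda>x. c i + w i \<bullet> x)"
    by metis
  have "p x = (\<chi> i. c i) + (\<chi> i. w i) *v x" for x
    using fun_cong[OF cw, of x]
    by (simp add: vec_eq_iff matrix_vector_mult_def inner_vec_def)
  then show "p \<in> {(\<lambda>x. c + M *v x) | c (M :: real^3^3). True}" by blast
next
  fix p assume "p \<in> {(\<lambda>x. c + M *v x) | c (M :: real^3^3). True}"
  then obtain c and M :: "real^3^3" where p: "p = (\<lambda>x. c + M *v x)" by blast
  have "(\<lambda>x. p x $ i) = (\<lambda>x. c $ i + (M $ i) \<bullet> x)" for i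
    by (simp add: p matrix_vector_mult_def inner_vec_def)
  then show "p \<in> vpol 1"
    by (simp add: vpol_def pol_add pol_const pol_inner)
qed

lemma vpol_2: "vpol 2 = {(\<lambda>x. c + M *v x + Y *v sqv x + Z *v crv x) | c M Y Z. True}" (is "_ = ?R")
proof (intro equalityI subsetI)
  fix p assume "p \<in> vpol 2"
  then have "\<forall>i. \<exists>c w y z. (\<lambda>x. p x $ i) = (\<lambda>x. c + w \<bullet> x + y \<bullet> sqv x + z \<bullet> crv x)"
    by (simp add: vpol_def pol_2)
  then obtain c w y z where cw: "\<And>i. (\<lambda>x. p x $ i) = (\<lambda>x. c i + w i \<bullet> x + y i \<bullet> sqv x + z i \<bullet> crv x)"
    by metis
  have "p x = (\<chi> i. c i) + (\<chi> i. w i) *v x + (\<chi> i. y i) *v sqv x + (\<chi> i. z i) *v crv x" for x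
    using fun_cong[OF cw, of x]
    by (simp add: vec_eq_iff matrix_vector_mult_def inner_vec_def)
  then show "p \<in> ?R" by blast
next
  fix p assume "p \<in> ?R"
  then obtain c and M Y Z :: "real^3^3" where p: "p = (\<lambda>x. c + M *v x + Y *v sqv x + Z *v crv x)" by blast
  have "(\<lambda>x. p x $ i) = (\<lambda>x. c $ i + (M $ i) \<bullet> x + (Y $ i) \<bullet> sqv x + (Z $ i) \<bullet> crv x)" for i
    by (simp add: p matrix_vector_mult_def inner_vec_def)
  then show "p \<in> vpol 2"
    unfolding vpol_def pol_2 by blast
qed

section \<open>Gradients of polynomials\<close>

definition is_grad :: "(real^3 \<Rightarrow> real) \<Rightarrow> (real^3 \<Rightarrow> real^3) \<Rightarrow> bool"
  where "is_grad f g \<longleftrightarrow> (\<forall>x. (f has_derivative (\<lambda>h. g x \<bullet> h)) (at x))"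

lemma is_grad_unique: "is_grad f g \<Longrightarrow> is_grad f g' \<Longrightarrow> g = g'"
  unfolding is_grad_def
  by (metis ext has_derivative_unique vector_eq_rdot)

lemma is_grad_add: "is_grad f g \<Longrightarrow> is_grad f' g' \<Longrightarrow> is_grad (\<lambda>x. f x + f' x) (\<lambda>x. g x + g' x)"
  by (auto simp: is_grad_def inner_add_left intro: has_derivative_add)

lemma is_grad_scale: "is_grad f g \<Longrightarrow> is_grad (\<lambda>x. c * f x) (\<lambda>x. c *\<^sub>R g x)"
  by (auto simp: is_grad_def intro: has_derivative_mult_right)

lemma is_grad_coord_mult:
  assumes "is_grad f g"
  shows "is_grad (\<lambda>x. x $ i * f x) (\<lambda>x. f x *\<^sub>R axis i 1 + x $ i *\<^sub>R g x)"
proof -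
  have "((\<lambda>x. x $ i * f x) has_derivative (\<lambda>h. x $ i * (g x \<bullet> h) + h $ i * f x)) (at x)" for x
    using assms by (intro has_derivative_mult) (auto simp: is_grad_def intro: bounded_linear_imp_has_derivative bounded_linear_vec_nth)
  then show ?thesis
    by (simp add: is_grad_def inner_add_left inner_axis' algebra_simps)
qed

text \<open>The last conclusion is Euler's identity. Degrees are integers, so the gradient of the
  constant monomial lies in \<open>vpol (- 1)\<close>, which is zero.\<close>

lemma monomial_grad:
  fixes \<alpha> :: "3 \<Rightarrow> nat"
  defines "f \<equiv> \<lambda>x::real^3. \<Prod>i\<in>UNIV. (x $ i) ^ \<alpha> i"
  obtains g where "is_grad f g" "g \<in> vpol (int (sum \<alpha> UNIV) - 1)" "\<forall>x. x \<bullet> g x = real (sum \<alpha> UNIV) * f x"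
proof
  define g :: "real^3 \<Rightarrow> real^3" where
    "g x = (\<chi> i. real (\<alpha> i) * x $ i ^ (\<alpha> i - 1) * (\<Prod>j\<in>UNIV - {i}. (x $ j) ^ \<alpha> j))" for x
  have "(f has_derivative (\<lambda>h. \<Sum>i\<in>UNIV. real (\<alpha> i) * h $ i * x $ i ^ (\<alpha> i - 1) * (\<Prod>j\<in>UNIV - {i}. (x $ j) ^ \<alpha> j))) (at x)" for x
    unfolding f_def
    by (intro has_derivative_prod has_derivative_power bounded_linear_imp_has_derivative bounded_linear_vec_nth)
  then show "is_grad f g"
    by (simp add: is_grad_def g_def inner_vec_def ac_simps)
  show "\<forall>x. x \<bullet> g x = real (sum \<alpha> UNIV) * f x"
  proof
    fix x
    have "x $ i * (real (\<alpha> i) * x $ i ^ (\<alpha> i - 1) * (\<Prod>j\<in>UNIV - {i}. (x $ j) ^ \<alpha> j)) = real (\<alpha> i) * f x" for i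
    proof -
      have "f x = x $ i ^ \<alpha> i * (\<Prod>j\<in>UNIV - {i}. (x $ j) ^ \<alpha> j)"
        unfolding f_def by (rule prod.remove) auto
      then show ?thesis by (cases "\<alpha> i") auto
    qed
    then have "(\<Sum>i\<in>UNIV. x $ i * (real (\<alpha> i) * x $ i ^ (\<alpha> i - 1) * (\<Prod>j\<in>UNIV - {i}. (x $ j) ^ \<alpha> j))) = (\<Sum>i\<in>UNIV. real (\<alpha> i) * f x)"
      by (intro sum.cong refl)
    then show "x \<bullet> g x = real (sum \<alpha> UNIV) * f x"
      by (simp add: g_def inner_vec_def sum_distrib_right)
  qed
  \<comment> \<open>A variable that does not occur is treated apart: for
    \<open>\<alpha> i = 0\<close> the truncated exponent \<open>\<alpha> i - 1\<close> does not
    lower the degree, but then the factor \<open>\<alpha> i\<close> is 0.\<close>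
  have "(\<lambda>x. g x $ i) \<in> pol (int (sum \<alpha> UNIV) - 1)" for i
  proof (cases "\<alpha> i")
    case 0
    then have "(\<lambda>x. g x $ i) = 0" by (simp add: g_def fun_eq_iff)
    then show ?thesis using subspace_0[OF subspace_pol] by metis
  next
    case (Suc n)
    define \<beta> where "\<beta> = \<alpha>(i := n)"
    have "sum \<alpha> UNIV = \<alpha> i + sum \<alpha> (UNIV - {i})" "sum \<beta> UNIV = n + sum \<alpha> (UNIV - {i})"
      using sum.remove[of UNIV i \<alpha>] sum.remove[of UNIV i \<beta>] by (auto simp: \<beta>_def)
    then have "int (sum \<beta> UNIV) \<le> int (sum \<alpha> UNIV) - 1" using Suc by linarith
    moreover have "(\<Prod>j\<in>UNIV. x $ j ^ \<beta> j) = x $ i ^ n * (\<Prod>j\<in>UNIV - {i}. x $ j ^ \<alpha> j)" for x :: "real^3"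
      using prod.remove[of UNIV i "\<lambda>j. x $ j ^ \<beta> j"] by (simp add: \<beta>_def)
    ultimately show ?thesis
      using pol_scale[OF pol_monom, of \<beta> "int (sum \<alpha> UNIV) - 1" "real (\<alpha> i)"] Suc by (simp add: g_def mult.assoc)
  qed
  then show "g \<in> vpol (int (sum \<alpha> UNIV) - 1)" by (simp add: vpol_def)
qed

lemma pol_grad:
  assumes "f \<in> pol m"
  obtains g where "is_grad f g" "g \<in> vpol (m - 1)"
proof -
  have "\<exists>g\<in>vpol (m - 1). is_grad f g"
    using assms unfolding pol_def
  proof (induction rule: span_induct_alt)
    case base
    have "is_grad 0 0" by (simp add: is_grad_def zero_fun_def)
    then show ?case using subspace_0[OF subspace_vpol] by blast
  next
    case (step c h f)
    then obtain g where g: "g \<in> vpol (m - 1)" "is_grad f g" by blast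
    obtain \<alpha> :: "3 \<Rightarrow> nat" where h: "h = (\<lambda>x. \<Prod>i\<in>UNIV. (x $ i) ^ \<alpha> i)" "sum \<alpha> UNIV \<le> nat m" "0 \<le> m"
      using step.hyps(1) by (rule monomialsE)
    obtain k where k: "is_grad h k" "k \<in> vpol (int (sum \<alpha> UNIV) - 1)" "\<forall>x. x \<bullet> k x = real (sum \<alpha> UNIV) * h x"
      unfolding h(1) by (rule monomial_grad[of \<alpha>])
    have "int (sum \<alpha> UNIV) \<le> m"
      using h(2,3) by (simp add: le_nat_iff del: of_nat_sum)
    then have "k \<in> vpol (m - 1)"
      using k(2) vpol_mono[of "int (sum \<alpha> UNIV) - 1" "m - 1"] by auto
    then have "c *\<^sub>R k + g \<in> vpol (m - 1)"
      using g subspace_vpol by (simp add: subspace_add subspace_scale)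
    moreover have "is_grad (c *\<^sub>R h + f) (c *\<^sub>R k + g)"
      using is_grad_add[OF is_grad_scale[OF k(1), of c] g(2)] by (simp add: scaleR_fun_def plus_fun_def)
    ultimately show ?case by blast
  qed
  then show ?thesis using that by blast
qed

text \<open>The counterpart of \<open>V_ND\<close> on the whole space; its restrictions to K make up
  \<open>V_ND\<close>, as \<open>V_ND_eq\<close> shows.\<close>

definition nd_fields :: "int \<Rightarrow> (real^3 \<Rightarrow> real^3) set"
  where "nd_fields k = {(\<lambda>x. g x + cross3 x (p x)) | f g p. f \<in> pol (k + 1) \<and> is_grad f g \<and> p \<in> vpol 1}"

lemma nd_fieldsI: "f \<in> pol (k + 1) \<Longrightarrow> is_grad f g \<Longrightarrow> p \<in> vpol 1 \<Longrightarrow> (\<lambda>x. g x + cross3 x (p x)) \<in> nd_fields k"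
  unfolding nd_fields_def by (rule CollectI, rule exI[of _ f], rule exI[of _ g], rule exI[of _ p]) simp

lemma nd_fieldsE:
  assumes "u \<in> nd_fields k"
  obtains f g p where "u = (\<lambda>x. g x + cross3 x (p x))" "f \<in> pol (k + 1)" "is_grad f g" "p \<in> vpol 1"
  using assms unfolding nd_fields_def mem_Collect_eq by (elim exE conjE)

lemma subspace_nd_fields: "subspace (nd_fields k)"
proof (rule subspaceI)
  have "0 \<in> pol (k + 1)" "is_grad 0 0" "0 \<in> vpol 1"
    using subspace_0[OF subspace_pol] subspace_0[OF subspace_vpol] by (auto simp: is_grad_def zero_fun_def)
  from nd_fieldsI[OF this] show "0 \<in> nd_fields k" by (simp add: zero_fun_def)
next
  fix u v assume "u \<in> nd_fields k" "v \<in> nd_fields k"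
  obtain f g p where u: "u = (\<lambda>x. g x + cross3 x (p x))" "f \<in> pol (k + 1)" "is_grad f g" "p \<in> vpol 1"
    using \<open>u \<in> nd_fields k\<close> by (rule nd_fieldsE)
  obtain f' g' p' where v: "v = (\<lambda>x. g' x + cross3 x (p' x))" "f' \<in> pol (k + 1)" "is_grad f' g'" "p' \<in> vpol 1"
    using \<open>v \<in> nd_fields k\<close> by (rule nd_fieldsE)
  have "p + p' \<in> vpol 1"
    using u v subspace_vpol by (simp add: subspace_add)
  from nd_fieldsI[OF pol_add[OF u(2) v(2)] is_grad_add[OF u(3) v(3)] this]
  show "u + v \<in> nd_fields k"
    by (simp add: u(1) v(1) plus_fun_def cross_add_right algebra_simps)
next
  fix c u assume "u \<in> nd_fields k"
  then obtain f g p where u: "u = (\<lambda>x. g x + cross3 x (p x))" "f \<in> pol (k + 1)" "is_grad f g" "p \<in> vpol 1"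
    by (rule nd_fieldsE)
  have "c *\<^sub>R p \<in> vpol 1"
    using u subspace_vpol by (simp add: subspace_scale)
  from nd_fieldsI[OF pol_scale[OF u(2)] is_grad_scale[OF u(3)] this]
  show "c *\<^sub>R u \<in> nd_fields k"
    by (simp add: u(1) scaleR_fun_def cross_mult_right algebra_simps)
qed

text \<open>For a field \<open>v\<close> that is homogeneous of degree \<open>m\<close>, Euler's identity gives
  \<open>(m + 1) v = grad (x \<bullet> v) - x \<times> curl v\<close>.\<close>

lemma vpol_subset_nd_fields:
  assumes "k \<le> 2"
  shows "vpol k \<subseteq> nd_fields k"
proof
  have *: "(\<lambda>x. f x *\<^sub>R axis i 1) \<in> nd_fields k" if "f \<in> pol k" for f i
    using that unfolding pol_def
  proof (induction rule: span_induct_alt)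
    case base
    then show ?case using subspace_0[OF subspace_nd_fields] by (simp add: zero_fun_def)
  next
    case (step c h f)
    obtain \<alpha> :: "3 \<Rightarrow> nat" where h: "h = (\<lambda>x. \<Prod>i\<in>UNIV. (x $ i) ^ \<alpha> i)" "sum \<alpha> UNIV \<le> nat k" "0 \<le> k"
      using step.hyps(1) by (rule monomialsE)
    define m where "m = sum \<alpha> UNIV"
    have m: "int m \<le> k"
      using h(2,3) unfolding m_def by (simp add: le_nat_iff del: of_nat_sum)
    obtain g where g: "is_grad h g" "g \<in> vpol (int m - 1)" "\<forall>x. x \<bullet> g x = real m * h x"
      unfolding h(1) m_def by (rule monomial_grad[of \<alpha>])
    define s where "s = 1 / (real m + 1)"
    have "h \<in> pol k" unfolding h(1) using m by (intro pol_monom) (simp add: m_def)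
    then have "(\<lambda>x. x $ i * h x) \<in> pol (1 + k)"
      by (intro pol_mult pol_coord) auto
    then have F: "(\<lambda>x. s * (x $ i * h x)) \<in> pol (k + 1)"
      by (intro pol_scale) (simp add: add.commute)
    have "(\<lambda>x. cross3 (g x) (axis i 1)) \<in> vpol (int m - 1 + 0)"
      by (intro cross3_vpol g const_vpol) auto
    \<comment> \<open>Here k \<le> 2 enters: the curl of a field of degree k has degree k - 1 and
      must fit into the fixed degree 1 of the factor p in x \<times> p.\<close>
    also have "\<dots> \<subseteq> vpol 1" using m assms by (intro vpol_mono) simp
    finally have "(- s) *\<^sub>R (\<lambda>x. cross3 (g x) (axis i 1)) \<in> vpol 1"
      using subspace_vpol by (intro subspace_scale)
    from nd_fieldsI[OF F is_grad_scale[OF is_grad_coord_mult[OF g(1)]] this]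
    have "(\<lambda>x. s *\<^sub>R (h x *\<^sub>R axis i 1 + x $ i *\<^sub>R g x) - s *\<^sub>R cross3 x (cross3 (g x) (axis i 1))) \<in> nd_fields k"
      by (simp add: scaleR_fun_def cross_mult_right)
    moreover have "s *\<^sub>R (h x *\<^sub>R axis i 1 + x $ i *\<^sub>R g x) - s *\<^sub>R cross3 x (cross3 (g x) (axis i 1)) = h x *\<^sub>R axis i 1" for x
    proof -
      have "s *\<^sub>R (h x *\<^sub>R axis i 1 + x $ i *\<^sub>R g x) - s *\<^sub>R cross3 x (cross3 (g x) (axis i 1))
          = (s * (1 + real m) * h x) *\<^sub>R axis i 1"
        unfolding Lagrange by (simp add: g(3)[rule_format] inner_axis algebra_simps)
      moreover have "s * (1 + real m) = 1"
        unfolding s_def by simp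
      ultimately show ?thesis by simp
    qed
    ultimately have "(\<lambda>x. h x *\<^sub>R axis i 1) \<in> nd_fields k" by simp
    from subspace_add[OF subspace_nd_fields subspace_scale[OF subspace_nd_fields this, of c] step.IH]
    show ?case by (simp add: scaleR_fun_def plus_fun_def scaleR_add_left)
  qed
  fix u assume "u \<in> vpol k"
  then have "(\<Sum>i\<in>UNIV. (\<lambda>x. u x $ i *\<^sub>R axis i 1)) \<in> nd_fields k"
    by (intro subspace_sum subspace_nd_fields *) (simp add: vpol_def)
  also have "(\<Sum>i\<in>UNIV. (\<lambda>x. u x $ i *\<^sub>R axis i 1)) = u"
    by (simp add: fun_eq_iff vec_eq_iff axis_def sum_3 forall_3)
  finally show "u \<in> nd_fields k" .
qed

text \<open>Gradients of cubics and the fields x \<times> p with p affine have degree at most 2; the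
  converse is the decomposition by Euler's identity. So nothing but the degree restricts the fields
  for k = 2.\<close>

lemma nd_fields_2: "nd_fields 2 = vpol 2"
proof
  show "nd_fields 2 \<subseteq> vpol 2"
  proof
    fix u assume "u \<in> nd_fields 2"
    then obtain f g p where u: "u = (\<lambda>x. g x + cross3 x (p x))" "f \<in> pol (2 + 1)" "is_grad f g" "p \<in> vpol 1"
      by (rule nd_fieldsE)
    obtain g' where g': "is_grad f g'" "g' \<in> vpol (2 + 1 - 1)"
      using u(2) by (rule pol_grad)
    then have "g \<in> vpol 2" using is_grad_unique[OF g'(1) u(3)] by simp
    moreover have "(\<lambda>x. cross3 x (p x)) \<in> vpol 2"
      using cross3_vpol[OF ident_vpol u(4)] by simp
    ultimately show "u \<in> vpol 2"
      using subspace_add[OF subspace_vpol, of g 2 "\<lambda>x. cross3 x (p x)"] by (simp add: u(1) plus_fun_def)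
  qed
qed (simp add: vpol_subset_nd_fields)

text \<open>Linear maps modulo multiples of the identity, which \<open>x \<times> _\<close> annihilates: the last diagonal
  entry is normalised to 0.\<close>

definition rlin :: "real^3 \<Rightarrow> real^3 \<Rightarrow> real \<Rightarrow> real \<Rightarrow> real^3 \<Rightarrow> real^3"
  where "rlin P Q r s x = vector [P \<bullet> x, Q \<bullet> x, r * x $ 1 + s * x $ 2]"

text \<open>Gradients of quadratic polynomials are affine, and so is x \<times> q for the constant
  part q of p; the proper quadratic part is x \<times> (A x), with A taken modulo the identity. The
  3 + 9 + 8 = 20 parameters are unique by \<open>nedelec_zero\<close>.\<close>

lemma nd_fields_1: "nd_fields 1 = {(\<lambda>x. c + M *v x + cross3 x (rlin P Q r s x)) | c M P Q r s. True}" (is "_ = ?R")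
proof
  show "nd_fields 1 \<subseteq> ?R"
  proof
    fix u assume "u \<in> nd_fields 1"
    then obtain f g p where u: "u = (\<lambda>x. g x + cross3 x (p x))" "f \<in> pol (1 + 1)" "is_grad f g" "p \<in> vpol 1"
      by (rule nd_fieldsE)
    obtain g' where g': "is_grad f g'" "g' \<in> vpol (1 + 1 - 1)"
      using u(2) by (rule pol_grad)
    then have g: "g \<in> vpol 1" using is_grad_unique[OF g'(1) u(3)] by simp
    obtain q and A :: "real^3^3" where p: "p = (\<lambda>x. q + A *v x)"
      using u(4) unfolding vpol_1 mem_Collect_eq by (elim exE conjE)
    have "(\<lambda>x. cross3 x q) \<in> vpol 1"
      using cross3_vpol[OF ident_vpol const_vpol[of 0 q]] by simp
    with g have "(\<lambda>x. g x + cross3 x q) \<in> vpol 1"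
      using subspace_add[OF subspace_vpol, of g 1 "\<lambda>x. cross3 x q"] by (simp add: plus_fun_def)
    then obtain c and M :: "real^3^3" where cM: "(\<lambda>x. g x + cross3 x q) = (\<lambda>x. c + M *v x)"
      unfolding vpol_1 mem_Collect_eq by (elim exE conjE)
    have "cross3 x (A *v x) = cross3 x (rlin (A $ 1 - A $ 3 $ 3 *\<^sub>R axis 1 1) (A $ 2 - A $ 3 $ 3 *\<^sub>R axis 2 1) (A $ 3 $ 1) (A $ 3 $ 2) x)" for x
      by (simp add: rlin_def cross3_def vec_eq_iff forall_3 matrix_vector_mult_def inner_vec_def sum_3 axis_def algebra_simps)
    then have "u = (\<lambda>x. c + M *v x + cross3 x (rlin (A $ 1 - A $ 3 $ 3 *\<^sub>R axis 1 1) (A $ 2 - A $ 3 $ 3 *\<^sub>R axis 2 1) (A $ 3 $ 1) (A $ 3 $ 2) x))"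
      using fun_cong[OF cM] by (simp add: u(1) p fun_eq_iff cross_add_right add.assoc[symmetric])
    then show "u \<in> ?R" by (intro CollectI exI conjI TrueI)
  qed
  show "?R \<subseteq> nd_fields 1"
  proof
    fix u assume "u \<in> ?R"
    then obtain c and M :: "real^3^3" and P Q r s where u: "u = (\<lambda>x. c + M *v x + cross3 x (rlin P Q r s x))"
      unfolding mem_Collect_eq by (elim exE conjE)
    have "rlin P Q r s = (\<lambda>x. 0 + (vector [P, Q, vector [r, s, 0]] :: real^3^3) *v x)"
      by (simp add: fun_eq_iff rlin_def vec_eq_iff forall_3 matrix_vector_mult_def inner_vec_def sum_3)
    then have "rlin P Q r s \<in> vpol 1"
      unfolding vpol_1 by (intro CollectI exI conjI TrueI)
    moreover have "0 \<in> pol (1 + 1)" "is_grad 0 0"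
      using subspace_0[OF subspace_pol] by (auto simp: is_grad_def zero_fun_def)
    ultimately have "(\<lambda>x. 0 x + cross3 x (rlin P Q r s x)) \<in> nd_fields 1"
      by (intro nd_fieldsI)
    moreover have "(\<lambda>x. c + M *v x) \<in> vpol 1"
      unfolding vpol_1 by (rule CollectI, rule exI[of _ c], rule exI[of _ M]) simp
    ultimately show "u \<in> nd_fields 1"
      using vpol_subset_nd_fields[of 1] subspace_add[OF subspace_nd_fields, of "\<lambda>x. c + M *v x" 1 "\<lambda>x. 0 x + cross3 x (rlin P Q r s x)"]
      by (auto simp: u plus_fun_def)
  qed
qed

section \<open>Differentiation within a convex body\<close>

text \<open>At a boundary point of K, convexity makes every segment from x to a point y of K
  available, and the one-sided derivative along it determines the value at y - x. Since K has
  interior points, these directions span the space.\<close>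

lemma has_derivative_within_convex_unique:
  fixes f :: "'a::euclidean_space \<Rightarrow> 'b::real_normed_vector"
  assumes K: "convex K" "interior K \<noteq> {}" "x \<in> K"
    and f': "(f has_derivative f') (at x within K)"
    and f'': "(f has_derivative f'') (at x within K)"
  shows "f' = f''"
proof -
  interpret f': bounded_linear f' using f' by (rule has_derivative_bounded_linear)
  interpret f'': bounded_linear f'' using f'' by (rule has_derivative_bounded_linear)
  have eq: "f' (y - x) = f'' (y - x)" if "y \<in> K" for y
  proof -
    define \<gamma> where "\<gamma> s = x + s *\<^sub>R (y - x)" for s :: real
    have \<gamma>: "(\<gamma> has_derivative (\<lambda>s. s *\<^sub>R (y - x))) (at 0 within {0..1})"
      unfolding \<gamma>_def by (auto intro!: derivative_eq_intros)
    have img: "\<gamma> ` {0..1} \<subseteq> K"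
    proof
      fix z assume "z \<in> \<gamma> ` {0..1}"
      then obtain s where s: "0 \<le> s" "s \<le> 1" "z = (1 - s) *\<^sub>R x + s *\<^sub>R y"
        by (auto simp: \<gamma>_def algebra_simps)
      show "z \<in> K" unfolding s(3) using K(1,3) that s(1,2) by (intro convexD) auto
    qed
    have *: "((f \<circ> \<gamma>) has_vector_derivative L (y - x)) (at 0 within cbox 0 1)"
      if L: "(f has_derivative L) (at x within K)" for L
    proof -
      have "bounded_linear L" using L by (rule has_derivative_bounded_linear)
      then have "L (s *\<^sub>R (y - x)) = s *\<^sub>R L (y - x)" for s
        by (rule linear_scale[OF bounded_linear.linear])
      moreover have "(f has_derivative L) (at (\<gamma> 0) within \<gamma> ` {0..1})"
        using has_derivative_subset[OF L img] by (simp add: \<gamma>_def)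
      ultimately show ?thesis
        using diff_chain_within[OF \<gamma>, of f L]
        by (simp add: has_vector_derivative_def o_def)
    qed
    show ?thesis
      using vector_derivative_unique_within_closed_interval[OF _ _ *[OF f'] *[OF f'']] by simp
  qed
  obtain z where "z \<in> interior K" using K(2) by auto
  then obtain e where e: "e > 0" "ball z e \<subseteq> K"
    by (auto simp: mem_interior)
  show ?thesis
  proof
    fix h :: 'a
    \<comment> \<open>A step so small that z + d h stays in the ball around z; the summand 1 in the
      denominator covers h = 0.\<close>
    define d where "d = e / 2 / (norm h + 1)"
    have pos: "norm h + 1 > 0" by (simp add: add_nonneg_pos)
    have "d > 0" using e(1) pos by (simp add: d_def)
    moreover have "d * (norm h + 1) = e / 2" 
    proof -
      have "e / 2 / q * q = e / 2" if "q > 0" for q :: real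
        using that by simp
      from this[OF pos] show ?thesis by (simp only: d_def)
    qed
    ultimately have d: "d > 0" "d * norm h < e" using e(1) by (simp_all add: algebra_simps)
    have "z \<in> K" "z + d *\<^sub>R h \<in> K"
      using e d by (auto intro!: subsetD[OF e(2)] simp: dist_norm)
    then have "f' (z + d *\<^sub>R h - x) - f' (z - x) = f'' (z + d *\<^sub>R h - x) - f'' (z - x)"
      by (simp add: eq)
    then have "d *\<^sub>R f' h = d *\<^sub>R f'' h"
      by (simp add: f'.add f'.diff f'.scaleR f''.add f''.diff f''.scaleR)
    then show "f' h = f'' h" using d by simp
  qed
qed

text \<open>This turns the derivative within K of a function known only on K into the derivative of
  any global extension, here always a polynomial.\<close>

lemma partial_in_eq:
  assumes "convex K" "interior K \<noteq> {}" "x \<in> K"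
    and f: "(f has_derivative f') (at x)" and "\<And>y. y \<in> K \<Longrightarrow> g y = f y"
  shows "partial_in K i g x = f' (axis i 1)"
proof -
  have g: "(g has_derivative f') (at x within K)"
    using assms by (intro has_derivative_transform[of x K g f]) (auto intro: has_derivative_at_withinI)
  then have "(g has_derivative frechet_derivative g (at x within K)) (at x within K)"
    by (intro frechet_derivative_works[THEN iffD1] differentiableI)
  then have "frechet_derivative g (at x within K) = f'"
    by (rule has_derivative_within_convex_unique[OF assms(1-3) _ g])
  then show ?thesis by (simp add: partial_in_def)
qed

lemma grad_in_eq:
  assumes "convex K" "interior K \<noteq> {}" "is_grad f g"
  shows "grad_in K (on_set K f) = on_set K g"
  unfolding grad_in_def
proof (rule on_set_cong)
  fix x assume "x \<in> K"
  then have "partial_in K i (on_set K f) x = g x \<bullet> axis i 1" for i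
    using assms by (intro partial_in_eq[where f = f]) (auto simp: is_grad_def on_set_def)
  then show "(\<chi> i. partial_in K i (on_set K f) x) = g x"
    by (simp add: vec_eq_iff inner_axis)
qed

lemma V_ND_eq:
  assumes K: "convex K" "interior K \<noteq> {}"
  shows "V_ND k K = on_set K ` nd_fields k"
proof (intro equalityI subsetI)
  fix v assume "v \<in> V_ND k K"
  then obtain f p where f: "f \<in> pol (k + 1)" and p: "p \<in> vpol 1"
    and v: "v = grad_in K (on_set K f) + (\<lambda>x. cross3 x (on_set K p x))"
    unfolding V_ND_def poly_on_eq vpoly_on_eq by (elim set_plus_elim imageE) simp
  obtain g where g: "is_grad f g"
    using f by (rule pol_grad)
  have "v = on_set K (\<lambda>x. g x + cross3 x (p x))"
    unfolding v grad_in_eq[OF K g] by (auto simp: on_set_def fun_eq_iff)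
  then show "v \<in> on_set K ` nd_fields k"
    using nd_fieldsI[OF f g p] by (rule image_eqI)
next
  fix v assume "v \<in> on_set K ` nd_fields k"
  then obtain u where u: "v = on_set K u" "u \<in> nd_fields k" by (rule imageE)
  obtain f g p where *: "u = (\<lambda>x. g x + cross3 x (p x))" "f \<in> pol (k + 1)" "is_grad f g" "p \<in> vpol 1"
    using u(2) by (rule nd_fieldsE)
  have "v = grad_in K (on_set K f) + (\<lambda>x. cross3 x (on_set K p x))"
    unfolding u(1) *(1) grad_in_eq[OF K *(3)] by (auto simp: on_set_def fun_eq_iff)
  moreover have "grad_in K (on_set K f) \<in> grad_in K ` poly_on (k + 1) K"
    using *(2) by (auto simp: poly_on_eq)
  moreover have "(\<lambda>x. cross3 x (on_set K p x)) \<in> (\<lambda>p x. cross3 x (p x)) ` vpoly_on 1 K"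
    using *(4) by (auto simp: vpoly_on_eq)
  ultimately show "v \<in> V_ND k K"
    unfolding V_ND_def by (simp only: set_plus_intro)
qed

text \<open>A pair (u, q) is only claimed to exist. That the field on K determines it follows from
  the unisolvence argument, in \<open>W_element_zero\<close>.\<close>

lemma W_eq:
  assumes K: "convex K" "interior K \<noteq> {}" and b: "bubble K = on_set K b"
  shows "W k K = {on_set K (\<lambda>x. u x + b x *\<^sub>R q x) | u q. u \<in> nd_fields k \<and> q \<in> vpol 1}" (is "_ = ?R")
proof (intro equalityI subsetI)
  fix v assume "v \<in> W k K"
  then obtain u q where uq: "u \<in> nd_fields k" "q \<in> vpol 1"
    and v: "v = on_set K u + (\<lambda>x. bubble K x *\<^sub>R on_set K q x)"
    unfolding W_def V_ND_eq[OF K] vpoly_on_eq by (elim set_plus_elim imageE) simp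
  have "v = on_set K (\<lambda>x. u x + b x *\<^sub>R q x)"
    by (auto simp: v b on_set_def fun_eq_iff)
  then show "v \<in> ?R" using uq
    by (intro CollectI exI conjI)
next
  fix v assume "v \<in> ?R"
  then obtain u q where uq: "v = on_set K (\<lambda>x. u x + b x *\<^sub>R q x)" "u \<in> nd_fields k" "q \<in> vpol 1"
    unfolding mem_Collect_eq by (elim exE conjE)
  have "v = on_set K u + (\<lambda>x. bubble K x *\<^sub>R on_set K q x)"
    by (auto simp: uq(1) b on_set_def fun_eq_iff)
  moreover have "(\<lambda>x. bubble K x *\<^sub>R on_set K q x) \<in> (\<lambda>p x. bubble K x *\<^sub>R p x) ` vpoly_on 1 K"
    using uq(3) by (auto simp: vpoly_on_eq)
  ultimately show "v \<in> W k K"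
    unfolding W_def V_ND_eq[OF K] using uq(2) by (simp only: set_plus_intro imageI)
qed

text \<open>The curl as a linear function of the derivative L, so that the product rule for
  derivatives carries over to it.\<close>

definition curlD :: "(real^3 \<Rightarrow> real^3) \<Rightarrow> real^3"
  where "curlD L = vector
    [L (axis 2 1) $ 3 - L (axis 3 1) $ 2, L (axis 3 1) $ 1 - L (axis 1 1) $ 3, L (axis 1 1) $ 2 - L (axis 2 1) $ 1]"

lemma curl_in_eq:
  assumes K: "convex K" "interior K \<noteq> {}" "x \<in> K"
    and V: "(V has_derivative V') (at x)"
  shows "curl_in K (on_set K V) x = curlD V'"
proof -
  have "partial_in K i (\<lambda>y. on_set K V y $ j) x = V' (axis i 1) $ j" for i j
  proof (rule partial_in_eq[OF K])
    show "((\<lambda>y. V y $ j) has_derivative (\<lambda>h. V' h $ j)) (at x)"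
      using V by (rule bounded_linear.has_derivative[OF bounded_linear_vec_nth])
  qed (simp add: on_set_def)
  then show ?thesis
    using K(3) by (simp add: curl_in_def curlD_def on_set_def)
qed

section \<open>Barycentric coordinates\<close>

text \<open>Four affinely independent points span the whole space affinely, so the coordinates exist
  at every point, not only in the simplex; their uniqueness makes them affine functions.\<close>

lemma barycentric_coordinates:
  fixes C :: "(real^3) set"
  assumes ind: "\<not> affine_dependent C" and card: "card C = 4"
  obtains l g where
    "\<And>x. (\<Sum>p\<in>C. l p x) = 1" "\<And>x. (\<Sum>p\<in>C. l p x *\<^sub>R p) = x"
    "\<And>u x p. sum u C = 1 \<Longrightarrow> (\<Sum>p\<in>C. u p *\<^sub>R p) = x \<Longrightarrow> p \<in> C \<Longrightarrow> l p x = u p"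
    "\<And>p x y. p \<in> C \<Longrightarrow> l p x - l p y = g p \<bullet> (x - y)"
proof -
  have fin: "finite C" using card by (simp add: card_ge_0_finite)
  have "affine hull C = UNIV"
    using affine_independent_span_eq[OF ind] card by simp
  then have "\<forall>x. \<exists>u. sum u C = 1 \<and> (\<Sum>p\<in>C. u p *\<^sub>R p) = x"
    using affine_hull_finite[OF fin] by auto
  then obtain U where "\<forall>x. sum (U x) C = 1 \<and> (\<Sum>p\<in>C. U x p *\<^sub>R p) = x"
    using choice[of "\<lambda>x u. sum u C = 1 \<and> (\<Sum>p\<in>C. u p *\<^sub>R p) = x"] by auto
  then have U: "\<And>x. sum (U x) C = 1" "\<And>x. (\<Sum>p\<in>C. U x p *\<^sub>R p) = x"
    by auto
  have uniq: "u p = w p" if "sum u C = sum w C" "(\<Sum>p\<in>C. u p *\<^sub>R p) = (\<Sum>p\<in>C. w p *\<^sub>R p)" "p \<in> C" for u w p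
  proof (rule ccontr)
    assume "u p \<noteq> w p"
    then have "(\<Sum>p\<in>C. u p - w p) = 0 \<and> (\<exists>p\<in>C. u p - w p \<noteq> 0) \<and> (\<Sum>p\<in>C. (u p - w p) *\<^sub>R p) = 0"
      using that by (auto simp: sum_subtractf scaleR_diff_left)
    then have "affine_dependent C"
      unfolding affine_dependent_explicit_finite[OF fin] by (rule exI[of _ "\<lambda>p. u p - w p"])
    with ind show False by contradiction
  qed
  define m where "m p x = U x p - U 0 p" for p x
  have lin: "linear (m p)" if p: "p \<in> C" for p
  proof (rule linearI)
    show "m p (x + y) = m p x + m p y" for x y
    proof -
      have "U (x + y) p = U x p + U y p - U 0 p"
        by (rule uniq[OF _ _ p, of "U (x + y)" "\<lambda>p. U x p + U y p - U 0 p"]) (simp_all add: U sum.distrib sum_subtractf scaleR_add_left scaleR_diff_left)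
      then show ?thesis by (simp add: m_def)
    qed
    show "m p (c *\<^sub>R x) = c *\<^sub>R m p x" for c x
    proof -
      have "(\<Sum>p\<in>C. (c * U x p + (1 - c) * U 0 p) *\<^sub>R p)
          = c *\<^sub>R (\<Sum>p\<in>C. U x p *\<^sub>R p) + (1 - c) *\<^sub>R (\<Sum>p\<in>C. U 0 p *\<^sub>R p)"
        by (simp add: scaleR_sum_right scaleR_add_left sum.distrib)
      moreover have "(\<Sum>p\<in>C. c * U x p + (1 - c) * U 0 p) = 1"
        by (simp add: U sum.distrib flip: sum_distrib_left)
      ultimately have "U (c *\<^sub>R x) p = c * U x p + (1 - c) * U 0 p"
        by (intro uniq[OF _ _ p, of "U (c *\<^sub>R x)" "\<lambda>p. c * U x p + (1 - c) * U 0 p"]) (simp_all add: U)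
      then show ?thesis by (simp add: m_def algebra_simps)
    qed
  qed
  \<comment> \<open>The vector \<open>adjoint (m p) 1\<close> represents the functional
    \<open>m p\<close>; it is the constant gradient of the coordinate.\<close>
  show ?thesis
  proof (rule that[of "\<lambda>p x. U x p" "\<lambda>p. adjoint (m p) 1"])
    show "U x p - U y p = adjoint (m p) 1 \<bullet> (x - y)" if "p \<in> C" for p x y
    proof -
      have "(x - y) \<bullet> adjoint (m p) 1 = m p x - m p y"
        using adjoint_works[OF lin[OF that], of "x - y" 1] linear_diff[OF lin[OF that]] by simp
      then show ?thesis by (simp add: m_def inner_commute)
    qed
    show "U x p = u p" if "sum u C = 1" "(\<Sum>p\<in>C. u p *\<^sub>R p) = x" "p \<in> C" for u x p
      using that by (intro uniq[of "U x" u]) (simp_all add: U)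
  qed (fact U)+
qed

text \<open>The vector \<open>g p\<close> is the gradient of the barycentric coordinate
  \<open>l p\<close>. Both are global, which makes the bubble a polynomial; for p outside C nothing
  is prescribed.\<close>

locale tetra =
  fixes C K :: "(real^3) set" and l :: "real^3 \<Rightarrow> real^3 \<Rightarrow> real" and g :: "real^3 \<Rightarrow> real^3"
  assumes ind: "\<not> affine_dependent C" and card: "card C = 4" and K: "K = convex hull C"
    and l_sum: "(\<Sum>p\<in>C. l p x) = 1" and l_repr: "(\<Sum>p\<in>C. l p x *\<^sub>R p) = x"
    and l_unique: "sum u C = 1 \<Longrightarrow> (\<Sum>p\<in>C. u p *\<^sub>R p) = x \<Longrightarrow> p \<in> C \<Longrightarrow> l p x = u p"
    and l_diff: "p \<in> C \<Longrightarrow> l p x - l p y = g p \<bullet> (x - y)"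
begin

lemma fin: "finite C" using card by (simp add: card_ge_0_finite)

lemma l_vertex: "p \<in> C \<Longrightarrow> q \<in> C \<Longrightarrow> l p q = (if p = q then 1 else 0)"
  using l_unique[of "\<lambda>p. if p = q then 1 else 0" q p] fin
  by (simp add: if_distrib[of "\<lambda>c. c *\<^sub>R _"] cong: if_cong)

lemma convex_K: "convex K" by (simp add: K)

lemma interior_K: "interior K \<noteq> {}"
  using interior_convex_hull_eq_empty[of C] ind card by (simp add: K)

lemma vertices_K: "vertices K = C"
  using extreme_point_of_convex_hull_affine_independent[OF ind] by (auto simp: vertices_def K)

definition bub :: "real^3 \<Rightarrow> real" where "bub x = (\<Prod>p\<in>C. l p x)"

lemma bubble_K: "bubble K = on_set K bub"
proof -
  have "barycentric K p x = l p x" if "p \<in> C" for p x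
    unfolding barycentric_def vertices_K
  proof (rule the_equality)
    show "\<exists>u. sum u C = 1 \<and> (\<Sum>b\<in>C. u b *\<^sub>R b) = x \<and> l p x = u p"
      by (rule exI[of _ "\<lambda>p. l p x"]) (simp add: l_sum l_repr)
    fix c assume "\<exists>u. sum u C = 1 \<and> (\<Sum>b\<in>C. u b *\<^sub>R b) = x \<and> c = u p"
    then obtain u where u: "sum u C = 1" "(\<Sum>b\<in>C. u b *\<^sub>R b) = x" "c = u p"
      by (elim exE conjE)
    show "c = l p x" using l_unique[OF u(1,2) that] u(3) by simp
  qed
  then show ?thesis
    unfolding bubble_def vertices_K bub_def by (intro on_set_cong prod.cong) auto
qed

lemma facet_iff: "F facet_of K \<longleftrightarrow> (\<exists>d\<in>C. F = convex hull (C - {d}))"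
  using facet_of_convex_hull_affine_independent_alt[OF ind, of F] card by (auto simp: K)

lemma edge_iff: "e edge_of K \<longleftrightarrow> (\<exists>c. c \<subseteq> C \<and> card c = 2 \<and> e = convex hull c)"
proof -
  have "aff_dim (convex hull c) = 1 \<longleftrightarrow> card c = 2" if "c \<subseteq> C" for c
  proof -
    have "aff_dim c = int (card c) - 1"
      using aff_dim_affine_independent[OF affine_independent_subset[OF ind that]] by simp
    then show ?thesis by (auto simp: aff_dim_convex_hull)
  qed
  then show ?thesis
    unfolding edge_of_def K face_of_convex_hull_affine_independent[OF ind] by auto
qed

end

section \<open>Integrals over edges and faces\<close>

text \<open>Euler's Beta integral at i + 1 and j + 1. The end points are excepted because
  \<open>0 powr 0\<close> is 0 while \<open>0 ^ 0\<close> is 1.\<close>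

lemma has_integral_power_mult_power:
  "((\<lambda>t::real. t ^ i * (1 - t) ^ j) has_integral (fact i * fact j / fact (i + j + 1))) {0..1}"
proof (rule has_integral_spike_finite)
  have "((\<lambda>t. t powr (real (Suc i) - 1) * (1 - t) powr (real (Suc j) - 1)) has_integral Beta (real (Suc i)) (real (Suc j))) {0..1}"
    by (rule has_integral_Beta_real) simp_all
  moreover have "Beta (real (Suc i)) (real (Suc j)) = fact i * fact j / fact (i + j + 1)"
    using Gamma_fact[of "i + j + 1", where 'a = real] Gamma_fact[of i, where 'a = real] Gamma_fact[of j, where 'a = real]
    by (simp add: Beta_def add_ac)
  ultimately show "((\<lambda>t. t powr real i * (1 - t) powr real j) has_integral (fact i * fact j / fact (i + j + 1))) {0..1}"
    by simp
  show "t ^ i * (1 - t) ^ j = t powr real i * (1 - t) powr real j" if "t \<in> {0..1} - {0, 1}" for t :: real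
    using that by (simp add: powr_realpow)
qed simp

section \<open>Moments over the unit triangle\<close>

definition std_triangle :: "(real \<times> real) set"
  where "std_triangle = {(s, r). 0 \<le> s \<and> 0 \<le> r \<and> s + r \<le> 1}"

text \<open>Dirichlet's formula, by Tonelli for the nonnegative integrand: the inner integral over r
  leaves \<open>s ^ i * (1 - s) ^ (j + 1) / (j + 1)\<close>, a Beta integral.\<close>

lemma has_integral_triangle_monomial:
  "((\<lambda>(s, r). s ^ i * r ^ j) has_integral (fact i * fact j / fact (i + j + 2))) std_triangle"
proof -
  define f :: "real \<times> real \<Rightarrow> real" where "f = (\<lambda>(s, r). s ^ i * r ^ j)"
  have T: "std_triangle \<in> sets borel"
  proof -
    have "std_triangle = {z. 0 \<le> fst z} \<inter> {z. 0 \<le> snd z} \<inter> {z. fst z + snd z \<le> 1}"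
      by (auto simp: std_triangle_def)
    also have "closed \<dots>" by (intro closed_Int closed_Collect_le continuous_intros)
    finally show ?thesis by (rule borel_closed)
  qed
  have [measurable]: "f \<in> borel_measurable borel"
    unfolding f_def case_prod_beta by (intro borel_measurable_continuous_onI continuous_intros)
  define F where "F = (\<lambda>z. indicator std_triangle z * f z)"
  have F: "F \<in> borel_measurable borel"
    unfolding F_def using T by measurable
  have pos: "0 \<le> F z" for z
    by (auto simp: F_def f_def std_triangle_def indicator_def)
  have inner: "(\<integral>\<^sup>+ r. ennreal (F (s, r)) \<partial>lborel) = ennreal (s ^ i * (1 - s) ^ (j + 1) / (j + 1)) * indicator {0..1} s" for s
  proof (cases "s \<in> {0..1}")
    case True
    have "((\<lambda>r. s ^ i * r ^ j) has_integral (s ^ i * ((1 - s) ^ (j + 1) / (j + 1) - 0 ^ (j + 1) / (j + 1)))) {0..1 - s}"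
    proof (intro has_integral_mult_right fundamental_theorem_of_calculus)
      show "((\<lambda>r. r ^ (j + 1) / (j + 1)) has_vector_derivative r ^ j) (at r within {0..1 - s})" for r
        using DERIV_cdivide[OF DERIV_pow[of "Suc j" r "{0..1 - s}"], of "real j + 1"]
        by (simp add: add.commute flip: has_real_derivative_iff_has_vector_derivative)
    qed (use True in auto)
    then have "(\<integral>\<^sup>+ r. ennreal (s ^ i * r ^ j) * indicator {0..1 - s} r \<partial>lborel) = ennreal (s ^ i * ((1 - s) ^ (j + 1) / (j + 1)))"
      using True by (intro nn_integral_has_integral_lebesgue') auto
    moreover have "ennreal (F (s, r)) = ennreal (s ^ i * r ^ j) * indicator {0..1 - s} r" for r
      using True by (auto simp: F_def f_def std_triangle_def indicator_def)
    ultimately show ?thesis using True by simp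
  next
    case False
    then have "F (s, r) = 0" for r
      by (auto simp: F_def std_triangle_def indicator_def)
    with False show ?thesis by simp
  qed
  have "(\<integral>\<^sup>+ z. ennreal (F z) \<partial>lborel) = (\<integral>\<^sup>+ z. ennreal (F z) \<partial>(lborel \<Otimes>\<^sub>M lborel))"
    by (simp add: lborel_prod)
  also have "\<dots> = (\<integral>\<^sup>+ s. \<integral>\<^sup>+ r. ennreal (F (s, r)) \<partial>lborel \<partial>lborel)"
    using F by (intro lborel.nn_integral_fst[symmetric]) (simp add: lborel_prod)
  also have "\<dots> = (\<integral>\<^sup>+ s. ennreal (s ^ i * (1 - s) ^ (j + 1) / (j + 1)) * indicator {0..1} s \<partial>lborel)"
    by (simp only: inner)
  also have "\<dots> = ennreal (fact i * fact (j + 1) / fact (i + (j + 1) + 1) / (j + 1))"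
    by (intro nn_integral_has_integral_lebesgue' has_integral_divide has_integral_power_mult_power) auto
  also have "fact i * fact (j + 1) / fact (i + (j + 1) + 1) / (j + 1) = (fact i * fact j / fact (i + j + 2) :: real)"
  proof -
    have "x * ((real j + 1) * y) / w / (real j + 1) = x * y / w" for x y w :: real
      by (simp add: divide_simps)
    moreover have "(fact (j + 1) :: real) = (real j + 1) * fact j" "i + (j + 1) + 1 = i + j + 2" "real (j + 1) = real j + 1"
      by (simp_all add: add.commute)
    ultimately show ?thesis by (simp only:)
  qed
  finally have "(F has_integral (fact i * fact j / fact (i + j + 2))) UNIV"
    using F pos by (intro nn_integral_has_integral) auto
  moreover have "F = (\<lambda>z. if z \<in> std_triangle then f z else 0)"
    by (auto simp: F_def indicator_def)
  ultimately have "(f has_integral (fact i * fact j / fact (i + j + 2))) std_triangle"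
    by (simp add: has_integral_restrict_UNIV)
  then show ?thesis by (simp add: f_def)
qed

lemma has_integral_triangle_polynomial:
  "((\<lambda>(s, r). \<Sum>(c, i, j)\<leftarrow>xs. c * (s ^ i * r ^ j)) has_integral
    (\<Sum>(c, i, j)\<leftarrow>xs. c * (fact i * fact j / fact (i + j + 2)))) std_triangle"
proof (induction xs)
  case Nil
  show ?case by (simp add: case_prod_beta)
next
  case (Cons x xs)
  obtain c i j where x: "x = (c, i, j)" by (cases x)
  from has_integral_add[OF has_integral_mult_right[OF has_integral_triangle_monomial[of i j], of c] Cons.IH]
  show ?case by (simp add: x case_prod_beta)
qed

text \<open>The barycentric coordinates of the unit triangle are 1 - s - r, s and r; a product of
  two different ones has integral 1/24.\<close>

lemma triangle_moment_quadratic: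
  "((\<lambda>(s, r). A * ((1 - s - r) * s) + B * ((1 - s - r) * r) + D * (s * r)) has_integral (A + B + D) / 24) std_triangle"
proof (rule has_integral_eq_rhs[OF has_integral_eq])
  show "((\<lambda>(s, r). \<Sum>(c, i, j)\<leftarrow>[(A,1,0), (B,0,1), (-A,2,0), (-B,0,2), (D-A-B,1,1)]. c * (s ^ i * r ^ j)) has_integral
    (\<Sum>(c, i, j)\<leftarrow>[(A,1,0), (B,0,1), (-A,2,0), (-B,0,2), (D-A-B,1,1)]. c * (fact i * fact j / fact (i + j + 2)))) std_triangle"
    by (rule has_integral_triangle_polynomial)
qed (auto simp: algebra_simps power2_eq_square fact_numeral add_divide_distrib diff_divide_distrib)

text \<open>The product of all three coordinates has integral 1/120, and a square times another
  coordinate has 2/120. The shape is that of a quadratic field without vertex coefficients,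
  multiplied by the position vector.\<close>

lemma triangle_moment_cubic:
  "((\<lambda>(s, r). (1 - s - r) * s * (A * s + A' * r) + (1 - s - r) * r * (B * s + B' * r) + s * r * (D * s + D' * r))
    has_integral (2 * A + A' + B + 2 * B' + 2 * D + 2 * D') / 120) std_triangle"
proof (rule has_integral_eq_rhs[OF has_integral_eq])
  show "((\<lambda>(s, r). \<Sum>(c, i, j)\<leftarrow>[(A,2,0), (A',1,1), (-A,3,0), (-A'-A,2,1), (-A',1,2), (B,1,1), (B',0,2), (-B,2,1), (-B'-B,1,2), (-B',0,3), (D,2,1), (D',1,2)]. c * (s ^ i * r ^ j)) has_integral
    (\<Sum>(c, i, j)\<leftarrow>[(A,2,0), (A',1,1), (-A,3,0), (-A'-A,2,1), (-A',1,2), (B,1,1), (B',0,2), (-B,2,1), (-B'-B,1,2), (-B',0,3), (D,2,1), (D',1,2)]. c * (fact i * fact j / fact (i + j + 2)))) std_triangle"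
    by (rule has_integral_triangle_polynomial)
qed (auto simp: algebra_simps power2_eq_square power3_eq_cube fact_numeral add_divide_distrib diff_divide_distrib)

text \<open>Weighted with the face bubble, 1 integrates to 1/120, s and r to 2/720, s^2 and r^2 to
  6/5040, and s r to 4/5040.\<close>

lemma triangle_moment_bubble:
  "((\<lambda>(s, r). s * r * (1 - s - r) * (A + B * s + B' * r + (D * (s * s) + D' * (s * r) + D'' * (r * r))))
    has_integral A / 120 + (B + B') / 360 + (6 * D + 4 * D' + 6 * D'') / 5040) std_triangle"
proof (rule has_integral_eq_rhs[OF has_integral_eq])
  show "((\<lambda>(s, r). \<Sum>(c, i, j)\<leftarrow>[(A,1,1), (-A,2,1), (-A,1,2), (B,2,1), (-B,3,1), (-B,2,2),
      (B',1,2), (-B',2,2), (-B',1,3), (D,3,1), (-D,4,1), (-D,3,2), (D',2,2), (-D',3,2), (-D',2,3),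
      (D'',1,3), (-D'',2,3), (-D'',1,4)]. c * (s ^ i * r ^ j)) has_integral
    (\<Sum>(c, i, j)\<leftarrow>[(A,1,1), (-A,2,1), (-A,1,2), (B,2,1), (-B,3,1), (-B,2,2),
      (B',1,2), (-B',2,2), (-B',1,3), (D,3,1), (-D,4,1), (-D,3,2), (D',2,2), (-D',3,2), (-D',2,3),
      (D'',1,3), (-D'',2,3), (-D'',1,4)]. c * (fact i * fact j / fact (i + j + 2)))) std_triangle"
    by (rule has_integral_triangle_polynomial)
qed (auto simp: algebra_simps power2_eq_square power3_eq_cube power4_eq_xxxx fact_numeral add_divide_distrib diff_divide_distrib)

lemma compact_triangle: "compact std_triangle"
proof -
  have "std_triangle = cbox (0, 0) (1, 1) \<inter> {z. fst z + snd z \<le> 1}"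
    by (auto simp: std_triangle_def cbox_Pair_eq)
  also have "compact \<dots>"
    by (intro compact_Int_closed compact_cbox closed_Collect_le continuous_intros)
  finally show ?thesis .
qed

lemma integrable_triangle:
  fixes f :: "real \<times> real \<Rightarrow> real"
  assumes "continuous_on std_triangle f"
  shows "f integrable_on std_triangle"
proof -
  have "set_integrable lborel std_triangle f"
    using borel_integrable_compact[OF compact_triangle assms]
    by (simp add: set_integrable_def indicator_scaleR_eq_if)
  then show ?thesis by (rule set_borel_integral_eq_integral)
qed

text \<open>The choice in \<open>edge_integral\<close> may orient the segment either way, so only
  the unordered pair of end points is known.\<close>

lemma edge_integral_segment:
  assumes "a \<noteq> b"
  obtains a' b' where "{a', b'} = {a, b}"
    "\<forall>f. edge_integral (closed_segment a b) f = dist a b * integral {0..1} (\<lambda>s. f (linepath a' b' s))"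
proof -
  define ab where "ab = (SOME (a', b'). closed_segment a b = closed_segment a' b')"
  obtain a' b' where ab': "ab = (a', b')" by (cases ab)
  have "case ab of (a', b') \<Rightarrow> closed_segment a b = closed_segment a' b'"
    unfolding ab_def by (rule someI[of _ "(a, b)"]) simp
  then have "{a', b'} = {a, b}" by (simp add: ab')
  moreover from this have "dist a' b' = dist a b"
    by (auto simp: doubleton_eq_iff dist_commute)
  ultimately show ?thesis
    using that[of a' b'] ab' unfolding ab_def edge_integral_def by simp
qed

context tetra
begin

text \<open>The names a, b, c belong to the triple that the choice in \<open>face_integral\<close>
  selects. A convex hull has its extreme points among its generators, so the triple consists of the
  three vertices of the face, in some order.\<close>

lemma face_eq: 
  assumes "d \<in> C"
  obtains a b c where "C = {a, b, c, d}" "distinct [a, b, c, d]"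
    "\<forall>f. face_integral (convex hull (C - {d})) f = norm (cross3 (b - a) (c - a)) *
        integral std_triangle (\<lambda>(s, r). f (a + s *\<^sub>R (b - a) + r *\<^sub>R (c - a)))"
proof -
  let ?F = "convex hull (C - {d})"
  have c3: "card (C - {d}) = 3" using assms card fin by simp
  define abc where "abc = (SOME (a, b, c). ?F = convex hull {a, b, c})"
  obtain a b c where abc: "abc = (a, b, c)" by (cases abc)
  obtain p q r where pqr: "C - {d} = {p, q, r}"
    using c3 by (auto simp: card_3_iff)
  have "case abc of (a, b, c) \<Rightarrow> ?F = convex hull {a, b, c}"
    unfolding abc_def by (rule someI[of _ "(p, q, r)"]) (simp add: pqr)
  then have F: "?F = convex hull {a, b, c}" by (simp add: abc)
  have ind': "\<not> affine_dependent (C - {d})"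
    using ind by (rule affine_independent_subset) auto
  have "C - {d} \<subseteq> {a, b, c}"
  proof
    fix x assume "x \<in> C - {d}"
    then have "x extreme_point_of ?F"
      using extreme_point_of_convex_hull_affine_independent[OF ind'] by simp
    then show "x \<in> {a, b, c}"
      unfolding F by (rule extreme_point_of_convex_hull)
  qed
  moreover have "card {a, b, c} \<le> 3" by (rule card_insert_le_m1) (auto simp: card_insert_if)
  ultimately have eq: "C - {d} = {a, b, c}"
    using c3 by (intro card_seteq) auto
  with assms have "C = {a, b, c, d}" by auto
  moreover have "distinct [a, b, c, d]"
    using c3 eq by (auto simp: card_insert_if split: if_splits)
  ultimately show ?thesis
    using that[of a b c] abc unfolding abc_def face_integral_def std_triangle_def by simp
qed

lemma cross3_neq_0:
  assumes "C = {a, b, c, d}" "distinct [a, b, c, d]"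
  shows "cross3 (b - a) (c - a) \<noteq> 0"
proof
  assume "cross3 (b - a) (c - a) = 0"
  then have "collinear {b, a, c}"
    by (subst collinear_3) (simp_all add: NO_MATCH_def cross_eq_0)
  moreover have "\<not> affine_dependent {b, a, c}"
    using assms by (intro affine_independent_subset[OF ind]) auto
  ultimately show False
    using assms(2) by (auto simp: collinear_3_eq_affine_dependent)
qed

end

section \<open>Blossoms of quadratic fields\<close>

text \<open>The symmetric biaffine polar form of a quadratic field. Its values at pairs of vertices are the
  Bernstein coefficients of the field.\<close>

definition blossom :: "(real^3 \<Rightarrow> real^3) \<Rightarrow> (real^3 \<Rightarrow> real^3 \<Rightarrow> real^3) \<Rightarrow> bool"
  where "blossom u U \<longleftrightarrow> (\<forall>x. u x = U x x) \<and> (\<forall>x y. U x y = U y x) \<and>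
    (\<exists>D. (\<forall>z. linear (\<lambda>h. D h z)) \<and> (\<forall>x y z. U x z - U y z = D (x - y) z))"

lemma blossom_diag: "blossom u U \<Longrightarrow> u x = U x x"
  by (simp add: blossom_def)

lemma blossom_sym: "blossom u U \<Longrightarrow> U x y = U y x"
  by (simp add: blossom_def)

lemma blossom_affine:
  assumes "blossom u U"
  shows "U (a + s *\<^sub>R (b - a) + r *\<^sub>R (c - a)) z = (1 - s - r) *\<^sub>R U a z + s *\<^sub>R U b z + r *\<^sub>R U c z"
proof -
  obtain D where lin: "\<forall>z. linear (\<lambda>h. D h z)" and D: "\<forall>x y z. U x z - U y z = D (x - y) z"
    using assms unfolding blossom_def by (elim conjE exE)
  have "U (a + s *\<^sub>R (b - a) + r *\<^sub>R (c - a)) z - U a z = D (s *\<^sub>R (b - a) + r *\<^sub>R (c - a)) z"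
    by (simp add: D)
  also have "\<dots> = s *\<^sub>R D (b - a) z + r *\<^sub>R D (c - a) z"
    using linear_add[OF lin[rule_format, of z]] linear_scale[OF lin[rule_format, of z]] by simp
  also have "\<dots> = s *\<^sub>R (U b z - U a z) + r *\<^sub>R (U c z - U a z)"
    by (simp add: D)
  finally show ?thesis by (simp add: algebra_simps)
qed

lemma blossom_sum:
  assumes "blossom u U" and "sum w C = 1"
  shows "U (\<Sum>p\<in>C. w p *\<^sub>R p) z = (\<Sum>p\<in>C. w p *\<^sub>R U p z)"
proof -
  obtain D where lin: "\<forall>z. linear (\<lambda>h. D h z)" and D: "\<forall>x y z. U x z - U y z = D (x - y) z"
    using assms unfolding blossom_def by (elim conjE exE)
  have "U (\<Sum>p\<in>C. w p *\<^sub>R p) z - U 0 z = D (\<Sum>p\<in>C. w p *\<^sub>R p) z"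
    by (simp add: D)
  also have "\<dots> = (\<Sum>p\<in>C. w p *\<^sub>R D p z)"
    using linear_sum[OF lin[rule_format, of z], of "\<lambda>p. w p *\<^sub>R p" C] linear_scale[OF lin[rule_format, of z]] by simp
  also have "\<dots> = (\<Sum>p\<in>C. w p *\<^sub>R (U p z - U 0 z))"
    by (simp add: D)
  also have "\<dots> = (\<Sum>p\<in>C. w p *\<^sub>R U p z) - U 0 z"
    using assms(2) by (simp add: algebra_simps sum_subtractf flip: scaleR_sum_left)
  finally show ?thesis by simp
qed

text \<open>Expanding x in the points of C, in one argument of U after the other, writes u x as a
  combination of the values U p q.\<close>

lemma blossom_eq_0:
  assumes u: "blossom u U" and C: "\<And>x. \<exists>w. sum w C = 1 \<and> (\<Sum>p\<in>C. w p *\<^sub>R p) = x"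
    and zero: "\<And>p q. p \<in> C \<Longrightarrow> q \<in> C \<Longrightarrow> U p q = 0"
  shows "u x = 0"
proof -
  obtain w where w: "sum w C = 1" "(\<Sum>p\<in>C. w p *\<^sub>R p) = x"
    using C[of x] by (elim exE conjE)
  have "U q x = 0" if "q \<in> C" for q
    using blossom_sum[OF u w(1), of q] zero that by (simp add: w(2) blossom_sym[OF u, of q])
  then have "U x x = 0"
    using blossom_sum[OF u w(1), of x] by (simp add: w(2))
  then show ?thesis by (simp add: blossom_diag[OF u])
qed

lemma rlin_linear: "linear (rlin P Q r s)"
  by (rule linearI) (auto simp: rlin_def vec_eq_iff forall_3 inner_simps algebra_simps)

text \<open>For k = 1 the second difference of U in the direction y - x is the cross product of y -
  x with another vector, hence orthogonal to y - x: the quadratic part does not contribute to the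
  tangential component along a line.\<close>

lemma nd_fields_blossom:
  assumes "k \<in> {1, 2}" "u \<in> nd_fields k"
  obtains U where "blossom u U" "k = 1 \<longrightarrow> (\<forall>x y. (U y y - 2 *\<^sub>R U y x + U x x) \<bullet> (y - x) = 0)"
proof (cases "k = 2")
  case True
  with assms obtain c and M Y Z :: "real^3^3" where u: "u = (\<lambda>x. c + M *v x + Y *v sqv x + Z *v crv x)"
    unfolding True nd_fields_2 vpol_2 mem_Collect_eq by (elim exE conjE)
  \<comment> \<open>The symmetric bilinear form of the quadratic part. A mixed product polarises to
    two terms, whence the factor 1/2 at Z.\<close>
  define B where "B x y = Y *v vector [x$1 * y$1, x$2 * y$2, x$3 * y$3]
    + (1/2) *\<^sub>R (Z *v vector [x$2 * y$3 + x$3 * y$2, x$1 * y$3 + x$3 * y$1, x$1 * y$2 + x$2 * y$1])" for x y :: "real^3"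
  define U where "U x y = c + (1/2) *\<^sub>R (M *v x + M *v y) + B x y" for x y
  have "blossom u U"
    unfolding blossom_def
  proof (intro conjI allI exI[of _ "\<lambda>h z. (1/2) *\<^sub>R (M *v h) + B h z"])
    show "u x = U x x" for x
      by (simp add: u U_def B_def vec_eq_iff forall_3 matrix_vector_mult_def sum_3 sqv_def crv_def algebra_simps)
    show "U x y = U y x" for x y
      by (simp add: U_def B_def add.commute mult.commute)
    show "linear (\<lambda>h. (1/2) *\<^sub>R (M *v h) + B h z)" for z
      by (rule linearI) (simp_all add: B_def vec_eq_iff forall_3 matrix_vector_mult_def sum_3 algebra_simps add_divide_distrib)
    show "U x z - U y z = (1/2) *\<^sub>R (M *v (x - y)) + B (x - y) z" for x y z
      by (simp add: U_def B_def vec_eq_iff forall_3 matrix_vector_mult_def sum_3 algebra_simps add_divide_distrib diff_divide_distrib)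
  qed
  then show ?thesis by (rule that) (use True in simp)
next
  case False
  with assms have k: "k = 1" by simp
  obtain c and M :: "real^3^3" and P Q r s where u: "u = (\<lambda>x. c + M *v x + cross3 x (rlin P Q r s x))"
    using assms(2) unfolding k nd_fields_1 mem_Collect_eq by (elim exE conjE)
  let ?\<rho> = "rlin P Q r s"
  note \<rho> = linear_add[OF rlin_linear, of P Q r s] linear_diff[OF rlin_linear, of P Q r s] linear_scale[OF rlin_linear, of P Q r s]
  define U where "U x y = c + (1/2) *\<^sub>R (M *v x + M *v y) + (1/2) *\<^sub>R (cross3 x (?\<rho> y) + cross3 y (?\<rho> x))" for x y
  have "blossom u U"
    unfolding blossom_def
  proof (intro conjI allI exI[of _ "\<lambda>h z. (1/2) *\<^sub>R (M *v h) + (1/2) *\<^sub>R (cross3 h (?\<rho> z) + cross3 z (?\<rho> h))"])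
    show "u x = U x x" for x
      by (simp add: u U_def flip: scaleR_2)
    show "U x y = U y x" for x y
      by (simp add: U_def add.commute)
    show "linear (\<lambda>h. (1/2) *\<^sub>R (M *v h) + (1/2) *\<^sub>R (cross3 h (?\<rho> z) + cross3 z (?\<rho> h)))" for z
      by (rule linearI) (simp_all add: \<rho> cross_add_left cross_add_right cross_mult_left cross_mult_right matrix_vector_right_distrib matrix_vector_mult_scaleR algebra_simps)
    show "U x z - U y z = (1/2) *\<^sub>R (M *v (x - y)) + (1/2) *\<^sub>R (cross3 (x - y) (?\<rho> z) + cross3 z (?\<rho> (x - y)))" for x y z
      by (simp add: U_def \<rho> Cross3.left_diff_distrib Cross3.right_diff_distrib matrix_vector_mult_diff_distrib algebra_simps)
  qed
  moreover have "(U y y - 2 *\<^sub>R U y x + U x x) \<bullet> (y - x) = 0" for x y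
  proof -
    have "U y y - 2 *\<^sub>R U y x + U x x = cross3 (y - x) (?\<rho> (y - x))"
      by (simp add: U_def \<rho> Cross3.left_diff_distrib Cross3.right_diff_distrib vec_eq_iff algebra_simps)
    then show ?thesis by (simp add: dot_cross_self)
  qed
  ultimately show ?thesis using that[of U] by simp
qed

text \<open>The last hypothesis has two alternatives: the additional moment available for \<open>k = 2\<close>, or the
  property of the fields for \<open>k = 1\<close> that their quadratic part \<open>B\<close> satisfies \<open>B d d \<bullet> d = 0\<close>. The latter is
  used for the direction \<open>d = a + b - 2 c\<close>, along which the cubic face bubble has degree 3.\<close>

lemma face_nd_zero:
  assumes u: "blossom u U"
    and vertex: "U a a = 0" "U b b = 0" "U c c = 0"
    and edge: "U a b \<bullet> (b - a) = 0" "U a c \<bullet> (c - a) = 0" "U b c \<bullet> (c - b) = 0"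
    and const: "\<And>\<delta>. \<delta> \<in> {b - a, c - a} \<Longrightarrow>
      integral std_triangle (\<lambda>(s, r). u (a + s *\<^sub>R (b - a) + r *\<^sub>R (c - a)) \<bullet> \<delta>) = 0"
    and pos: "integral std_triangle (\<lambda>(s, r). u (a + s *\<^sub>R (b - a) + r *\<^sub>R (c - a)) \<bullet> (s *\<^sub>R (b - a) + r *\<^sub>R (c - a))) = 0
      \<or> (\<forall>x y. (U y y - 2 *\<^sub>R U y x + U x x) \<bullet> (y - x) = 0)"
  shows "U a b \<bullet> (c - a) = 0" "U a c \<bullet> (b - a) = 0" "U b c \<bullet> (b - a) = 0"
proof -
  \<comment> \<open>The Bernstein expansion on the face: the vertex coefficients vanish, and each
    mixed one occurs twice by symmetry.\<close>
  have exp: "u (a + s *\<^sub>R (b - a) + r *\<^sub>R (c - a)) =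
      (2 * ((1 - s - r) * s)) *\<^sub>R U a b + (2 * ((1 - s - r) * r)) *\<^sub>R U a c + (2 * (s * r)) *\<^sub>R U b c" for s r
  proof -
    let ?x = "a + s *\<^sub>R (b - a) + r *\<^sub>R (c - a)"
    have *: "U p ?x = (1 - s - r) *\<^sub>R U a p + s *\<^sub>R U b p + r *\<^sub>R U c p" for p
      using blossom_affine[OF u, of a s b r c p] by (simp add: blossom_sym[OF u, of p])
    have "u ?x = (1 - s - r) *\<^sub>R U a ?x + s *\<^sub>R U b ?x + r *\<^sub>R U c ?x"
      using blossom_affine[OF u, of a s b r c ?x] by (simp add: blossom_diag[OF u])
    also have "\<dots> = (2 * ((1 - s - r) * s)) *\<^sub>R U a b + (2 * ((1 - s - r) * r)) *\<^sub>R U a c + (2 * (s * r)) *\<^sub>R U b c"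
      unfolding * by (simp add: vertex blossom_sym[OF u, of b a] blossom_sym[OF u, of c a] blossom_sym[OF u, of c b] vec_eq_iff algebra_simps)
    finally show ?thesis .
  qed
  have int_const: "integral std_triangle (\<lambda>(s, r). u (a + s *\<^sub>R (b - a) + r *\<^sub>R (c - a)) \<bullet> \<delta>)
      = (U a b \<bullet> \<delta> + U a c \<bullet> \<delta> + U b c \<bullet> \<delta>) / 12" for \<delta>
  proof -
    have "((\<lambda>(s, r). u (a + s *\<^sub>R (b - a) + r *\<^sub>R (c - a)) \<bullet> \<delta>) has_integral
      (2 * (U a b \<bullet> \<delta>) + 2 * (U a c \<bullet> \<delta>) + 2 * (U b c \<bullet> \<delta>)) / 24) std_triangle"
      by (rule has_integral_eq[OF _ triangle_moment_quadratic]) (simp only: split_paired_all prod.case exp inner_add_left inner_add_right inner_diff_left inner_scaleR_left inner_scaleR_right, simp add: algebra_simps)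
    then show ?thesis by (simp add: integral_unique)
  qed
  have b_a: "U a c \<bullet> (b - a) + U b c \<bullet> (b - a) = 0"
    using const[of "b - a"] edge by (simp add: int_const)
  have c_a: "U a b \<bullet> (c - a) + U b c \<bullet> (c - a) = 0"
    using const[of "c - a"] edge by (simp add: int_const)
  have bc: "U b c \<bullet> (c - a) = U b c \<bullet> (b - a)"
    using edge(3) by (simp add: inner_simps)
  have ab: "U a b \<bullet> b = U a b \<bullet> a" and ac: "U a c \<bullet> c = U a c \<bullet> a"
    using edge(1,2) by (simp_all add: inner_simps)
  from pos have "U b c \<bullet> (b - a) = 0"
  proof
    assume "integral std_triangle (\<lambda>(s, r). u (a + s *\<^sub>R (b - a) + r *\<^sub>R (c - a)) \<bullet> (s *\<^sub>R (b - a) + r *\<^sub>R (c - a))) = 0"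
    moreover have "((\<lambda>(s, r). u (a + s *\<^sub>R (b - a) + r *\<^sub>R (c - a)) \<bullet> (s *\<^sub>R (b - a) + r *\<^sub>R (c - a))) has_integral
      (2 * (2 * (U a b \<bullet> (b - a))) + 2 * (U a b \<bullet> (c - a)) + 2 * (U a c \<bullet> (b - a)) + 2 * (2 * (U a c \<bullet> (c - a)))
       + 2 * (2 * (U b c \<bullet> (b - a))) + 2 * (2 * (U b c \<bullet> (c - a)))) / 120) std_triangle"
      by (rule has_integral_eq[OF _ triangle_moment_cubic]) (simp only: split_paired_all prod.case exp inner_add_left inner_add_right inner_diff_left inner_scaleR_left inner_scaleR_right, simp add: algebra_simps)
    ultimately have "2 * (U a b \<bullet> (c - a)) + 2 * (U a c \<bullet> (b - a)) + 4 * (U b c \<bullet> (b - a)) + 4 * (U b c \<bullet> (c - a)) = 0"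
      using edge by (simp add: integral_unique)
    \<comment> \<open>Let \<gamma> be the common product of \<open>U b c\<close> with b - a and c -
      a. By the moments against constants the other two products are - \<gamma>, so the left-hand
      side is 4 \<gamma>.\<close>
    then show ?thesis using b_a c_a bc by linarith
  next
    assume nd: "\<forall>x y. (U y y - 2 *\<^sub>R U y x + U x x) \<bullet> (y - x) = 0"
    \<comment> \<open>That is y = a + b - c, with affine weights 1, 1, -1, and y - c = a + b - 2
      c.\<close>
    define y where "y = c + 1 *\<^sub>R (a - c) + 1 *\<^sub>R (b - c)"
    have *: "U y z = U a z + U b z - U c z" for z
      unfolding y_def by (subst blossom_affine[OF u]) simp
    have "U y y = 2 *\<^sub>R U a b - 2 *\<^sub>R U a c - 2 *\<^sub>R U b c"
      unfolding *[of y] blossom_sym[OF u, of a y] blossom_sym[OF u, of b y] blossom_sym[OF u, of c y] *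
      by (simp add: vertex blossom_sym[OF u, of b a] blossom_sym[OF u, of c a] blossom_sym[OF u, of c b] vec_eq_iff)
    moreover have "U y c = U a c + U b c"
      by (simp add: * vertex)
    ultimately have "U y y - 2 *\<^sub>R U y c + U c c = 2 *\<^sub>R U a b - 4 *\<^sub>R U a c - 4 *\<^sub>R U b c"
      by (simp add: vertex vec_eq_iff)
    with nd[rule_format, of y c]
    have "(2 *\<^sub>R U a b - 4 *\<^sub>R U a c - 4 *\<^sub>R U b c) \<bullet> (y - c) = 0"
      by (simp only:)
    then have "(2 *\<^sub>R U a b - 4 *\<^sub>R U a c - 4 *\<^sub>R U b c) \<bullet> ((a - c) + (b - c)) = 0"
      by (simp add: y_def)
    \<comment> \<open>If \<gamma> again denotes the common product of \<open>U b c\<close> with b -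
      a and c - a, the left-hand side is 12 \<gamma>.\<close>
    then show ?thesis
      using b_a c_a bc ab ac
      unfolding inner_diff_left inner_add_right inner_diff_right inner_scaleR_left by linarith
  qed
  then show "U a b \<bullet> (c - a) = 0" "U a c \<bullet> (b - a) = 0" "U b c \<bullet> (b - a) = 0"
    using b_a c_a bc by linarith+
qed

lemma face_bubble_zero:
  assumes q: "\<And>s r. q (a + s *\<^sub>R (b - a) + r *\<^sub>R (c - a)) = (1 - s - r) *\<^sub>R q a + s *\<^sub>R q b + r *\<^sub>R q c"
    and const: "\<And>\<delta>. \<delta> \<in> {b - a, c - a} \<Longrightarrow>
      integral std_triangle (\<lambda>(s, r). s * r * (1 - s - r) * (q (a + s *\<^sub>R (b - a) + r *\<^sub>R (c - a)) \<bullet> \<delta>)) = 0"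
    and pos: "integral std_triangle (\<lambda>(s, r). s * r * (1 - s - r) *
      (q (a + s *\<^sub>R (b - a) + r *\<^sub>R (c - a)) \<bullet> (s *\<^sub>R (b - a) + r *\<^sub>R (c - a)))) = 0"
  shows "(q a + q b + q c) \<bullet> (b - a) = 0" "(q a + q b + q c) \<bullet> (c - a) = 0"
    "q b \<bullet> (b - a) + q c \<bullet> (c - a) = 0"
proof -
  have int_const: "integral std_triangle (\<lambda>(s, r). s * r * (1 - s - r) * (q (a + s *\<^sub>R (b - a) + r *\<^sub>R (c - a)) \<bullet> \<delta>))
      = (q a + q b + q c) \<bullet> \<delta> / 360" for \<delta>
  proof -
    have int: "((\<lambda>(s, r). s * r * (1 - s - r) * (q (a + s *\<^sub>R (b - a) + r *\<^sub>R (c - a)) \<bullet> \<delta>)) has_integral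
      (q a \<bullet> \<delta>) / 120 + ((q b - q a) \<bullet> \<delta> + (q c - q a) \<bullet> \<delta>) / 360 + (6 * 0 + 4 * 0 + 6 * 0) / 5040) std_triangle"
      by (rule has_integral_eq[OF _ triangle_moment_bubble]) (simp only: split_paired_all prod.case q inner_add_left inner_add_right inner_diff_left inner_scaleR_left inner_scaleR_right, simp add: algebra_simps)
    show ?thesis
      unfolding integral_unique[OF int] inner_add_left inner_diff_left
      by (simp add: add_divide_distrib diff_divide_distrib)
  qed
  show *: "(q a + q b + q c) \<bullet> (b - a) = 0" "(q a + q b + q c) \<bullet> (c - a) = 0"
    using const[of "b - a"] const[of "c - a"] by (simp_all add: int_const)
  have "((\<lambda>(s, r). s * r * (1 - s - r) *
      (q (a + s *\<^sub>R (b - a) + r *\<^sub>R (c - a)) \<bullet> (s *\<^sub>R (b - a) + r *\<^sub>R (c - a)))) has_integral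
      0 / 120 + (q a \<bullet> (b - a) + q a \<bullet> (c - a)) / 360 + (6 * ((q b - q a) \<bullet> (b - a)) +
      4 * ((q b - q a) \<bullet> (c - a) + (q c - q a) \<bullet> (b - a)) + 6 * ((q c - q a) \<bullet> (c - a))) / 5040) std_triangle"
    by (rule has_integral_eq[OF _ triangle_moment_bubble]) (simp only: split_paired_all prod.case q inner_add_left inner_add_right inner_diff_left inner_scaleR_left inner_scaleR_right, simp add: algebra_simps)
  with pos have "0 = (q a \<bullet> (b - a) + q a \<bullet> (c - a)) / 360 + (6 * ((q b - q a) \<bullet> (b - a)) +
      4 * ((q b - q a) \<bullet> (c - a) + (q c - q a) \<bullet> (b - a)) + 6 * ((q c - q a) \<bullet> (c - a))) / 5040"
    by (simp add: integral_unique)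
  \<comment> \<open>After multiplication by 5040 the right-hand side is four times the sum of the
    two expressions in \<open>*\<close> plus twice the expression claimed to vanish.\<close>
  with * show "q b \<bullet> (b - a) + q c \<bullet> (c - a) = 0"
    unfolding inner_add_left inner_diff_left by argo
qed

section \<open>Curls and test fields\<close>

text \<open>Continuity of the derivative is there for the curl: its integrals over the faces must
  exist before they can be subtracted.\<close>

lemma vpol_C1:
  assumes "V \<in> vpol m"
  obtains V' where "\<forall>x. (V has_derivative V' x) (at x)" "\<forall>h. continuous_on UNIV (\<lambda>x. V' x h)"
proof -
  have cont: "continuous_on UNIV f" if f: "f \<in> pol m" for f m
  proof -
    obtain g where "is_grad f g" "g \<in> vpol (m - 1)" using f by (rule pol_grad)
    then show ?thesis
      unfolding is_grad_def by (intro continuous_at_imp_continuous_on ballI has_derivative_continuous) auto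
  qed
  have "\<forall>i. \<exists>g\<in>vpol (m - 1). is_grad (\<lambda>x. V x $ i) g"
  proof
    fix i
    have "(\<lambda>x. V x $ i) \<in> pol m" using assms by (simp add: vpol_def)
    then obtain g where "is_grad (\<lambda>x. V x $ i) g" "g \<in> vpol (m - 1)" by (rule pol_grad)
    then show "\<exists>g\<in>vpol (m - 1). is_grad (\<lambda>x. V x $ i) g" by (intro bexI)
  qed
  then have "\<exists>G. \<forall>i. G i \<in> vpol (m - 1) \<and> is_grad (\<lambda>x. V x $ i) (G i)"
    unfolding Bex_def by (rule choice)
  then obtain G where "\<forall>i. G i \<in> vpol (m - 1) \<and> is_grad (\<lambda>x. V x $ i) (G i)" by (rule exE)
  then have G: "\<And>i. G i \<in> vpol (m - 1)" "\<And>i. is_grad (\<lambda>x. V x $ i) (G i)" by simp_all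
  show ?thesis
  proof (rule that[of "\<lambda>x h. \<chi> i. G i x \<bullet> h"]; rule allI)
    show "(V has_derivative (\<lambda>h. \<chi> i. G i x \<bullet> h)) (at x)" for x
      unfolding has_derivative_componentwise_within[of V]
      using G(2) by (auto simp: is_grad_def Basis_vec_def inner_axis)
    show "continuous_on UNIV (\<lambda>x. \<chi> i. G i x \<bullet> h)" for h
    proof (intro continuous_intros)
      have "continuous_on UNIV (\<lambda>x. G i x $ j)" for i j
        by (rule cont[of _ "m - 1"]) (use G(1)[of i] in \<open>simp add: vpol_def\<close>)
      then have "continuous_on UNIV (\<lambda>x. \<chi> j. G i x $ j)" for i
        by (rule continuous_on_vec_lambda)
      then show "continuous_on UNIV (\<lambda>x. G i x)" for i
        by simp
    qed
  qed
qed

lemma vpol_continuous: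
  assumes "V \<in> vpol m" shows "continuous_on S V"
proof -
  obtain V' where "\<forall>x. (V has_derivative V' x) (at x)"
    using assms by (rule vpol_C1)
  then have "\<And>x. (V has_derivative V' x) (at x)" by simp
  then show ?thesis
    by (intro continuous_at_imp_continuous_on ballI has_derivative_continuous)
qed

definition curlP :: "(real^3 \<Rightarrow> real^3) \<Rightarrow> real^3 \<Rightarrow> real^3"
  where "curlP V x = curlD (frechet_derivative V (at x))"

lemma curlP_eq: "(V has_derivative V') (at x) \<Longrightarrow> curlP V x = curlD V'"
  unfolding curlP_def using frechet_derivative_at[of V V' x] by simp

lemma curlD_diff: "curlD (\<lambda>h. L h - L' h) = curlD L - curlD L'"
  by (simp add: curlD_def vec_eq_iff forall_3)

lemma curlP_diff:
  assumes "V \<in> vpol m" "Y \<in> vpol m"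
  shows "curlP (\<lambda>x. V x - Y x) x = curlP V x - curlP Y x"
proof -
  obtain V' where "\<forall>x. (V has_derivative V' x) (at x)" using assms(1) by (rule vpol_C1)
  then have V: "\<And>x. (V has_derivative V' x) (at x)" by simp
  obtain Y' where "\<forall>x. (Y has_derivative Y' x) (at x)" using assms(2) by (rule vpol_C1)
  then have W: "\<And>x. (Y has_derivative Y' x) (at x)" by simp
  show ?thesis
    by (simp add: curlP_eq[OF V] curlP_eq[OF W] curlP_eq[OF has_derivative_diff[OF V W]] curlD_diff)
qed

lemma curlP_continuous:
  assumes "V \<in> vpol m" shows "continuous_on S (curlP V)"
proof -
  obtain V' where "\<forall>x. (V has_derivative V' x) (at x)" and "\<forall>h. continuous_on UNIV (\<lambda>x. V' x h)"
    using assms by (rule vpol_C1)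
  then have V: "\<And>x. (V has_derivative V' x) (at x)" and c: "\<And>h. continuous_on UNIV (\<lambda>x. V' x h)"
    by simp_all
  have "continuous_on UNIV (\<lambda>x. curlD (V' x) $ i)" for i
    unfolding curlD_def using exhaust_3[of i] by (elim disjE; simp; intro continuous_intros c)
  then have "continuous_on UNIV (\<lambda>x. \<chi> i. curlD (V' x) $ i)"
    by (rule continuous_on_vec_lambda)
  moreover have "curlP V = (\<lambda>x. curlD (V' x))"
    by (simp add: fun_eq_iff curlP_eq[OF V])
  ultimately show ?thesis
    by (auto intro: continuous_on_subset)
qed

section \<open>Test fields on a face\<close>

lemma tpoly_const:
  assumes "\<delta> \<bullet> n = 0"
  shows "on_set F (\<lambda>_. \<delta>) \<in> tpoly_on 0 F n"
  unfolding tpoly_on_def vpoly_on_eq mem_Collect_eq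
  by (intro conjI imageI const_vpol ballI) (simp_all add: on_set_def assms)

lemma zero_poly_on: "0 \<in> poly_on m F"
  unfolding poly_on_def by (rule span_zero)

text \<open>The field is rotated by n because (v \<times> n) . (n \<times> \<delta>) = - v .
  \<delta> for a unit normal n and tangential \<delta>: the functional becomes a moment of v
  itself.\<close>

lemma RM_const:
  assumes "\<delta> \<bullet> n = 0"
  shows "on_set F (\<lambda>_. cross3 n \<delta>) \<in> RM m F n"
proof -
  have "on_set F (\<lambda>_. cross3 n \<delta>) + (\<lambda>x. (0 :: _ \<Rightarrow> real) x *\<^sub>R cross3 n x) \<in> RM m F n"
    unfolding RM_def
    by (intro set_plus_intro tpoly_const imageI zero_poly_on) (simp add: dot_cross_self)
  then show ?thesis by (simp add: plus_fun_def zero_fun_def)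
qed

lemma RT_const:
  assumes "\<delta> \<bullet> n = 0"
  shows "on_set F (\<lambda>_. \<delta>) \<in> RT F n"
proof -
  have "on_set F (\<lambda>_. \<delta>) + (\<lambda>x. (0 :: _ \<Rightarrow> real) x *\<^sub>R (x - (x \<bullet> n) *\<^sub>R n)) \<in> RT F n"
    unfolding RT_def
    by (intro set_plus_intro tpoly_const imageI zero_poly_on assms)
  then show ?thesis by (simp add: plus_fun_def zero_fun_def)
qed

lemma on_set_1_poly_on: "on_set F (\<lambda>_. 1) \<in> poly_on 0 F"
  unfolding poly_on_eq by (intro imageI pol_const) simp

text \<open>Moving the origin to a changes the rotated position field by a tangential constant. The
  degree 0 is k - 2 for k = 2.\<close>

lemma RM_pos: "on_set F (\<lambda>x. cross3 n (x - a)) \<in> RM 0 F n"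
proof -
  have "on_set F (\<lambda>_. - cross3 n a) + (\<lambda>x. on_set F (\<lambda>_. 1) x *\<^sub>R cross3 n x) \<in> RM 0 F n"
    unfolding RM_def
    by (intro set_plus_intro tpoly_const imageI on_set_1_poly_on) (simp add: dot_cross_self)
  also have "on_set F (\<lambda>_. - cross3 n a) + (\<lambda>x. on_set F (\<lambda>_. 1) x *\<^sub>R cross3 n x) = on_set F (\<lambda>x. cross3 n (x - a))"
    by (auto simp: on_set_def fun_eq_iff Cross3.right_diff_distrib)
  finally show ?thesis .
qed

text \<open>On the plane of F the normal part of x is the constant (a . n) n, so x - a differs from
  the in-plane position vector by a tangential constant.\<close>

lemma RT_pos:
  assumes "n \<bullet> n = 1" "\<And>x. x \<in> F \<Longrightarrow> x \<bullet> n = a \<bullet> n"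
  shows "on_set F (\<lambda>x. x - a) \<in> RT F n"
proof -
  have "on_set F (\<lambda>_. (a \<bullet> n) *\<^sub>R n - a) + (\<lambda>x. on_set F (\<lambda>_. 1) x *\<^sub>R (x - (x \<bullet> n) *\<^sub>R n)) \<in> RT F n"
    unfolding RT_def
    by (intro set_plus_intro tpoly_const imageI on_set_1_poly_on) (simp add: inner_simps assms(1))
  also have "on_set F (\<lambda>_. (a \<bullet> n) *\<^sub>R n - a) + (\<lambda>x. on_set F (\<lambda>_. 1) x *\<^sub>R (x - (x \<bullet> n) *\<^sub>R n)) = on_set F (\<lambda>x. x - a)"
    by (auto simp: on_set_def fun_eq_iff assms(2))
  finally show ?thesis .
qed

lemma nd_fields_subset: "k \<in> {1, 2} \<Longrightarrow> nd_fields k \<subseteq> vpol 2"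
proof -
  have "nd_fields 1 \<subseteq> vpol 2"
  proof
    fix u assume "u \<in> nd_fields 1"
    then obtain f g p where u: "u = (\<lambda>x. g x + cross3 x (p x))" "f \<in> pol (1 + 1)" "is_grad f g" "p \<in> vpol 1"
      by (rule nd_fieldsE)
    have "f \<in> pol (2 + 1)" using u(2) by (rule subsetD[OF pol_mono, rotated]) simp
    from nd_fieldsI[OF this u(3,4)] show "u \<in> vpol 2"
      unfolding u(1) nd_fields_2 .
  qed
  moreover assume "k \<in> {1, 2}"
  ultimately show "nd_fields k \<subseteq> vpol 2"
    using nd_fields_2 by (elim insertE emptyE) simp_all
qed

lemma inner_vpol:
  assumes "V \<in> vpol m" "0 \<le> m"
  shows "(\<lambda>x. \<tau> \<bullet> V x) \<in> pol m"
proof -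
  have "(\<lambda>x. \<Sum>i\<in>UNIV. \<tau> $ i * V x $ i) \<in> pol m"
    using assms by (intro pol_sum pol_scale) (simp_all add: vpol_def)
  then show ?thesis by (simp add: inner_vec_def)
qed

text \<open>This makes the tangential component itself an admissible test function on an edge. For k
  = 1 the point a + s \<tau> contributes no factor s to the cross product term, as \<tau> \<times> p
  is orthogonal to \<tau>.\<close>

lemma nd_field_tangential:
  assumes k: "k \<in> {1, 2}" and nd: "u \<in> nd_fields k"
  obtains f where "f \<in> pol k" "\<forall>s. f (a + s *\<^sub>R \<tau>) = u (a + s *\<^sub>R \<tau>) \<bullet> \<tau>"
proof (cases "k = 2")
  case True
  show ?thesis
  proof (rule that)
    show "(\<lambda>x. \<tau> \<bullet> u x) \<in> pol k"
      using nd unfolding True nd_fields_2 by (rule inner_vpol) simp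
  qed (simp add: inner_commute)
next
  case False
  with k have k1: "k = 1" by simp
  obtain f g p where u: "u = (\<lambda>x. g x + cross3 x (p x))" "f \<in> pol (1 + 1)" "is_grad f g" "p \<in> vpol 1"
    using nd unfolding k1 by (rule nd_fieldsE)
  obtain g' where g': "is_grad f g'" "g' \<in> vpol (1 + 1 - 1)" using u(2) by (rule pol_grad)
  then have g: "g \<in> vpol 1" using is_grad_unique[OF g'(1) u(3)] by simp
  have c: "(\<lambda>x. cross3 a (p x)) \<in> vpol 1"
    using cross3_vpol[OF const_vpol[of 0 a] u(4)] by simp
  show ?thesis
  proof (rule that)
    show "(\<lambda>x. \<tau> \<bullet> (g + (\<lambda>x. cross3 a (p x))) x) \<in> pol k"
      unfolding k1 by (intro inner_vpol subspace_add[OF subspace_vpol] g c) simp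
    have "cross3 (a + s *\<^sub>R \<tau>) z \<bullet> \<tau> = cross3 a z \<bullet> \<tau>" for s z
      by (simp add: cross_add_left cross_mult_left inner_add_left dot_cross_self)
    then show "\<forall>s. \<tau> \<bullet> (g + (\<lambda>x. cross3 a (p x))) (a + s *\<^sub>R \<tau>) = u (a + s *\<^sub>R \<tau>) \<bullet> \<tau>"
      by (simp add: u(1) inner_add_left inner_commute[of \<tau>])
  qed
qed

section \<open>Barycentric coordinates and the bubble as polynomials\<close>

context tetra
begin

lemma l_affine:
  "p \<in> C \<Longrightarrow> l p (a + s *\<^sub>R (b - a) + r *\<^sub>R (c - a)) = (1 - s - r) * l p a + s * l p b + r * l p c"
proof -
  assume p: "p \<in> C"
  let ?x = "a + s *\<^sub>R (b - a) + r *\<^sub>R (c - a)"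
  have "l p ?x - l p a = g p \<bullet> (s *\<^sub>R (b - a) + r *\<^sub>R (c - a))"
    using l_diff[OF p, of ?x a] by simp
  also have "\<dots> = s * (l p b - l p a) + r * (l p c - l p a)"
    unfolding l_diff[OF p] by (simp add: inner_add_right)
  finally have "l p ?x = l p a + (s * (l p b - l p a) + r * (l p c - l p a))"
    by linarith
  also have "\<dots> = (1 - s - r) * l p a + s * l p b + r * l p c"
    by (simp add: algebra_simps)
  finally show ?thesis .
qed

text \<open>The edge vectors at p span the space: the barycentric coordinates of p + y express y
  through them.\<close>

lemma orth_zero:
  assumes "p \<in> C" "\<And>r. r \<in> C \<Longrightarrow> y \<bullet> (r - p) = 0"
  shows "y = 0"
proof -
  have "y = (\<Sum>r\<in>C. l r (p + y) *\<^sub>R r) - (\<Sum>r\<in>C. l r (p + y)) *\<^sub>R p"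
    by (simp add: l_repr l_sum)
  also have "\<dots> = (\<Sum>r\<in>C. l r (p + y) *\<^sub>R (r - p))"
    by (simp add: scaleR_diff_right sum_subtractf scaleR_sum_left)
  finally have "y \<bullet> y = y \<bullet> (\<Sum>r\<in>C. l r (p + y) *\<^sub>R (r - p))" by simp
  also have "\<dots> = 0" using assms(2) by (simp add: inner_sum_right)
  finally show ?thesis by simp
qed

lemma l_eq:
  assumes "p \<in> C"
  shows "(\<lambda>x. l p 0 + g p \<bullet> x) = l p"
proof
  show "l p 0 + g p \<bullet> x = l p x" for x
    using l_diff[OF assms, of x 0] by (simp only: diff_zero)
qed

lemma l_pol:
  assumes "p \<in> C"
  shows "l p \<in> pol 1"
proof -
  have "(\<lambda>x. l p 0 + g p \<bullet> x) \<in> pol 1"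
    by (intro pol_add pol_const pol_inner) auto
  then show ?thesis unfolding l_eq[OF assms] .
qed

lemma bub_pol: "bub \<in> pol 4"
proof -
  have "finite A \<Longrightarrow> A \<subseteq> C \<Longrightarrow> (\<lambda>x. \<Prod>p\<in>A. l p x) \<in> pol (int (card A))" for A
  proof (induction A rule: finite_induct)
    case empty
    then show ?case by (simp add: pol_const)
  next
    case (insert p A)
    then have "(\<lambda>x. l p x * (\<Prod>p\<in>A. l p x)) \<in> pol (1 + int (card A))"
      by (intro pol_mult l_pol) auto
    with insert show ?case by simp
  qed
  from this[OF fin subset_refl] show ?thesis by (simp add: bub_def[abs_def] card)
qed

lemma W_vpol:
  assumes "k \<in> {1, 2}" "u \<in> nd_fields k" "q \<in> vpol 1"
  shows "(\<lambda>x. u x + bub x *\<^sub>R q x) \<in> vpol 5"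
proof -
  have "u \<in> vpol 5" using assms nd_fields_subset[of k] vpol_mono[of 2 5] by auto
  moreover have "(\<lambda>x. bub x *\<^sub>R q x) \<in> vpol 5"
    using pol_mult[OF bub_pol, of _ 1] assms(3) by (simp add: vpol_def)
  ultimately have "u + (\<lambda>x. bub x *\<^sub>R q x) \<in> vpol 5"
    by (rule subspace_add[OF subspace_vpol])
  then show ?thesis by (simp add: plus_fun_def)
qed

lemma bub_zero: "d \<in> C \<Longrightarrow> l d x = 0 \<Longrightarrow> bub x = 0"
  unfolding bub_def using fin by (auto intro: prod_zero)

text \<open>In the product rule every term that does not differentiate \<open>l d\<close> keeps the
  factor \<open>l d x = 0\<close>.\<close>

lemma bub_derivative:
  assumes "d \<in> C" "l d x = 0"
  shows "(bub has_derivative (\<lambda>h. (\<Prod>p\<in>C - {d}. l p x) * (g d \<bullet> h))) (at x)"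
proof -
  have l': "(l p has_derivative (\<lambda>h. g p \<bullet> h)) (at x)" if "p \<in> C" for p
  proof -
    have "((\<lambda>x. l p 0 + g p \<bullet> x) has_derivative (\<lambda>h. g p \<bullet> h)) (at x)"
      by (auto intro!: derivative_eq_intros)
    then show ?thesis unfolding l_eq[OF that] .
  qed
  have "(bub has_derivative (\<lambda>h. \<Sum>p\<in>C. (g p \<bullet> h) * (\<Prod>q\<in>C - {p}. l q x))) (at x)"
    unfolding bub_def[abs_def] by (intro has_derivative_prod l')
  moreover have "(\<Sum>p\<in>C. (g p \<bullet> h) * (\<Prod>q\<in>C - {p}. l q x)) = (\<Prod>p\<in>C - {d}. l p x) * (g d \<bullet> h)" for h
  proof -
    have "(\<Sum>p\<in>C - {d}. (g p \<bullet> h) * (\<Prod>q\<in>C - {p}. l q x)) = 0"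
      using assms fin by (intro sum.neutral) (auto intro!: prod_zero)
    then show ?thesis
      using sum.remove[OF fin assms(1), of "\<lambda>p. (g p \<bullet> h) * (\<Prod>q\<in>C - {p}. l q x)"] by simp
  qed
  ultimately show ?thesis by simp
qed

text \<open>From curl (b q) = grad b \<times> q + b curl q, where b vanishes at x and grad b is
  given by \<open>bub_derivative\<close>.\<close>

lemma curl_bubble_field:
  assumes "d \<in> C" "l d x = 0" "q \<in> vpol 1"
  shows "curlP (\<lambda>x. bub x *\<^sub>R q x) x = (\<Prod>p\<in>C - {d}. l p x) *\<^sub>R cross3 (g d) (q x)"
proof -
  obtain q' where "\<forall>x. (q has_derivative q' x) (at x)" using assms(3) by (rule vpol_C1)
  then have q': "\<And>x. (q has_derivative q' x) (at x)" by simp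
  have "((\<lambda>x. bub x *\<^sub>R q x) has_derivative (\<lambda>h. bub x *\<^sub>R q' x h + ((\<Prod>p\<in>C - {d}. l p x) * (g d \<bullet> h)) *\<^sub>R q x)) (at x)"
    by (intro has_derivative_scaleR bub_derivative assms q')
  then have "curlP (\<lambda>x. bub x *\<^sub>R q x) x = curlD (\<lambda>h. ((\<Prod>p\<in>C - {d}. l p x) * (g d \<bullet> h)) *\<^sub>R q x)"
    using assms by (simp add: curlP_eq bub_zero)
  also have "\<dots> = (\<Prod>p\<in>C - {d}. l p x) *\<^sub>R cross3 (g d) (q x)"
    by (simp add: curlD_def cross3_def vec_eq_iff forall_3 inner_axis algebra_simps)
  finally show ?thesis .
qed

end

section \<open>Unisolvence\<close>

text \<open>Two fields with equal functionals, as in the claim, instead of one with vanishing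
  functionals: passing to the difference needs integrability. With the zero field as second field
  the same results show that a representation (u, q) is unique.\<close>

locale equal_dofs = tetra +
  fixes k :: int and u u' q q' :: "real^3 \<Rightarrow> real^3" and t n :: "(real^3) set \<Rightarrow> real^3" and V V'
  assumes k: "k \<in> {1, 2}"
    and u: "u \<in> nd_fields k" and u': "u' \<in> nd_fields k" and q: "q \<in> vpol 1" and q': "q' \<in> vpol 1"
    and t: "\<And>e. e edge_of K \<Longrightarrow> unit_tangent e (t e)"
    and n: "\<And>F. F facet_of K \<Longrightarrow> unit_normal F (n F)"
    and V_def: "V = (\<lambda>x. u x + bub x *\<^sub>R q x)" and V'_def: "V' = (\<lambda>x. u' x + bub x *\<^sub>R q' x)"
    and edge_dofs: "\<And>e p. e edge_of K \<Longrightarrow> p \<in> poly_on k e \<Longrightarrow>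
      edge_integral e (\<lambda>x. (on_set K V x \<bullet> t e) * p x) = edge_integral e (\<lambda>x. (on_set K V' x \<bullet> t e) * p x)"
    and face_dofs: "\<And>F p. F facet_of K \<Longrightarrow> p \<in> RM (k - 2) F (n F) \<Longrightarrow>
      face_integral F (\<lambda>x. cross3 (on_set K V x) (n F) \<bullet> p x) = face_integral F (\<lambda>x. cross3 (on_set K V' x) (n F) \<bullet> p x)"
    and curl_dofs: "\<And>F p. F facet_of K \<Longrightarrow> p \<in> RT F (n F) \<Longrightarrow>
      face_integral F (\<lambda>x. cross3 (curl_in K (on_set K V) x) (n F) \<bullet> p x)
      = face_integral F (\<lambda>x. cross3 (curl_in K (on_set K V') x) (n F) \<bullet> p x)"
begin

definition z :: "real^3 \<Rightarrow> real^3" where "z x = u x - u' x"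

lemma z_nd: "z \<in> nd_fields k"
  using subspace_diff[OF subspace_nd_fields u u'] by (simp add: z_def[abs_def] fun_diff_def)

lemma V_vpol: "V \<in> vpol 5" "V' \<in> vpol 5"
  unfolding V_def V'_def by (intro W_vpol[OF k] u u' q q')+

lemma V_diff: "bub x = 0 \<Longrightarrow> V x - V' x = z x"
  by (simp add: V_def V'_def z_def)

lemma edge_tangential_zero:
  assumes ab: "a \<in> C" "b \<in> C" "a \<noteq> b" and x: "x \<in> closed_segment a b"
  shows "z x \<bullet> (b - a) = 0"
proof -
  let ?e = "closed_segment a b"
  have e: "?e edge_of K"
    unfolding edge_iff using ab by (intro exI[of _ "{a, b}"]) (auto simp: segment_convex_hull)
  obtain a' b' where ab': "{a', b'} = {a, b}"
    and "\<forall>f. edge_integral ?e f = dist a b * integral {0..1} (\<lambda>s. f (linepath a' b' s))"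
    using ab(3) by (rule edge_integral_segment)
  then have int: "edge_integral ?e f = dist a b * integral {0..1} (\<lambda>s. f (linepath a' b' s))" for f
    by simp
  have e': "?e = closed_segment a' b'" using ab' by simp
  define \<tau> where "\<tau> = t ?e"
  from t[OF e] obtain y y' c where \<tau>: "norm \<tau> = 1" "y \<in> ?e" "y' \<in> ?e" "\<tau> = c *\<^sub>R (y' - y)"
    unfolding unit_tangent_def \<tau>_def by blast
  obtain s s' where s: "y = (1 - s) *\<^sub>R a' + s *\<^sub>R b'" "y' = (1 - s') *\<^sub>R a' + s' *\<^sub>R b'"
    using \<tau>(2,3) unfolding e' in_segment by blast
  \<comment> \<open>The tangent vector is only known to be a multiple of the difference of two
    points of the edge; \<kappa> relates it to the end points in the order used by the
    integral.\<close>
  define \<kappa> where "\<kappa> = c * (s' - s)"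
  have \<kappa>: "\<tau> = \<kappa> *\<^sub>R (b' - a')"
    by (simp add: \<tau>(4) s \<kappa>_def algebra_simps)
  with \<tau>(1) have \<kappa>0: "\<kappa> \<noteq> 0" by auto
  define X where "X = linepath a' b'"
  have X: "X s = a' + (s / \<kappa>) *\<^sub>R \<tau>" for s
    using \<kappa>0 by (simp add: X_def linepath_def \<kappa> algebra_simps)
  have Xe: "X s \<in> ?e" if "s \<in> {0..1}" for s
    unfolding e' X_def using that by (rule linepath_in_path)
  have eK: "?e \<subseteq> K"
    using e by (rule edge_of_imp_subset)
  \<comment> \<open>A vertex off the edge: \<open>l d\<close>, and with it the bubble, vanishes
    along the whole line.\<close>
  have "\<exists>d. d \<in> C \<and> d \<noteq> a \<and> d \<noteq> b"
  proof (rule ccontr)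
    assume "\<not> ?thesis"
    then have "C \<subseteq> {a, b}" by blast
    then have "card C \<le> card {a, b}" by (rule card_mono[rotated]) simp
    with card ab show False by simp
  qed
  then obtain d where d: "d \<in> C" "d \<noteq> a" "d \<noteq> b" by (elim exE conjE)
  have bub0: "bub (X s) = 0" for s
  proof (rule bub_zero[OF d(1)])
    have "a' \<in> {a, b}" "b' \<in> {a, b}" using ab' by auto
    then have "l d a' = 0" "l d b' = 0" using d ab by (auto simp: l_vertex)
    moreover have "X s = a' + s *\<^sub>R (b' - a') + 0 *\<^sub>R (a' - a')"
      by (simp add: X_def linepath_def algebra_simps)
    ultimately show "l d (X s) = 0" using l_affine[OF d(1), of a' s b' 0 a'] by simp
  qed
  obtain f where f: "f \<in> pol k" "\<forall>s. f (a' + s *\<^sub>R \<tau>) = z (a' + s *\<^sub>R \<tau>) \<bullet> \<tau>"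
    using k z_nd by (rule nd_field_tangential)
  have fX: "f (X s) = z (X s) \<bullet> \<tau>" for s
    unfolding X using f(2) by simp
  have cX: "continuous_on UNIV X"
    unfolding X_def linepath_def by (intro continuous_intros)
  have c: "continuous_on UNIV (\<lambda>s. Y (X s) \<bullet> \<tau>)" if "Y \<in> vpol m" for Y m
    using that by (intro continuous_intros continuous_on_compose2[OF vpol_continuous cX]) auto
  have cz: "continuous_on {0..1} (\<lambda>s. z (X s) \<bullet> \<tau>)"
    using c[of z 2] z_nd nd_fields_subset[OF k] continuous_on_subset by blast
  have I: "(\<lambda>s. (Y (X s) \<bullet> \<tau>) * (z (X s) \<bullet> \<tau>)) integrable_on {0..1}" if "Y \<in> vpol 5" for Y
    using c[OF that] cz continuous_on_subset
    by (intro integrable_continuous_real continuous_on_mult) blast+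
  have *: "edge_integral ?e (\<lambda>x. (on_set K Y x \<bullet> t ?e) * on_set ?e f x)
      = dist a b * integral {0..1} (\<lambda>s. (Y (X s) \<bullet> \<tau>) * (z (X s) \<bullet> \<tau>))" for Y
  proof -
    have "integral {0..1} (\<lambda>s. (on_set K Y (X s) \<bullet> \<tau>) * on_set ?e f (X s))
        = integral {0..1} (\<lambda>s. (Y (X s) \<bullet> \<tau>) * (z (X s) \<bullet> \<tau>))"
    proof (rule integral_cong)
      fix s :: real assume "s \<in> {0..1}"
      from Xe[OF this] eK show "(on_set K Y (X s) \<bullet> \<tau>) * on_set ?e f (X s) = (Y (X s) \<bullet> \<tau>) * (z (X s) \<bullet> \<tau>)"
        by (auto simp: on_set_def fX)
    qed
    then show ?thesis by (simp add: int \<tau>_def X_def)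
  qed
  have "on_set ?e f \<in> poly_on k ?e"
    unfolding poly_on_eq using f(1) by (rule imageI)
  from edge_dofs[OF e this]
  have "integral {0..1} (\<lambda>s. (V (X s) \<bullet> \<tau>) * (z (X s) \<bullet> \<tau>)) = integral {0..1} (\<lambda>s. (V' (X s) \<bullet> \<tau>) * (z (X s) \<bullet> \<tau>))"
    unfolding * using ab(3) by simp
  then have "integral {0..1} (\<lambda>s. (V (X s) \<bullet> \<tau>) * (z (X s) \<bullet> \<tau>) - (V' (X s) \<bullet> \<tau>) * (z (X s) \<bullet> \<tau>)) = 0"
    using integral_diff[OF I[OF V_vpol(1)] I[OF V_vpol(2)]] by simp
  moreover have "(V (X s) \<bullet> \<tau>) * (z (X s) \<bullet> \<tau>) - (V' (X s) \<bullet> \<tau>) * (z (X s) \<bullet> \<tau>) = (z (X s) \<bullet> \<tau>)\<^sup>2" for s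
    using V_diff[OF bub0, of s] by (simp add: power2_eq_square flip: inner_diff_left left_diff_distrib)
  ultimately have "integral {0..1} (\<lambda>s. (z (X s) \<bullet> \<tau>)\<^sup>2) = 0" by simp
  moreover have "continuous_on {0..1} (\<lambda>s. (z (X s) \<bullet> \<tau>)\<^sup>2)"
    by (intro continuous_on_power cz)
  ultimately have "\<forall>s\<in>{0..1}. (z (X s) \<bullet> \<tau>)\<^sup>2 = 0"
    by (subst (asm) integral_eq_0_iff) auto
  moreover obtain s where "s \<in> {0..1}" "x = X s"
    using x unfolding e' in_segment by (auto simp: X_def linepath_def)
  ultimately have "z x \<bullet> \<tau> = 0" by simp
  then have "z x \<bullet> (b' - a') = 0" using \<kappa>0 by (simp add: \<kappa>)
  then show ?thesis
    using ab' by (auto simp: doubleton_eq_iff inner_diff_right)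
qed

end

section \<open>Geometry of a face\<close>

context tetra
begin

lemma face_point:
  assumes C: "C = {a, b, c, d}" "distinct [a, b, c, d]" and sr: "(s, r) \<in> std_triangle"
  shows "a + s *\<^sub>R (b - a) + r *\<^sub>R (c - a) \<in> convex hull (C - {d})"
    and "a + s *\<^sub>R (b - a) + r *\<^sub>R (c - a) \<in> K"
    and "l d (a + s *\<^sub>R (b - a) + r *\<^sub>R (c - a)) = 0"
    and "(\<Prod>p\<in>C - {d}. l p (a + s *\<^sub>R (b - a) + r *\<^sub>R (c - a))) = s * r * (1 - s - r)"
proof -
  let ?x = "a + s *\<^sub>R (b - a) + r *\<^sub>R (c - a)"
  have Cd: "C - {d} = {a, b, c}" unfolding C(1) using C(2) by auto
  have s: "0 \<le> s" "0 \<le> r" "s + r \<le> 1" using sr unfolding std_triangle_def by simp_all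
  show F: "?x \<in> convex hull (C - {d})"
    unfolding Cd convex_hull_3_alt
    by (rule CollectI, rule exI[of _ s], rule exI[of _ r]) (simp add: s)
  show "?x \<in> K"
    unfolding K by (rule subsetD[OF hull_mono F]) simp
  have mem: "a \<in> C" "b \<in> C" "c \<in> C" "d \<in> C" unfolding C(1) by simp_all
  have ne: "a \<noteq> b" "a \<noteq> c" "a \<noteq> d" "b \<noteq> c" "b \<noteq> d" "c \<noteq> d" using C(2) by auto
  show "l d ?x = 0"
    unfolding l_affine[OF mem(4)] using mem ne by (simp add: l_vertex)
  have "l a ?x = 1 - s - r" "l b ?x = s" "l c ?x = r"
    unfolding l_affine[OF mem(1)] l_affine[OF mem(2)] l_affine[OF mem(3)] using mem ne by (simp_all add: l_vertex)
  then show "(\<Prod>p\<in>C - {d}. l p ?x) = s * r * (1 - s - r)"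
    unfolding Cd using ne by simp
qed

text \<open>The integrands f and f' contain fields and tests cut off by \<open>on_set\<close>, so
  they are replaced by continuous h and h' that agree with them on the face. The area factor cancels
  because the triangle is nondegenerate.\<close>

lemma face_difference:
  assumes C: "C = {a, b, c, d}" "distinct [a, b, c, d]"
    and int: "\<forall>f. face_integral (convex hull (C - {d})) f = norm (cross3 (b - a) (c - a)) *
        integral std_triangle (\<lambda>(s, r). f (a + s *\<^sub>R (b - a) + r *\<^sub>R (c - a)))"
    and eq: "face_integral (convex hull (C - {d})) f = face_integral (convex hull (C - {d})) f'"
    and f: "\<And>x. x \<in> convex hull (C - {d}) \<Longrightarrow> f x = h x" "\<And>x. x \<in> convex hull (C - {d}) \<Longrightarrow> f' x = h' x"
    and cont: "continuous_on UNIV h" "continuous_on UNIV h'"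
  shows "integral std_triangle (\<lambda>(s, r). h (a + s *\<^sub>R (b - a) + r *\<^sub>R (c - a)) - h' (a + s *\<^sub>R (b - a) + r *\<^sub>R (c - a))) = 0"
proof -
  define X where "X = (\<lambda>z. a + fst z *\<^sub>R (b - a) + snd z *\<^sub>R (c - a))"
  have *: "face_integral (convex hull (C - {d})) f = norm (cross3 (b - a) (c - a)) * integral std_triangle (\<lambda>z. h (X z))"
    if "\<And>x. x \<in> convex hull (C - {d}) \<Longrightarrow> f x = h x" for f h
  proof -
    have "integral std_triangle (\<lambda>(s, r). f (a + s *\<^sub>R (b - a) + r *\<^sub>R (c - a))) = integral std_triangle (\<lambda>z. h (X z))"
    proof (rule integral_cong)
      fix z assume "z \<in> std_triangle"
      then have "(fst z, snd z) \<in> std_triangle" by simp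
      from that[OF face_point(1)[OF C this]]
      show "(case z of (s, r) \<Rightarrow> f (a + s *\<^sub>R (b - a) + r *\<^sub>R (c - a))) = h (X z)"
        unfolding X_def case_prod_beta .
    qed
    then show ?thesis unfolding int[rule_format] by (rule arg_cong)
  qed
  have cX: "continuous_on std_triangle X"
    unfolding X_def by (intro continuous_intros)
  have i: "(\<lambda>z. h (X z)) integrable_on std_triangle" if "continuous_on UNIV h" for h :: "real^3 \<Rightarrow> real"
    by (rule integrable_triangle, rule continuous_on_compose2[OF that cX]) simp
  have "integral std_triangle (\<lambda>z. h (X z)) = integral std_triangle (\<lambda>z. h' (X z))"
    using eq cross3_neq_0[OF C] *[of f h] *[of f' h'] f by simp
  then have "integral std_triangle (\<lambda>z. h (X z) - h' (X z)) = 0"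
    unfolding integral_diff[OF i[OF cont(1)] i[OF cont(2)]] by simp
  then show ?thesis unfolding X_def case_prod_beta .
qed

text \<open>Both \<open>g d\<close> and n are orthogonal to the face, hence parallel to N;
  \<open>g d\<close> is not zero because \<open>l d\<close> rises from 0 at a to 1 at d.\<close>

lemma facet_normal:
  assumes C: "C = {a, b, c, d}" "distinct [a, b, c, d]" and n: "unit_normal (convex hull (C - {d})) n"
  shows "n \<bullet> n = 1" "(b - a) \<bullet> n = 0" "(c - a) \<bullet> n = 0" "g d \<bullet> (b - a) = 0" "g d \<bullet> (c - a) = 0" "g d \<bullet> n \<noteq> 0"
    and "\<And>x. x \<in> convex hull (C - {d}) \<Longrightarrow> x \<bullet> n = a \<bullet> n"
proof -
  have mem: "a \<in> C" "b \<in> C" "c \<in> C" "d \<in> C" unfolding C(1) by simp_all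
  have ne: "a \<noteq> b" "a \<noteq> c" "a \<noteq> d" "b \<noteq> c" "b \<noteq> d" "c \<noteq> d" using C(2) by auto
  have F: "a \<in> convex hull (C - {d})" "b \<in> convex hull (C - {d})" "c \<in> convex hull (C - {d})"
    using mem ne by (auto intro!: hull_inc)
  show nn: "n \<bullet> n = 1"
    using n by (simp add: unit_normal_def norm_eq_1)
  show x: "x \<bullet> n = a \<bullet> n" if "x \<in> convex hull (C - {d})" for x
  proof -
    have "n \<bullet> (x - a) = 0" using n F(1) that unfolding unit_normal_def by simp
    then show ?thesis by (simp add: inner_diff_right inner_commute)
  qed
  show n0: "(b - a) \<bullet> n = 0" "(c - a) \<bullet> n = 0"
    using x[OF F(2)] x[OF F(3)] by (simp_all add: inner_diff_left)
  show g0: "g d \<bullet> (b - a) = 0" "g d \<bullet> (c - a) = 0"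
    using l_diff[OF mem(4), of b a] l_diff[OF mem(4), of c a] mem ne by (simp_all add: l_vertex)
  define N where "N = cross3 (b - a) (c - a)"
  have N: "N \<noteq> 0" unfolding N_def using C by (rule cross3_neq_0)
  \<comment> \<open>A vector w orthogonal to both edge vectors has w \<times> N = 0, and expanding N
    \<times> (N \<times> w) exhibits w as a multiple of N.\<close>
  have par: "(N \<bullet> N) *\<^sub>R w = (N \<bullet> w) *\<^sub>R N" if "w \<bullet> (b - a) = 0" "w \<bullet> (c - a) = 0" for w
  proof -
    have "cross3 w N = 0" unfolding N_def Lagrange using that by simp
    then have "cross3 N w = 0" using cross_skew[of N w] by simp
    then have "cross3 N (cross3 N w) = 0" by simp
    then show ?thesis unfolding Lagrange by simp
  qed
  have "g d \<bullet> (d - a) = 1"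
    using l_diff[OF mem(4), of d a] mem ne by (simp add: l_vertex)
  then have "g d \<noteq> 0" by auto
  moreover have NN: "N \<bullet> N \<noteq> 0" using N by simp
  ultimately have Ng: "N \<bullet> g d \<noteq> 0"
    using par[OF g0] by auto
  have "n \<noteq> 0" using nn by auto
  then have Nn: "N \<bullet> n \<noteq> 0"
    using par[of n] n0 NN by (auto simp: inner_commute)
  have "(N \<bullet> N) * (g d \<bullet> n) = (N \<bullet> g d) * (N \<bullet> n)"
    using arg_cong[OF par[OF g0], of "\<lambda>w. w \<bullet> n"] by simp
  with Ng Nn show "g d \<bullet> n \<noteq> 0" by auto
qed

end

section \<open>Face functionals of the edge element part\<close>

context equal_dofs
begin

text \<open>The integral fixes its own order a, b, c of the vertices. Stated for arbitrary vertices
  of the face, the claim follows from the three products of \<open>face_nd_zero\<close> by the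
  symmetry of U and the edge relations.\<close>

lemma face_vertex_products:
  assumes z: "blossom z U" "k = 1 \<longrightarrow> (\<forall>x y. (U y y - 2 *\<^sub>R U y x + U x x) \<bullet> (y - x) = 0)"
    and vertex: "\<And>p. p \<in> C \<Longrightarrow> U p p = 0"
    and edge: "\<And>p r. p \<in> C \<Longrightarrow> r \<in> C \<Longrightarrow> U p r \<bullet> (r - p) = 0"
    and d: "d \<in> C" and pqr: "p \<in> C - {d}" "p' \<in> C - {d}" "r \<in> C - {d}" "p \<noteq> p'"
  shows "U p p' \<bullet> (r - p) = 0"
proof -
  obtain a b c where C: "C = {a, b, c, d}" "distinct [a, b, c, d]"
    and int: "\<forall>f. face_integral (convex hull (C - {d})) f = norm (cross3 (b - a) (c - a)) *
        integral std_triangle (\<lambda>(s, r). f (a + s *\<^sub>R (b - a) + r *\<^sub>R (c - a)))"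
    using d by (rule face_eq)
  let ?F = "convex hull (C - {d})" and ?X = "\<lambda>s r. a + s *\<^sub>R (b - a) + r *\<^sub>R (c - a)"
  have F: "?F facet_of K" using d facet_iff by blast
  define \<nu> where "\<nu> = n ?F"
  note N = facet_normal[OF C n[OF F], folded \<nu>_def]
  have FK: "?F \<subseteq> K" using F by (simp add: facet_of_imp_subset)
  \<comment> \<open>The rotation by the normal turns the functional into minus the moment of z
    against the tangential field \<tau>.\<close>
  have test: "integral std_triangle (\<lambda>(s, r). z (?X s r) \<bullet> \<tau> (?X s r)) = 0"
    if \<tau>: "on_set ?F (\<lambda>x. cross3 \<nu> (\<tau> x)) \<in> RM (k - 2) ?F \<nu>" "continuous_on UNIV \<tau>"
      "\<And>s r. \<tau> (?X s r) \<bullet> \<nu> = 0" for \<tau>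
  proof -
    have "integral std_triangle (\<lambda>(s, r). cross3 (V (?X s r)) \<nu> \<bullet> cross3 \<nu> (\<tau> (?X s r))
        - cross3 (V' (?X s r)) \<nu> \<bullet> cross3 \<nu> (\<tau> (?X s r))) = 0"
    proof (rule face_difference[OF C int face_dofs[OF F \<tau>(1)[unfolded \<nu>_def]], folded \<nu>_def,
          where h = "\<lambda>x. cross3 (V x) \<nu> \<bullet> cross3 \<nu> (\<tau> x)" and h' = "\<lambda>x. cross3 (V' x) \<nu> \<bullet> cross3 \<nu> (\<tau> x)"])
      show "cross3 (on_set K V x) \<nu> \<bullet> on_set ?F (\<lambda>x. cross3 \<nu> (\<tau> x)) x = cross3 (V x) \<nu> \<bullet> cross3 \<nu> (\<tau> x)"
        "cross3 (on_set K V' x) \<nu> \<bullet> on_set ?F (\<lambda>x. cross3 \<nu> (\<tau> x)) x = cross3 (V' x) \<nu> \<bullet> cross3 \<nu> (\<tau> x)"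
        if "x \<in> ?F" for x using that FK by (auto simp: on_set_def)
      show "continuous_on UNIV (\<lambda>x. cross3 (V x) \<nu> \<bullet> cross3 \<nu> (\<tau> x))"
        "continuous_on UNIV (\<lambda>x. cross3 (V' x) \<nu> \<bullet> cross3 \<nu> (\<tau> x))"
        by (rule continuous_on_inner continuous_on_cross vpol_continuous[OF V_vpol(1)] vpol_continuous[OF V_vpol(2)] continuous_on_const \<tau>(2))+
    qed
    moreover have "integral std_triangle (\<lambda>(s, r). cross3 (V (?X s r)) \<nu> \<bullet> cross3 \<nu> (\<tau> (?X s r))
        - cross3 (V' (?X s r)) \<nu> \<bullet> cross3 \<nu> (\<tau> (?X s r)))
        = integral std_triangle (\<lambda>y. - (case y of (s, r) \<Rightarrow> z (?X s r) \<bullet> \<tau> (?X s r)))"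
    proof (rule integral_cong)
      fix y assume y: "y \<in> std_triangle"
      obtain s r where sr: "y = (s, r)" by (cases y)
      have "bub (?X s r) = 0"
        using bub_zero[OF d face_point(3)[OF C]] y sr by simp
      then have zX: "V (?X s r) - V' (?X s r) = z (?X s r)" by (rule V_diff)
      have "cross3 (V (?X s r)) \<nu> \<bullet> cross3 \<nu> (\<tau> (?X s r)) - cross3 (V' (?X s r)) \<nu> \<bullet> cross3 \<nu> (\<tau> (?X s r))
          = cross3 (z (?X s r)) \<nu> \<bullet> cross3 \<nu> (\<tau> (?X s r))"
        unfolding zX[symmetric] Cross3.left_diff_distrib inner_diff_left ..
      also have "\<dots> = - (z (?X s r) \<bullet> \<tau> (?X s r))"
        using \<tau>(3)[of s r] unfolding dot_cross N(1) inner_commute[of \<nu> "\<tau> _"] by simp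
      finally show "(case y of (s, r) \<Rightarrow> cross3 (V (?X s r)) \<nu> \<bullet> cross3 \<nu> (\<tau> (?X s r))
        - cross3 (V' (?X s r)) \<nu> \<bullet> cross3 \<nu> (\<tau> (?X s r))) = - (case y of (s, r) \<Rightarrow> z (?X s r) \<bullet> \<tau> (?X s r))"
        unfolding sr prod.case .
    qed
    ultimately show ?thesis by simp
  qed
  have const: "integral std_triangle (\<lambda>(s, r). z (?X s r) \<bullet> \<delta>) = 0" if "\<delta> \<in> {b - a, c - a}" for \<delta>
    using that N by (intro test[of "\<lambda>_. \<delta>"] RM_const) auto
  have pos: "integral std_triangle (\<lambda>(s, r). z (?X s r) \<bullet> (s *\<^sub>R (b - a) + r *\<^sub>R (c - a))) = 0" if "k = 2"
    using test[of "\<lambda>x. x - a"] that N RM_pos[of ?F \<nu> a]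
    by (simp add: inner_add_left continuous_on_diff)
  have mem: "a \<in> C" "b \<in> C" "c \<in> C" using C(1) by auto
  have *: "U a b \<bullet> (c - a) = 0" "U a c \<bullet> (b - a) = 0" "U b c \<bullet> (b - a) = 0"
    using k pos z(2) by (intro face_nd_zero[OF z(1) vertex[OF mem(1)] vertex[OF mem(2)] vertex[OF mem(3)]
      edge[OF mem(1,2)] edge[OF mem(1,3)] edge[OF mem(2,3)] const]; auto)+
  have sym: "U b a = U a b" "U c a = U a c" "U c b = U b c"
    using blossom_sym[OF z(1)] by metis+
  have e: "U a b \<bullet> b = U a b \<bullet> a" "U a c \<bullet> c = U a c \<bullet> a" "U b c \<bullet> c = U b c \<bullet> b"
    using edge[OF mem(1,2)] edge[OF mem(1,3)] edge[OF mem(2,3)] by (simp_all add: inner_diff_right)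
  have "p \<in> {a, b, c}" "p' \<in> {a, b, c}" "r \<in> {a, b, c}" using pqr C by auto
  then show ?thesis
    using * e pqr(4) by (elim insertE emptyE) (simp_all add: sym inner_diff_right)
qed

end

section \<open>Affine fields and their vertex values\<close>

lemma vpol_1_affine:
  assumes "w \<in> vpol 1"
  shows "w (a + s *\<^sub>R (b - a) + r *\<^sub>R (c - a)) = (1 - s - r) *\<^sub>R w a + s *\<^sub>R w b + r *\<^sub>R w c"
    and "sum f C = 1 \<Longrightarrow> w (\<Sum>p\<in>C. f p *\<^sub>R p) = (\<Sum>p\<in>C. f p *\<^sub>R w p)"
proof -
  obtain c0 and M :: "real^3^3" where w: "w = (\<lambda>x. c0 + M *v x)"
    using assms unfolding vpol_1 mem_Collect_eq by (elim exE conjE)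
  show "w (a + s *\<^sub>R (b - a) + r *\<^sub>R (c - a)) = (1 - s - r) *\<^sub>R w a + s *\<^sub>R w b + r *\<^sub>R w c"
    unfolding w matrix_vector_right_distrib matrix_vector_mult_diff_distrib matrix_vector_mult_scaleR
    by (simp add: algebra_simps)
  have "w (\<Sum>p\<in>C. f p *\<^sub>R p) = c0 + (\<Sum>p\<in>C. f p *\<^sub>R (M *v p))"
    unfolding w linear_sum[OF matrix_vector_mul_linear] matrix_vector_mult_scaleR ..
  moreover assume "sum f C = 1"
  then have "(\<Sum>p\<in>C. f p *\<^sub>R w p) = c0 + (\<Sum>p\<in>C. f p *\<^sub>R (M *v p))"
    unfolding w scaleR_add_right sum.distrib scaleR_sum_left[symmetric] by simp
  ultimately show "w (\<Sum>p\<in>C. f p *\<^sub>R p) = (\<Sum>p\<in>C. f p *\<^sub>R w p)" by simp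
qed

text \<open>The numbers B . (b - a), D . (c - a) and E . (d - a) sum to zero in pairs, so each of
  them vanishes. At b the same holds: orthogonality of the sums moves the relations of the faces abc
  and abd from a to b, and D . (c - b) = E . (d - b) = 0 results. Hence B, D and E are each
  orthogonal to b - a.\<close>

lemma tetrahedron_products_zero:
  fixes a b c d :: "'a::real_inner" and A B D E :: 'a
  assumes "(A + B + D) \<bullet> (b - a) = 0" "(A + B + D) \<bullet> (c - a) = 0" "B \<bullet> (b - a) + D \<bullet> (c - a) = 0"
    and "(A + B + E) \<bullet> (b - a) = 0" "(A + B + E) \<bullet> (d - a) = 0" "B \<bullet> (b - a) + E \<bullet> (d - a) = 0"
    and "(A + D + E) \<bullet> (c - a) = 0" "(A + D + E) \<bullet> (d - a) = 0" "D \<bullet> (c - a) + E \<bullet> (d - a) = 0"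
    and "(B + D + E) \<bullet> (c - b) = 0" "(B + D + E) \<bullet> (d - b) = 0" "D \<bullet> (c - b) + E \<bullet> (d - b) = 0"
  shows "(B + D + E) \<bullet> (b - a) = 0"
  using assms unfolding inner_add_left inner_diff_right by linarith

context tetra
begin

text \<open>The sum over the face opposite to a is orthogonal to the edges of that face by
  \<open>sums\<close> and to b - a by \<open>tetrahedron_products_zero\<close>, hence to all edge
  vectors.\<close>

lemma affine_field_zero:
  assumes w: "w \<in> vpol 1"
    and sums: "\<And>p r d. d \<in> C \<Longrightarrow> p \<in> C - {d} \<Longrightarrow> r \<in> C - {d} \<Longrightarrow> (\<Sum>i\<in>C - {d}. w i) \<bullet> (r - p) = 0"
    and div: "\<And>p d. d \<in> C \<Longrightarrow> p \<in> C - {d} \<Longrightarrow> (\<Sum>i\<in>C - {d}. w i \<bullet> (i - p)) = 0"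
  shows "w x = 0"
proof -
  have S0: "(\<Sum>i\<in>C - {a}. w i) = 0" if a: "a \<in> C" for a
  proof -
    have "card (C - {a}) = 3" using card a fin by simp
    then obtain b c d where bcd: "C - {a} = {b, c, d}" "b \<noteq> c" "b \<noteq> d" "c \<noteq> d"
      by (auto simp: card_3_iff)
    have "C = insert a (C - {a})" using a by auto
    then have C: "C = {a, b, c, d}" unfolding bcd(1) .
    have "b \<in> C - {a}" "c \<in> C - {a}" "d \<in> C - {a}" unfolding bcd(1) by simp_all
    then have ne: "a \<noteq> b" "a \<noteq> c" "a \<noteq> d" by auto
    have mem: "a \<in> C" "b \<in> C" "c \<in> C" "d \<in> C" unfolding C by simp_all
    have Cd: "C - {d} = {a, b, c}" "C - {c} = {a, b, d}" "C - {b} = {a, c, d}"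
      unfolding C using ne bcd by auto
    have 1: "(w a + w b + w c) \<bullet> (b - a) = 0" "(w a + w b + w c) \<bullet> (c - a) = 0" "w b \<bullet> (b - a) + w c \<bullet> (c - a) = 0"
      using sums[OF mem(4), of a b] sums[OF mem(4), of a c] div[OF mem(4), of a] ne bcd unfolding Cd by (simp_all add: add.assoc)
    have 2: "(w a + w b + w d) \<bullet> (b - a) = 0" "(w a + w b + w d) \<bullet> (d - a) = 0" "w b \<bullet> (b - a) + w d \<bullet> (d - a) = 0"
      using sums[OF mem(3), of a b] sums[OF mem(3), of a d] div[OF mem(3), of a] ne bcd unfolding Cd by (simp_all add: add.assoc)
    have 3: "(w a + w c + w d) \<bullet> (c - a) = 0" "(w a + w c + w d) \<bullet> (d - a) = 0" "w c \<bullet> (c - a) + w d \<bullet> (d - a) = 0"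
      using sums[OF mem(2), of a c] sums[OF mem(2), of a d] div[OF mem(2), of a] ne bcd unfolding Cd by (simp_all add: add.assoc)
    have 4: "(w b + w c + w d) \<bullet> (c - b) = 0" "(w b + w c + w d) \<bullet> (d - b) = 0" "w c \<bullet> (c - b) + w d \<bullet> (d - b) = 0"
      using sums[OF mem(1), of b c] sums[OF mem(1), of b d] div[OF mem(1), of b] ne bcd unfolding bcd(1) by (simp_all add: add.assoc)
    have sum: "(\<Sum>i\<in>C - {a}. w i) = w b + w c + w d"
      unfolding bcd(1) using bcd by (simp add: add.assoc)
    have ba: "(\<Sum>i\<in>C - {a}. w i) \<bullet> (b - a) = 0"
      unfolding sum by (rule tetrahedron_products_zero[OF 1 2 3 4])
    show ?thesis
    proof (rule orth_zero[OF a])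
      fix r assume "r \<in> C"
      show "(\<Sum>i\<in>C - {a}. w i) \<bullet> (r - a) = 0"
      proof (cases "r = a")
        case False
        with \<open>r \<in> C\<close> have "(\<Sum>i\<in>C - {a}. w i) \<bullet> (r - b) = 0"
          using mem ne by (intro sums) auto
        with ba show ?thesis by (simp add: inner_diff_right)
      qed simp
    qed
  qed
  \<comment> \<open>Every sum over three vertices is the total S minus one value, so all four values
    equal S, and S = 4 S.\<close>
  have "w p = sum w C" if "p \<in> C" for p
    using sum.remove[OF fin that, of w] S0[OF that] by simp
  then have "sum w C = (\<Sum>p\<in>C. sum w C)" by (rule sum.cong[OF refl])
  then have "sum w C = 4 *\<^sub>R sum w C" unfolding sum_constant_scaleR card by simp
  then have "(4 - 1) *\<^sub>R sum w C = 0" unfolding scaleR_diff_left by simp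
  then have "sum w C = 0" by simp
  with \<open>\<And>p. p \<in> C \<Longrightarrow> w p = sum w C\<close> have "w p = 0" if "p \<in> C" for p using that by simp
  then have "w (\<Sum>p\<in>C. l p x *\<^sub>R p) = 0"
    using vpol_1_affine(2)[OF w, of "\<lambda>p. l p x" C] by (simp add: l_sum)
  then show ?thesis by (simp add: l_repr)
qed

end

section \<open>Vanishing of the edge element part and of the bubble part\<close>

context equal_dofs
begin

lemma z_zero: "z x = 0"
proof -
  obtain U where U: "blossom z U" "k = 1 \<longrightarrow> (\<forall>x y. (U y y - 2 *\<^sub>R U y x + U x x) \<bullet> (y - x) = 0)"
    using k z_nd by (rule nd_fields_blossom)
  have vertex: "U p p = 0" if p: "p \<in> C" for p
  proof (rule orth_zero[OF p])
    show "U p p \<bullet> (r - p) = 0" if "r \<in> C" for r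
      using edge_tangential_zero[OF p that, of p] blossom_diag[OF U(1), of p] by (cases "p = r") auto
  qed
  have edge: "U p r \<bullet> (r - p) = 0" if "p \<in> C" "r \<in> C" for p r
  proof (cases "p = r")
    case False
    \<comment> \<open>The midpoint of the edge, with a void third term to fit
      \<open>blossom_affine\<close>. There z equals half of \<open>U p r\<close>, because the
      coefficients at the end points vanish.\<close>
    define m where "m = p + (1/2) *\<^sub>R (r - p) + 0 *\<^sub>R (p - p)"
    have *: "U m y = (1/2) *\<^sub>R U p y + (1/2) *\<^sub>R U r y" for y
      unfolding m_def blossom_affine[OF U(1)] by simp
    have "z m = (1/2) *\<^sub>R U p m + (1/2) *\<^sub>R U r m"
      unfolding blossom_diag[OF U(1), of m] * ..
    also have "U p m = (1/2) *\<^sub>R U p r"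
      unfolding blossom_sym[OF U(1), of p m] * using vertex[OF that(1)] blossom_sym[OF U(1), of r p] by simp
    also have "U r m = (1/2) *\<^sub>R U p r"
      unfolding blossom_sym[OF U(1), of r m] * using vertex[OF that(2)] by simp
    finally have "z m = (1/2) *\<^sub>R U p r" by (simp flip: scaleR_add_left)
    moreover have "m \<in> closed_segment p r"
      unfolding in_segment m_def by (rule exI[of _ "1/2"]) (simp add: vec_eq_iff algebra_simps)
    ultimately show ?thesis
      using edge_tangential_zero[OF that False, of m] by simp
  qed simp
  have zero: "U p p' = 0" if p: "p \<in> C" "p' \<in> C" for p p'
  proof (cases "p = p'")
    case False
    show ?thesis
    proof (rule orth_zero[OF p(1)])
      fix r assume r: "r \<in> C"
      \<comment> \<open>The vertices p, p' and r lie on the face opposite to some fourth vertex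
        d.\<close>
      have "\<not> C \<subseteq> {p, p', r}"
      proof
        assume "C \<subseteq> {p, p', r}"
        then have "card C \<le> card {p, p', r}" by (intro card_mono) auto
        also have "\<dots> \<le> 3" by (simp add: card_insert_if)
        finally show False using card by simp
      qed
      then obtain d where d: "d \<in> C" "d \<noteq> p" "d \<noteq> p'" "d \<noteq> r" by auto
      show "U p p' \<bullet> (r - p) = 0"
        by (rule face_vertex_products[OF U vertex edge d(1)]) (use p r d False in auto)
    qed
  qed (simp add: vertex p)
  show ?thesis
  proof (rule blossom_eq_0[OF U(1) _ zero])
    show "\<exists>w. sum w C = 1 \<and> (\<Sum>p\<in>C. w p *\<^sub>R p) = x" for x
      by (rule exI[of _ "\<lambda>p. l p x"]) (simp add: l_sum l_repr)
  qed
qed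

definition w :: "real^3 \<Rightarrow> real^3" where "w x = q x - q' x"

lemma w_vpol: "w \<in> vpol 1"
  using subspace_diff[OF subspace_vpol q q'] by (simp add: w_def[abs_def] fun_diff_def)

lemma curl_difference:
  assumes "d \<in> C" "l d x = 0"
  shows "curlP V x - curlP V' x = (\<Prod>p\<in>C - {d}. l p x) *\<^sub>R cross3 (g d) (w x)"
proof -
  have "V y - V' y = bub y *\<^sub>R w y" for y
    using z_zero[of y] by (simp add: V_def V'_def w_def z_def scaleR_diff_right)
  then have "curlP V x - curlP V' x = curlP (\<lambda>y. bub y *\<^sub>R w y) x"
    using curlP_diff[OF V_vpol, of x] by simp
  then show ?thesis using curl_bubble_field[OF assms w_vpol] by simp
qed

lemma curl_in_field:
  assumes "Y \<in> vpol m" "x \<in> K"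
  shows "curl_in K (on_set K Y) x = curlP Y x"
proof -
  obtain Y' where Y: "\<forall>x. (Y has_derivative Y' x) (at x)" using assms(1) by (rule vpol_C1)
  have Yx: "(Y has_derivative Y' x) (at x)" using Y by (rule spec)
  show ?thesis
    using curl_in_eq[OF convex_K interior_K assms(2) Yx] curlP_eq[OF Yx] by simp
qed

text \<open>With n \<times> (grad \<times> w) = (n . w) grad - (n . grad) w for the gradient
  \<open>g d\<close>, a test field orthogonal to \<open>g d\<close> leaves the last term alone: the
  functional is a bubble-weighted moment of w with the nonzero factor
  \<open>g d \<bullet> \<nu>\<close>.\<close>

lemma face_bubble_moments:
  assumes C: "C = {a, b, c, d}" "distinct [a, b, c, d]"
    and int: "\<forall>f. face_integral (convex hull (C - {d})) f = norm (cross3 (b - a) (c - a)) *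
        integral std_triangle (\<lambda>(s, r). f (a + s *\<^sub>R (b - a) + r *\<^sub>R (c - a)))"
  shows "(w a + w b + w c) \<bullet> (b - a) = 0" "(w a + w b + w c) \<bullet> (c - a) = 0"
    "w b \<bullet> (b - a) + w c \<bullet> (c - a) = 0"
proof -
  let ?F = "convex hull (C - {d})" and ?X = "\<lambda>s r. a + s *\<^sub>R (b - a) + r *\<^sub>R (c - a)"
  have d: "d \<in> C" unfolding C by simp
  have F: "?F facet_of K" using d facet_iff by blast
  define \<nu> where "\<nu> = n ?F"
  note N = facet_normal[OF C n[OF F], folded \<nu>_def]
  have FK: "?F \<subseteq> K" using F by (simp add: facet_of_imp_subset)
  have test: "integral std_triangle (\<lambda>(s, r). s * r * (1 - s - r) * (w (?X s r) \<bullet> \<tau> (?X s r))) = 0"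
    if \<tau>: "on_set ?F \<tau> \<in> RT ?F \<nu>" "continuous_on UNIV \<tau>" "\<And>s r. g d \<bullet> \<tau> (?X s r) = 0" for \<tau>
  proof -
    have "integral std_triangle (\<lambda>(s, r). cross3 (curlP V (?X s r)) \<nu> \<bullet> \<tau> (?X s r)
        - cross3 (curlP V' (?X s r)) \<nu> \<bullet> \<tau> (?X s r)) = 0"
    proof (rule face_difference[OF C int curl_dofs[OF F \<tau>(1)[unfolded \<nu>_def]], folded \<nu>_def,
          where h = "\<lambda>x. cross3 (curlP V x) \<nu> \<bullet> \<tau> x" and h' = "\<lambda>x. cross3 (curlP V' x) \<nu> \<bullet> \<tau> x"])
      fix x assume x: "x \<in> ?F"
      then have xK: "x \<in> K" using FK by auto
      show "cross3 (curl_in K (on_set K V) x) \<nu> \<bullet> on_set ?F \<tau> x = cross3 (curlP V x) \<nu> \<bullet> \<tau> x"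
        using x unfolding curl_in_field[OF V_vpol(1) xK] by (simp add: on_set_def)
      show "cross3 (curl_in K (on_set K V') x) \<nu> \<bullet> on_set ?F \<tau> x = cross3 (curlP V' x) \<nu> \<bullet> \<tau> x"
        using x unfolding curl_in_field[OF V_vpol(2) xK] by (simp add: on_set_def)
    next
      show "continuous_on UNIV (\<lambda>x. cross3 (curlP V x) \<nu> \<bullet> \<tau> x)"
        "continuous_on UNIV (\<lambda>x. cross3 (curlP V' x) \<nu> \<bullet> \<tau> x)"
        by (rule continuous_on_inner continuous_on_cross curlP_continuous[OF V_vpol(1)] curlP_continuous[OF V_vpol(2)] continuous_on_const \<tau>(2))+
    qed
    moreover have "integral std_triangle (\<lambda>(s, r). cross3 (curlP V (?X s r)) \<nu> \<bullet> \<tau> (?X s r)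
        - cross3 (curlP V' (?X s r)) \<nu> \<bullet> \<tau> (?X s r))
      = integral std_triangle (\<lambda>y. (g d \<bullet> \<nu>) * (case y of (s, r) \<Rightarrow> s * r * (1 - s - r) * (w (?X s r) \<bullet> \<tau> (?X s r))))"
    proof (rule integral_cong)
      fix y assume y: "y \<in> std_triangle"
      obtain s r where sr: "y = (s, r)" by (cases y)
      note P = face_point[OF C y[unfolded sr]]
      have "cross3 (curlP V (?X s r)) \<nu> \<bullet> \<tau> (?X s r) - cross3 (curlP V' (?X s r)) \<nu> \<bullet> \<tau> (?X s r)
          = cross3 ((s * r * (1 - s - r)) *\<^sub>R cross3 (g d) (w (?X s r))) \<nu> \<bullet> \<tau> (?X s r)"
        unfolding curl_difference[OF d P(3), unfolded P(4), symmetric] Cross3.left_diff_distrib inner_diff_left ..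
      also have "\<dots> = - ((s * r * (1 - s - r)) * (cross3 \<nu> (cross3 (g d) (w (?X s r))) \<bullet> \<tau> (?X s r)))"
        unfolding cross_mult_left cross_skew[of _ \<nu>] cross_mult_right by simp
      also have "\<dots> = (g d \<bullet> \<nu>) * (s * r * (1 - s - r) * (w (?X s r) \<bullet> \<tau> (?X s r)))"
        unfolding Lagrange inner_diff_left inner_scaleR_left \<tau>(3) inner_commute[of \<nu> "g d"] by simp
      finally show "(case y of (s, r) \<Rightarrow> cross3 (curlP V (?X s r)) \<nu> \<bullet> \<tau> (?X s r)
          - cross3 (curlP V' (?X s r)) \<nu> \<bullet> \<tau> (?X s r))
        = (g d \<bullet> \<nu>) * (case y of (s, r) \<Rightarrow> s * r * (1 - s - r) * (w (?X s r) \<bullet> \<tau> (?X s r)))"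
        unfolding sr prod.case .
    qed
    ultimately show ?thesis using N(6) by simp
  qed
  have const: "integral std_triangle (\<lambda>(s, r). s * r * (1 - s - r) * (w (?X s r) \<bullet> \<delta>)) = 0"
    if "\<delta> \<in> {b - a, c - a}" for \<delta>
    using that N by (intro test[of "\<lambda>_. \<delta>"] RT_const) auto
  have pos: "integral std_triangle (\<lambda>(s, r). s * r * (1 - s - r) * (w (?X s r) \<bullet> (s *\<^sub>R (b - a) + r *\<^sub>R (c - a)))) = 0"
    using test[of "\<lambda>x. x - a"] N RT_pos[of \<nu> ?F a]
    by (simp add: inner_add_right continuous_on_diff)
  show "(w a + w b + w c) \<bullet> (b - a) = 0" "(w a + w b + w c) \<bullet> (c - a) = 0"
    "w b \<bullet> (b - a) + w c \<bullet> (c - a) = 0"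
    using face_bubble_zero[OF vpol_1_affine(1)[OF w_vpol] const pos] by blast+
qed

lemma w_zero: "w x = 0"
proof (rule affine_field_zero[OF w_vpol])
  fix d assume "d \<in> C"
  then obtain a b c where C: "C = {a, b, c, d}" "distinct [a, b, c, d]"
    and int: "\<forall>f. face_integral (convex hull (C - {d})) f = norm (cross3 (b - a) (c - a)) *
        integral std_triangle (\<lambda>(s, r). f (a + s *\<^sub>R (b - a) + r *\<^sub>R (c - a)))"
    by (rule face_eq)
  note M = face_bubble_moments[OF C int]
  have Cd: "C - {d} = {a, b, c}" unfolding C(1) using C(2) by auto
  have sum: "sum f (C - {d}) = f a + f b + f c" for f :: "real^3 \<Rightarrow> 'b::comm_monoid_add"
    unfolding Cd using C(2) by (simp add: add.assoc)
  \<comment> \<open>\<open>face_bubble_moments\<close> refers to the vertex a. Moving the reference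
    point to p adds the product of the sum with a - p, which is zero by this equation.\<close>
  have all_eq: "(\<Sum>i\<in>C - {d}. w i) \<bullet> p = (w a + w b + w c) \<bullet> a" if "p \<in> C - {d}" for p
    using that[unfolded Cd] M(1,2) unfolding sum by (auto simp: inner_diff_right)
  show "(\<Sum>i\<in>C - {d}. w i) \<bullet> (r - p) = 0" if "p \<in> C - {d}" "r \<in> C - {d}" for p r
    unfolding inner_diff_right all_eq[OF that(1)] all_eq[OF that(2)] by simp
  show "(\<Sum>i\<in>C - {d}. w i \<bullet> (i - p)) = 0" if "p \<in> C - {d}" for p
    using all_eq[OF that] M(3) unfolding sum inner_add_left inner_diff_right by linarith
qed

lemma fields_eq: "u = u'" "q = q'"
  using z_zero w_zero by (auto simp: z_def w_def fun_eq_iff)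

end

section \<open>Dimensions\<close>

text \<open>The target is a space of functions of infinite dimension; the finite dimension comes
  from the parameter space, a basis of which is carried over.\<close>

lemma dim_injective_image:
  fixes f :: "'a::euclidean_space \<Rightarrow> 'b::real_vector"
  assumes "linear f" "subspace S" and zero: "\<And>x. x \<in> S \<Longrightarrow> f x = 0 \<Longrightarrow> x = 0"
  shows "dim (f ` S) = dim S"
proof -
  obtain B where B: "B \<subseteq> S" "independent B" "S \<subseteq> span B" "card B = dim S"
    by (rule basis_exists)
  have span: "span B = S"
    using B(1,3) assms(2) by (simp add: span_subspace)
  have inj: "inj_on f (span B)"
    unfolding span
  proof (rule inj_onI)
    fix x y assume xy: "x \<in> S" "y \<in> S" "f x = f y"
    then have "f (x - y) = 0" by (simp add: linear_diff[OF assms(1)])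
    moreover have "x - y \<in> S" using assms(2) xy by (simp add: subspace_diff)
    ultimately have "x - y = 0" by (intro zero)
    then show "x = y" by simp
  qed
  have ind: "independent (f ` B)"
    using assms(1) B(2) inj by (rule linear_independent_injective_image)
  have sp: "span (f ` B) = span (f ` S)"
    unfolding linear_span_image[OF assms(1)] span using assms(2) by (simp add: span_eq_iff[THEN iffD2])
  have "dim (f ` S) = card (f ` B)"
    using sp ind by (rule dim_eq_card)
  also have "\<dots> = dim S"
    unfolding B(4)[symmetric] by (rule card_image[OF inj_on_subset[OF inj span_superset]])
  finally show ?thesis .
qed

text \<open>The values at 0, at plus and minus the unit vectors, and at sums of two unit vectors
  determine a quadratic polynomial.\<close>

lemma quadratic_zero:
  assumes "\<And>x. c + w \<bullet> x + y \<bullet> sqv x + z \<bullet> crv x = 0"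
  shows "c = 0 \<and> w = 0 \<and> y = 0 \<and> z = 0"
proof -
  have h: "c + (w$1 * s + w$2 * t + w$3 * r) + (y$1 * (s * s) + y$2 * (t * t) + y$3 * (r * r))
      + (z$1 * (t * r) + z$2 * (s * r) + z$3 * (s * t)) = 0" for s t r
    using assms[of "vector [s, t, r]"] by (simp add: inner_vec_def sum_3 sqv_def crv_def)
  have c: "c = 0" using h[of 0 0 0] by simp
  have 1: "w$1 + y$1 = 0" "w$1 = y$1" "w$2 + y$2 = 0" "w$2 = y$2" "w$3 + y$3 = 0" "w$3 = y$3"
    using h[of 1 0 0] h[of "-1" 0 0] h[of 0 1 0] h[of 0 "-1" 0] h[of 0 0 1] h[of 0 0 "-1"] c by simp_all
  then have 2: "w$1 = 0" "y$1 = 0" "w$2 = 0" "y$2 = 0" "w$3 = 0" "y$3 = 0" by simp_all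
  have "z$1 = 0" "z$2 = 0" "z$3 = 0"
    using h[of 0 1 1] h[of 1 0 1] h[of 1 1 0] c 2 by simp_all
  with c 2 show ?thesis by (simp add: vec_eq_iff forall_3)
qed

lemma vector_quadratic_zero:
  fixes M Y Z :: "real^3^3"
  assumes "\<And>x. c + M *v x + Y *v sqv x + Z *v crv x = 0"
  shows "c = 0 \<and> M = 0 \<and> Y = 0 \<and> Z = 0"
proof -
  have "c $ i = 0 \<and> M $ i = 0 \<and> Y $ i = 0 \<and> Z $ i = 0" for i
  proof (rule quadratic_zero)
    fix x
    have "(c + M *v x + Y *v sqv x + Z *v crv x) $ i = 0" unfolding assms by simp
    then show "c $ i + M $ i \<bullet> x + Y $ i \<bullet> sqv x + Z $ i \<bullet> crv x = 0"
      by (simp add: matrix_vector_mult_def inner_vec_def)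
  qed
  then show ?thesis unfolding vec_eq_iff by simp
qed

lemma affine_zero:
  fixes M :: "real^3^3"
  assumes "\<And>x. c + M *v x = 0"
  shows "c = 0 \<and> M = 0"
  using vector_quadratic_zero[of c M 0 0] assms by simp

text \<open>The reflection of x to - x separates M x from the even quadratic part. The latter
  vanishes only if the linear map in it is a multiple of the identity, and the normalisation in
  \<open>rlin\<close> leaves 0.\<close>

lemma nedelec_zero:
  fixes M :: "real^3^3"
  assumes "\<And>x. c + M *v x + cross3 x (rlin P Q r s x) = 0"
  shows "c = 0 \<and> M = 0 \<and> P = 0 \<and> Q = 0 \<and> r = 0 \<and> s = 0"
proof -
  have "c + M *v x = 0" for x
  proof -
    have e: "cross3 (- x) (rlin P Q r s (- x)) = cross3 x (rlin P Q r s x)"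
      using linear_neg[OF rlin_linear, of P Q r s x] by simp
    have c: "c = 0" using assms[of 0] by simp
    have m: "M *v (- x) = - (M *v x)" by (simp add: matrix_vector_mult_def vec_eq_iff sum_negf)
    have "M *v x + cross3 x (rlin P Q r s x) = 0" "- (M *v x) + cross3 x (rlin P Q r s x) = 0"
      using assms[of x] assms[of "- x"] unfolding c e m by simp_all
    then have "2 *\<^sub>R (M *v x) = 0" by (simp add: scaleR_2 add_eq_0_iff2)
    then show ?thesis using c by simp
  qed
  then have cM: "c = 0 \<and> M = 0" by (rule affine_zero)
  have "cross3 (vector [a, b, d]) (rlin P Q r s (vector [a, b, d])) = 0" for a b d
    using assms[of "vector [a, b, d]"] cM by simp
  then have h: "b * (r * a + s * b) = d * (Q$1 * a + Q$2 * b + Q$3 * d)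
    \<and> d * (P$1 * a + P$2 * b + P$3 * d) = a * (r * a + s * b)
    \<and> a * (Q$1 * a + Q$2 * b + Q$3 * d) = b * (P$1 * a + P$2 * b + P$3 * d)" for a b d
    by (simp add: cross3_def rlin_def vec_eq_iff forall_3 inner_vec_def sum_3)
  show ?thesis
    using cM h[of 1 0 0] h[of 0 1 0] h[of 0 0 1] h[of 1 0 1] h[of 0 1 1] by (simp add: vec_eq_iff forall_3)
qed

section \<open>Edges, faces and the dimensions of their test spaces\<close>

context tetra
begin

text \<open>A face recovers its vertices as its extreme points, so different vertex sets have
  different hulls.\<close>

lemma card_facets: "card {F. F facet_of K} = 4"
proof -
  have eq: "{F. F facet_of K} = (\<lambda>d. convex hull (C - {d})) ` C"
    unfolding facet_iff by auto
  have "inj_on (\<lambda>d. convex hull (C - {d})) C"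
  proof (rule inj_onI)
    fix d d' assume d: "d \<in> C" "d' \<in> C" and h: "convex hull (C - {d}) = convex hull (C - {d'})"
    have ext: "{x. x extreme_point_of convex hull c} = c" if "c \<subseteq> C" for c
      using extreme_point_of_convex_hull_affine_independent[OF affine_independent_subset[OF ind that]] by simp
    have "C - {d} = {x. x extreme_point_of convex hull (C - {d})}" by (rule ext[symmetric]) auto
    also have "\<dots> = C - {d'}" unfolding h by (rule ext) auto
    finally have "C - {d} = C - {d'}" .
    with d show "d = d'" by blast
  qed
  then show ?thesis
    unfolding eq by (simp add: card_image card)
qed

lemma card_edges: "card {e. e edge_of K} = 6"
proof -
  have eq: "{e. e edge_of K} = (\<lambda>c. convex hull c) ` {c. c \<subseteq> C \<and> card c = 2}"
    unfolding edge_iff by auto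
  have "inj_on (\<lambda>c. convex hull c) {c. c \<subseteq> C \<and> card c = 2}"
  proof (rule inj_onI)
    fix c c' assume d: "c \<in> {c. c \<subseteq> C \<and> card c = 2}" "c' \<in> {c. c \<subseteq> C \<and> card c = 2}" and h: "convex hull c = convex hull c'"
    have ext: "{x. x extreme_point_of convex hull c} = c" if "c \<subseteq> C" for c
      using extreme_point_of_convex_hull_affine_independent[OF affine_independent_subset[OF ind that]] by simp
    have "c = {x. x extreme_point_of convex hull c}" using d(1) by (intro ext[symmetric]) simp
    also have "\<dots> = c'" unfolding h using d(2) by (intro ext) simp
    finally show "c = c'" .
  qed
  moreover have "card {c. c \<subseteq> C \<and> card c = 2} = 6"
    using n_subsets[OF fin, of 2] card by (simp add: choose_two)
  ultimately show ?thesis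
    unfolding eq by (simp add: card_image)
qed

end

lemma dim_tangential:
  fixes n :: "real^3"
  assumes "n \<noteq> 0"
  shows "dim {\<delta>. n \<bullet> \<delta> = 0} = 2" "dim {z :: (real^3) \<times> real. n \<bullet> fst z = 0} = 3"
proof -
  show "dim {\<delta>. n \<bullet> \<delta> = 0} = 2" using dim_hyperplane[OF assms] by simp
  have "(n, 0::real) \<noteq> 0" using assms by (simp add: zero_prod_def)
  from dim_hyperplane[OF this] show "dim {z :: (real^3) \<times> real. n \<bullet> fst z = 0} = 3"
    by (simp add: inner_prod_def)
qed

lemma tpoly_on_0: "tpoly_on 0 F n = (\<lambda>\<delta>. on_set F (\<lambda>_. \<delta>)) ` {\<delta>. n \<bullet> \<delta> = 0}" if ne: "F \<noteq> {}"
proof (intro equalityI subsetI)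
  fix p assume "p \<in> tpoly_on 0 F n"
  then obtain f where f: "f \<in> vpol 0" "p = on_set F f" "\<forall>x\<in>F. p x \<bullet> n = 0"
    by (auto simp: tpoly_on_def vpoly_on_eq)
  have "\<forall>i. \<exists>c. \<forall>x. f x $ i = c"
    using f(1) unfolding vpol_def pol_0 image_iff by (auto simp: fun_eq_iff)
  then obtain c where "\<forall>i. \<forall>x. f x $ i = c i" using choice[of "\<lambda>i c. \<forall>x. f x $ i = c"] by auto
  then have fc: "f = (\<lambda>x. \<chi> i. c i)" by (simp add: fun_eq_iff vec_eq_iff)
  obtain x where "x \<in> F" using ne by auto
  with f(3) have "p x \<bullet> n = 0" by blast
  moreover have "p x = (\<chi> i. c i)" unfolding f(2) fc using \<open>x \<in> F\<close> by (simp add: on_set_def)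
  ultimately have "n \<bullet> (\<chi> i. c i) = 0" by (simp only: inner_commute)
  then show "p \<in> (\<lambda>\<delta>. on_set F (\<lambda>_. \<delta>)) ` {\<delta>. n \<bullet> \<delta> = 0}"
    unfolding f(2) fc by (intro imageI CollectI)
next
  fix p assume "p \<in> (\<lambda>\<delta>. on_set F (\<lambda>_. \<delta>)) ` {\<delta>. n \<bullet> \<delta> = 0}"
  then show "p \<in> tpoly_on 0 F n" by (auto intro!: tpoly_const simp: inner_commute)
qed

lemma poly_on_0: "poly_on 0 F = range (\<lambda>c. on_set F (\<lambda>_. c))"
  unfolding poly_on_eq pol_0 by (simp add: image_image)

text \<open>Common to \<open>RM 0\<close> and \<open>RT\<close>: two dimensions of tangential
  constants and one of multiples of Y. Assumption \<open>Y\<close> says that Y takes different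
  values at a and b, so no nonzero multiple of it is constant on F.\<close>

lemma dim_tangential_field:
  fixes n :: "real^3"
  assumes F: "a \<in> F" "b \<in> F" and n: "n \<noteq> 0" and Y: "\<And>\<alpha>. \<alpha> *\<^sub>R (Y b - Y a) = 0 \<Longrightarrow> \<alpha> = 0"
  shows "dim (tpoly_on 0 F n + (\<lambda>q x. q x *\<^sub>R Y x) ` poly_on 0 F) = 3"
proof -
  define f where "f = (\<lambda>(\<delta>, \<alpha>). on_set F (\<lambda>x. \<delta> + \<alpha> *\<^sub>R Y x))"
  have "tpoly_on 0 F n + (\<lambda>q x. q x *\<^sub>R Y x) ` poly_on 0 F = f ` {z. n \<bullet> fst z = 0}"
  proof (intro equalityI subsetI)
    fix p assume "p \<in> tpoly_on 0 F n + (\<lambda>q x. q x *\<^sub>R Y x) ` poly_on 0 F"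
    then obtain p' q where p': "p' \<in> tpoly_on 0 F n" and q: "q \<in> poly_on 0 F" and p: "p = p' + (\<lambda>x. q x *\<^sub>R Y x)"
      by (elim set_plus_elim imageE) simp
    obtain \<delta> where "n \<bullet> \<delta> = 0" "p' = on_set F (\<lambda>_. \<delta>)"
      using p' F(1) tpoly_on_0[of F n] by auto
    moreover obtain \<alpha> where "q = on_set F (\<lambda>_. \<alpha>)"
      using q unfolding poly_on_0 by (rule rangeE)
    ultimately have "n \<bullet> \<delta> = 0" "p = on_set F (\<lambda>_. \<delta>) + (\<lambda>x. on_set F (\<lambda>_. \<alpha>) x *\<^sub>R Y x)"
      using p by simp_all
    moreover from this(2) have "p = f (\<delta>, \<alpha>)"
      by (auto simp: f_def on_set_def fun_eq_iff)
    ultimately show "p \<in> f ` {z. n \<bullet> fst z = 0}" by (intro image_eqI[of p f "(\<delta>, \<alpha>)"]) auto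
  next
    fix p assume "p \<in> f ` {z. n \<bullet> fst z = 0}"
    then obtain \<delta> \<alpha> where p: "n \<bullet> \<delta> = 0" "p = f (\<delta>, \<alpha>)" by auto
    then have "p = on_set F (\<lambda>_. \<delta>) + (\<lambda>x. on_set F (\<lambda>_. \<alpha>) x *\<^sub>R Y x)"
      by (auto simp: f_def on_set_def fun_eq_iff)
    also have "\<dots> \<in> tpoly_on 0 F n + (\<lambda>q x. q x *\<^sub>R Y x) ` poly_on 0 F"
      using p(1) by (intro set_plus_intro tpoly_const imageI) (simp_all add: inner_commute poly_on_0)
    finally show "p \<in> tpoly_on 0 F n + (\<lambda>q x. q x *\<^sub>R Y x) ` poly_on 0 F" .
  qed
  also have "dim (f ` {z. n \<bullet> fst z = 0}) = dim {z :: (real^3) \<times> real. n \<bullet> fst z = 0}"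
  proof (rule dim_injective_image)
    show "linear f"
      by (rule linearI) (auto simp: f_def on_set_def fun_eq_iff scaleR_fun_def algebra_simps)
    show "subspace {z :: (real^3) \<times> real. n \<bullet> fst z = 0}"
      by (rule subspaceI) (auto simp: inner_add_right)
    fix z assume z: "f z = 0"
    obtain \<delta> \<alpha> where [simp]: "z = (\<delta>, \<alpha>)" by (cases z)
    have "\<delta> + \<alpha> *\<^sub>R Y a = 0" "\<delta> + \<alpha> *\<^sub>R Y b = 0"
      using fun_cong[OF z, of a] fun_cong[OF z, of b] F by (simp_all add: f_def on_set_def)
    moreover have "\<alpha> *\<^sub>R (Y b - Y a) = (\<delta> + \<alpha> *\<^sub>R Y b) - (\<delta> + \<alpha> *\<^sub>R Y a)"
      by (simp add: scaleR_diff_right)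
    ultimately have Ya: "\<delta> + \<alpha> *\<^sub>R Y a = 0" and "\<alpha> *\<^sub>R (Y b - Y a) = 0"
      by (simp_all only: diff_zero)
    then have "\<alpha> = 0" by (intro Y)
    with Ya show "z = 0" by (simp add: zero_prod_def)
  qed
  also have "\<dots> = 3" using n by (rule dim_tangential)
  finally show ?thesis .
qed

lemma dim_RT:
  assumes F: "a \<in> F" "b \<in> F" "a \<noteq> b" and n: "unit_normal F n"
  shows "dim (RT F n) = 3"
  unfolding RT_def
proof (rule dim_tangential_field[OF F(1,2)])
  show "n \<noteq> 0" using n by (auto simp: unit_normal_def)
  fix \<alpha> :: real
  have "n \<bullet> (b - a) = 0" using n F by (simp add: unit_normal_def)
  then have "b \<bullet> n = a \<bullet> n" by (simp add: inner_diff_right inner_commute)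
  then have "b - (b \<bullet> n) *\<^sub>R n - (a - (a \<bullet> n) *\<^sub>R n) = b - a" by simp
  moreover assume "\<alpha> *\<^sub>R (b - (b \<bullet> n) *\<^sub>R n - (a - (a \<bullet> n) *\<^sub>R n)) = 0"
  ultimately have "\<alpha> *\<^sub>R (b - a) = 0" by (simp only:)
  then show "\<alpha> = 0" using F(3) by simp
qed

lemma dim_RM_0:
  assumes F: "a \<in> F" "b \<in> F" "a \<noteq> b" and n: "unit_normal F n"
  shows "dim (RM 0 F n) = 3"
  unfolding RM_def
proof (rule dim_tangential_field[OF F(1,2)])
  show n0: "n \<noteq> 0" using n by (auto simp: unit_normal_def)
  fix \<alpha> :: real
  have "n \<bullet> (b - a) = 0" using n F by (simp add: unit_normal_def)
  then have "cross3 n (b - a) \<noteq> 0"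
    using norm_and_cross_eq_0[of n "b - a"] F(3) n0 by auto
  moreover assume "\<alpha> *\<^sub>R (cross3 n b - cross3 n a) = 0"
  ultimately show "\<alpha> = 0" by (simp add: Cross3.right_diff_distrib)
qed

text \<open>The degree - 1 is k - 2 for k = 1, where only the tangential constants remain.\<close>

lemma dim_RM_neg:
  assumes F: "a \<in> F" and n: "unit_normal F n"
  shows "dim (RM (- 1) F n) = 2"
proof -
  have n0: "n \<noteq> 0" using n by (auto simp: unit_normal_def)
  have "poly_on (- 1) F = {0}"
    unfolding poly_on_eq by (simp add: pol_neg linear_0[OF linear_on_set])
  then have "(\<lambda>q x. q x *\<^sub>R cross3 n x) ` poly_on (- 1) F = {0}"
    by (simp add: zero_fun_def)
  then have "RM (- 1) F n = tpoly_on 0 F n"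
    by (simp add: RM_def set_plus_def)
  also have "\<dots> = (\<lambda>\<delta>. on_set F (\<lambda>_. \<delta>)) ` {\<delta>. n \<bullet> \<delta> = 0}"
    using F by (intro tpoly_on_0) auto
  also have "dim \<dots> = dim {\<delta>. n \<bullet> \<delta> = 0}"
  proof (rule dim_injective_image)
    show "linear (\<lambda>\<delta> :: real^3. on_set F (\<lambda>_. \<delta>))"
      by (rule linearI) (auto simp: on_set_def fun_eq_iff scaleR_fun_def)
    show "subspace {\<delta>. n \<bullet> \<delta> = 0}" by (rule subspace_hyperplane)
    fix \<delta> :: "real^3" assume "on_set F (\<lambda>_. \<delta>) = 0"
    from fun_cong[OF this, of a] F show "\<delta> = 0" by (simp add: on_set_def)
  qed
  also have "\<dots> = 2" using n0 by (rule dim_tangential)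
  finally show ?thesis .
qed

lemma pol_2_segment:
  assumes "f \<in> pol 2"
  obtains \<alpha> \<beta> \<gamma> where "\<forall>s. f (a + s *\<^sub>R \<delta>) = \<alpha> + \<beta> * s + \<gamma> * (s * s)"
proof -
  obtain c w y z where f: "f = (\<lambda>x. c + w \<bullet> x + y \<bullet> sqv x + z \<bullet> crv x)"
    using assms unfolding pol_2 mem_Collect_eq by (elim exE conjE)
  \<comment> \<open>The derivative of f at a in the direction \<delta>.\<close>
  define \<beta> where "\<beta> = w \<bullet> \<delta> + 2 * (y$1 * (a$1 * \<delta>$1) + y$2 * (a$2 * \<delta>$2) + y$3 * (a$3 * \<delta>$3))
    + z$1 * (a$2 * \<delta>$3 + a$3 * \<delta>$2) + z$2 * (a$1 * \<delta>$3 + a$3 * \<delta>$1) + z$3 * (a$1 * \<delta>$2 + a$2 * \<delta>$1)"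
  have "f (a + s *\<^sub>R \<delta>) = f a + \<beta> * s + (y \<bullet> sqv \<delta> + z \<bullet> crv \<delta>) * (s * s)" for s
    by (simp add: f \<beta>_def sqv_def crv_def inner_vec_def sum_3 algebra_simps)
  then show ?thesis by (intro that) (rule allI)
qed

lemma dim_poly_on_segment:
  assumes ab: "a \<noteq> b" and k: "k \<in> {1, 2}"
  shows "int (dim (poly_on k (closed_segment a b))) = k + 1"
proof -
  let ?e = "closed_segment a b"
  \<comment> \<open>With this v the affine function \<tau> returns the parameter of each point of
    the segment, and restricted polynomials are polynomials in \<tau>.\<close>
  define v where "v = (1 / ((b - a) \<bullet> (b - a))) *\<^sub>R (b - a)"
  define \<tau> where "\<tau> x = - (v \<bullet> a) + v \<bullet> x" for x
  have "(b - a) \<bullet> (b - a) \<noteq> 0" using ab by simp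
  then have v: "v \<bullet> (b - a) = 1" by (simp add: v_def)
  have \<tau>: "\<tau> (a + s *\<^sub>R (b - a)) = s" for s
    using v by (simp add: \<tau>_def inner_add_right)
  have e: "\<exists>s. x = a + s *\<^sub>R (b - a)" if "x \<in> ?e" for x
    using that unfolding in_segment by (auto simp: algebra_simps)
  have x: "x = a + \<tau> x *\<^sub>R (b - a)" if "x \<in> ?e" for x
    using e[OF that] \<tau> by auto
  have pol: "\<tau> \<in> pol 1"
    unfolding \<tau>_def[abs_def] by (intro pol_add pol_const pol_inner) auto
  \<comment> \<open>The two end points and the midpoint determine a quadratic polynomial in
    \<tau>.\<close>
  define m where "m = a + (1/2) *\<^sub>R (b - a)"
  have "m \<in> ?e"
    unfolding m_def in_segment by (rule exI[of _ "1/2"]) (simp add: vec_eq_iff algebra_simps)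
  then have pts: "a \<in> ?e" "b \<in> ?e" "m \<in> ?e" by simp_all
  have vals: "\<tau> a = 0" "\<tau> b = 1" "\<tau> m = 1/2"
    using \<tau>[of 0] \<tau>[of 1] \<tau>[of "1/2"] by (simp_all add: m_def)
  from k show ?thesis
  proof (elim insertE emptyE)
    assume k: "k = 1"
    define f where "f = (\<lambda>(\<alpha>, \<beta>). on_set ?e (\<lambda>x. \<alpha> + \<beta> * \<tau> x))"
    have "poly_on 1 ?e = range f"
    proof (intro equalityI subsetI)
      fix p assume "p \<in> poly_on 1 ?e"
      then obtain h where h: "h \<in> pol 1" "p = on_set ?e h" unfolding poly_on_eq by (elim imageE)
      obtain c w where hcw: "h = (\<lambda>x. c + w \<bullet> x)"
        using h(1) unfolding pol_1 mem_Collect_eq by (elim exE conjE)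
      have "on_set ?e h = on_set ?e (\<lambda>x. (c + w \<bullet> a) + (w \<bullet> (b - a)) * \<tau> x)"
      proof (rule on_set_cong)
        fix x assume "x \<in> ?e"
        have "h x = c + w \<bullet> (a + \<tau> x *\<^sub>R (b - a))" unfolding hcw using x[OF \<open>x \<in> ?e\<close>] by simp
        then show "h x = (c + w \<bullet> a) + (w \<bullet> (b - a)) * \<tau> x" by (simp add: inner_add_right)
      qed
      then have "p = f (c + w \<bullet> a, w \<bullet> (b - a))" by (simp add: h f_def)
      then show "p \<in> range f" by (rule range_eqI)
    next
      fix p assume "p \<in> range f"
      then obtain z where "p = f z" by (rule rangeE)
      then have "p = on_set ?e (\<lambda>x. fst z + snd z * \<tau> x)" by (simp add: f_def case_prod_beta)
      also have "\<dots> \<in> poly_on 1 ?e"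
        unfolding poly_on_eq by (intro imageI pol_add pol_const pol_scale pol) simp
      finally show "p \<in> poly_on 1 ?e" .
    qed
    also have "dim (range f) = dim (UNIV :: (real \<times> real) set)"
    proof (rule dim_injective_image)
      show "linear f"
        by (rule linearI) (auto simp: f_def on_set_def fun_eq_iff scaleR_fun_def algebra_simps)
      fix z assume z: "f z = 0"
      obtain \<alpha> \<beta> where ab: "z = (\<alpha>, \<beta>)" by (cases z)
      have "\<alpha> + \<beta> * \<tau> y = 0" if "y \<in> ?e" for y
        using fun_cong[OF z, of y] that by (simp add: f_def ab on_set_def)
      from this[OF pts(1)] this[OF pts(2)] show "z = 0" by (simp add: vals ab zero_prod_def)
    qed simp
    finally show ?thesis by (simp add: k)
  next
    assume k: "k = 2"
    define f where "f = (\<lambda>(\<alpha>, \<beta>, \<gamma>). on_set ?e (\<lambda>x. \<alpha> + \<beta> * \<tau> x + \<gamma> * (\<tau> x * \<tau> x)))"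
    have "poly_on 2 ?e = range f"
    proof (intro equalityI subsetI)
      fix p assume "p \<in> poly_on 2 ?e"
      then obtain h where h: "h \<in> pol 2" "p = on_set ?e h" unfolding poly_on_eq by (elim imageE)
      obtain \<alpha> \<beta> \<gamma> where *: "\<forall>s. h (a + s *\<^sub>R (b - a)) = \<alpha> + \<beta> * s + \<gamma> * (s * s)"
        using h(1) by (rule pol_2_segment)
      have "on_set ?e h = on_set ?e (\<lambda>x. \<alpha> + \<beta> * \<tau> x + \<gamma> * (\<tau> x * \<tau> x))"
      proof (rule on_set_cong)
        fix y assume "y \<in> ?e"
        show "h y = \<alpha> + \<beta> * \<tau> y + \<gamma> * (\<tau> y * \<tau> y)"
          using *[rule_format, of "\<tau> y"] x[OF \<open>y \<in> ?e\<close>] by simp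
      qed
      then have "p = f (\<alpha>, \<beta>, \<gamma>)" by (simp add: h f_def)
      then show "p \<in> range f" by (rule range_eqI)
    next
      fix p assume "p \<in> range f"
      then obtain z where "p = f z" by (rule rangeE)
      then have "p = on_set ?e (\<lambda>x. fst z + fst (snd z) * \<tau> x + snd (snd z) * (\<tau> x * \<tau> x))"
        by (simp add: f_def case_prod_beta)
      also have "\<dots> \<in> poly_on 2 ?e"
        unfolding poly_on_eq using pol_mult[OF pol pol] pol pol_mono[of 1 2]
        by (intro imageI pol_add pol_const pol_scale) auto
      finally show "p \<in> poly_on 2 ?e" .
    qed
    also have "dim (range f) = dim (UNIV :: (real \<times> real \<times> real) set)"
    proof (rule dim_injective_image)
      show "linear f"
        by (rule linearI) (auto simp: f_def on_set_def fun_eq_iff scaleR_fun_def algebra_simps)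
      fix z assume z: "f z = 0"
      obtain \<alpha> \<beta> \<gamma> where ab: "z = (\<alpha>, \<beta>, \<gamma>)" by (cases z)
      have "\<alpha> + \<beta> * \<tau> y + \<gamma> * (\<tau> y * \<tau> y) = 0" if "y \<in> ?e" for y
        using fun_cong[OF z, of y] that by (simp add: f_def ab on_set_def)
      from this[OF pts(1)] this[OF pts(2)] this[OF pts(3)] show "z = 0" by (simp add: vals ab zero_prod_def)
    qed simp
    finally show ?thesis by (simp add: k)
  qed
qed

lemma tetra_exists:
  assumes "3 simplex K"
  obtains C l g where "tetra C K l g"
proof -
  obtain C where C: "\<not> affine_dependent C" "card C = 4" "K = convex hull C"
    using assms by (auto simp: simplex_def)
  show ?thesis
  proof (rule barycentric_coordinates[OF C(1,2)])
    fix l g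
    assume *: "\<And>x. (\<Sum>p\<in>C. l p x) = 1" "\<And>x. (\<Sum>p\<in>C. l p x *\<^sub>R p) = x"
      "\<And>u x p. sum u C = 1 \<Longrightarrow> (\<Sum>p\<in>C. u p *\<^sub>R p) = x \<Longrightarrow> p \<in> C \<Longrightarrow> l p x = u p"
      "\<And>p x y. p \<in> C \<Longrightarrow> l p x - l p y = g p \<bullet> (x - y)"
    show thesis
      by (rule that[of C l g], unfold_locales) (fact C | fact *)+
  qed
qed

section \<open>Dimension of the space and number of functionals\<close>

context tetra
begin

lemma W_representation:
  "W k K = {on_set K (\<lambda>x. u x + bub x *\<^sub>R q x) | u q. u \<in> nd_fields k \<and> q \<in> vpol 1}"
  using convex_K interior_K bubble_K by (rule W_eq)

text \<open>A field that is zero on K has the same functionals as the zero field with its pair (0,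
  0), so \<open>fields_eq\<close> applies. In particular the sum of the edge element and bubble
  parts is direct.\<close>

lemma W_element_zero:
  assumes k: "k \<in> {1, 2}"
    and t: "\<And>e. e edge_of K \<Longrightarrow> unit_tangent e (t e)" and n: "\<And>F. F facet_of K \<Longrightarrow> unit_normal F (n F)"
    and u: "u \<in> nd_fields k" and q: "q \<in> vpol 1" and zero: "on_set K (\<lambda>x. u x + bub x *\<^sub>R q x) = 0"
  shows "u = (\<lambda>_. 0)" "q = (\<lambda>_. 0)"
proof -
  have z: "(\<lambda>_. 0) \<in> nd_fields k" "(\<lambda>_. 0) \<in> vpol 1"
    using subspace_0[OF subspace_nd_fields] subspace_0[OF subspace_vpol] by (simp_all add: zero_fun_def)
  have eq: "on_set K (\<lambda>x. u x + bub x *\<^sub>R q x) = on_set K (\<lambda>x. 0 + bub x *\<^sub>R 0)"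
    unfolding zero by (simp add: on_set_def zero_fun_def)
  interpret equal_dofs C K l g k u "\<lambda>_. 0" q "\<lambda>_. 0" t n "\<lambda>x. u x + bub x *\<^sub>R q x" "\<lambda>x. 0 + bub x *\<^sub>R 0"
    by unfold_locales (fact k u q z | rule t n refl | assumption | simp only: eq)+
  show "u = (\<lambda>_. 0)" "q = (\<lambda>_. 0)" by (fact fields_eq)+
qed

text \<open>The edge element part has 3 + 9 + 3 + 3 + 1 + 1 = 20 or 3 + 9 + 9 + 9 = 30 parameters,
  the bubble part 3 + 9 = 12.\<close>

lemma dim_W:
  assumes t: "\<And>e. e edge_of K \<Longrightarrow> unit_tangent e (t e)" and n: "\<And>F. F facet_of K \<Longrightarrow> unit_normal F (n F)"
  shows "dim (W 1 K) = 32" "dim (W 2 K) = 42"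
proof -
  define f1 where "f1 = (\<lambda>(c, M :: real^3^3, P, Q, r, s, q0, Q1 :: real^3^3).
    on_set K (\<lambda>x. (c + M *v x + cross3 x (rlin P Q r s x)) + bub x *\<^sub>R (q0 + Q1 *v x)))"
  have "W 1 K = range f1"
  proof (intro equalityI subsetI)
    fix v assume "v \<in> W 1 K"
    then obtain u q where v: "v = on_set K (\<lambda>x. u x + bub x *\<^sub>R q x)" "u \<in> nd_fields 1" "q \<in> vpol 1"
      unfolding W_representation mem_Collect_eq by (elim exE conjE)
    obtain c and M :: "real^3^3" and P Q r s where u: "u = (\<lambda>x. c + M *v x + cross3 x (rlin P Q r s x))"
      using v(2) unfolding nd_fields_1 mem_Collect_eq by (elim exE conjE)
    obtain q0 and Q1 :: "real^3^3" where q: "q = (\<lambda>x. q0 + Q1 *v x)"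
      using v(3) unfolding vpol_1 mem_Collect_eq by (elim exE conjE)
    have "v = f1 (c, M, P, Q, r, s, q0, Q1)" unfolding v(1) u q f1_def prod.case ..
    then show "v \<in> range f1" by (rule range_eqI)
  next
    fix v assume "v \<in> range f1"
    then obtain a where a: "v = f1 a" by (rule rangeE)
    obtain c and M :: "real^3^3" and P Q r s q0 and Q1 :: "real^3^3" where a': "a = (c, M, P, Q, r, s, q0, Q1)"
      by (metis surj_pair)
    have "(\<lambda>x. c + M *v x + cross3 x (rlin P Q r s x)) \<in> nd_fields 1"
      unfolding nd_fields_1
      by (rule CollectI, rule exI[of _ c], rule exI[of _ M], rule exI[of _ P], rule exI[of _ Q], rule exI[of _ r], rule exI[of _ s]) simp
    moreover have "(\<lambda>x. q0 + Q1 *v x) \<in> vpol 1"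
      unfolding vpol_1 by (rule CollectI, rule exI[of _ q0], rule exI[of _ Q1]) simp
    moreover have "v = on_set K (\<lambda>x. (c + M *v x + cross3 x (rlin P Q r s x)) + bub x *\<^sub>R (q0 + Q1 *v x))"
      unfolding a a' f1_def prod.case ..
    ultimately show "v \<in> W 1 K"
      unfolding W_representation
      by (intro CollectI exI[of _ "\<lambda>x. c + M *v x + cross3 x (rlin P Q r s x)"] exI[of _ "\<lambda>x. q0 + Q1 *v x"] conjI)
  qed
  also have "dim (range f1) = dim (UNIV :: ((real^3) \<times> (real^3^3) \<times> (real^3) \<times> (real^3) \<times> real \<times> real \<times> (real^3) \<times> (real^3^3)) set)"
  proof (rule dim_injective_image)
    show "linear f1"
      by (rule linearI) (auto simp: f1_def on_set_def fun_eq_iff scaleR_fun_def rlin_def cross3_def vec_eq_iff forall_3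
        matrix_vector_mult_def inner_vec_def sum_3 algebra_simps)
    fix a assume z: "f1 a = 0"
    obtain c and M :: "real^3^3" and P Q r s q0 and Q1 :: "real^3^3" where a': "a = (c, M, P, Q, r, s, q0, Q1)"
      by (metis surj_pair)
    have nd: "(\<lambda>x. c + M *v x + cross3 x (rlin P Q r s x)) \<in> nd_fields 1"
      unfolding nd_fields_1
      by (rule CollectI, rule exI[of _ c], rule exI[of _ M], rule exI[of _ P], rule exI[of _ Q], rule exI[of _ r], rule exI[of _ s]) simp
    have vp: "(\<lambda>x. q0 + Q1 *v x) \<in> vpol 1"
      unfolding vpol_1 by (rule CollectI, rule exI[of _ q0], rule exI[of _ Q1]) simp
    have "on_set K (\<lambda>x. (c + M *v x + cross3 x (rlin P Q r s x)) + bub x *\<^sub>R (q0 + Q1 *v x)) = 0"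
      using z unfolding a' f1_def prod.case .
    note W0 = W_element_zero[OF _ t n nd vp this]
    have "c = 0 \<and> M = 0 \<and> P = 0 \<and> Q = 0 \<and> r = 0 \<and> s = 0"
      by (rule nedelec_zero) (use W0(1) in \<open>simp add: fun_eq_iff\<close>)
    moreover have "q0 = 0 \<and> Q1 = 0"
      by (rule affine_zero) (use W0(2) in \<open>simp add: fun_eq_iff\<close>)
    ultimately show "a = 0" by (simp add: a' zero_prod_def)
  qed simp
  also have "\<dots> = 32" by simp
  finally show "dim (W 1 K) = 32" .
  define f2 where "f2 = (\<lambda>(c, M :: real^3^3, Y :: real^3^3, Z :: real^3^3, q0, Q1 :: real^3^3).
    on_set K (\<lambda>x. (c + M *v x + Y *v sqv x + Z *v crv x) + bub x *\<^sub>R (q0 + Q1 *v x)))"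
  have "W 2 K = range f2"
  proof (intro equalityI subsetI)
    fix v assume "v \<in> W 2 K"
    then obtain u q where v: "v = on_set K (\<lambda>x. u x + bub x *\<^sub>R q x)" "u \<in> nd_fields 2" "q \<in> vpol 1"
      unfolding W_representation mem_Collect_eq by (elim exE conjE)
    obtain c and M Y Z :: "real^3^3" where u: "u = (\<lambda>x. c + M *v x + Y *v sqv x + Z *v crv x)"
      using v(2) unfolding nd_fields_2 vpol_2 mem_Collect_eq by (elim exE conjE)
    obtain q0 and Q1 :: "real^3^3" where q: "q = (\<lambda>x. q0 + Q1 *v x)"
      using v(3) unfolding vpol_1 mem_Collect_eq by (elim exE conjE)
    have "v = f2 (c, M, Y, Z, q0, Q1)" unfolding v(1) u q f2_def prod.case ..
    then show "v \<in> range f2" by (rule range_eqI)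
  next
    fix v assume "v \<in> range f2"
    then obtain a where a: "v = f2 a" by (rule rangeE)
    obtain c and M Y Z :: "real^3^3" and q0 and Q1 :: "real^3^3" where a': "a = (c, M, Y, Z, q0, Q1)"
      by (cases a)
    have "(\<lambda>x. c + M *v x + Y *v sqv x + Z *v crv x) \<in> nd_fields 2"
      unfolding nd_fields_2 vpol_2
      by (rule CollectI, rule exI[of _ c], rule exI[of _ M], rule exI[of _ Y], rule exI[of _ Z]) simp
    moreover have "(\<lambda>x. q0 + Q1 *v x) \<in> vpol 1"
      unfolding vpol_1 by (rule CollectI, rule exI[of _ q0], rule exI[of _ Q1]) simp
    moreover have "v = on_set K (\<lambda>x. (c + M *v x + Y *v sqv x + Z *v crv x) + bub x *\<^sub>R (q0 + Q1 *v x))"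
      unfolding a a' f2_def prod.case ..
    ultimately show "v \<in> W 2 K"
      unfolding W_representation
      by (intro CollectI exI[of _ "\<lambda>x. c + M *v x + Y *v sqv x + Z *v crv x"] exI[of _ "\<lambda>x. q0 + Q1 *v x"] conjI)
  qed
  also have "dim (range f2) = dim (UNIV :: ((real^3) \<times> (real^3^3) \<times> (real^3^3) \<times> (real^3^3) \<times> (real^3) \<times> (real^3^3)) set)"
  proof (rule dim_injective_image)
    show "linear f2"
      by (rule linearI) (auto simp: f2_def on_set_def fun_eq_iff scaleR_fun_def matrix_vector_mult_add_rdistrib
        scaleR_matrix_vector_assoc[symmetric] scaleR_add_right scaleR_add_left mult.commute)
    fix a assume z: "f2 a = 0"
    obtain c and M Y Z :: "real^3^3" and q0 and Q1 :: "real^3^3" where a': "a = (c, M, Y, Z, q0, Q1)"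
      by (cases a)
    have nd: "(\<lambda>x. c + M *v x + Y *v sqv x + Z *v crv x) \<in> nd_fields 2"
      unfolding nd_fields_2 vpol_2
      by (rule CollectI, rule exI[of _ c], rule exI[of _ M], rule exI[of _ Y], rule exI[of _ Z]) simp
    have vp: "(\<lambda>x. q0 + Q1 *v x) \<in> vpol 1"
      unfolding vpol_1 by (rule CollectI, rule exI[of _ q0], rule exI[of _ Q1]) simp
    have "on_set K (\<lambda>x. (c + M *v x + Y *v sqv x + Z *v crv x) + bub x *\<^sub>R (q0 + Q1 *v x)) = 0"
      using z unfolding a' f2_def prod.case .
    note W0 = W_element_zero[OF _ t n nd vp this]
    have "c = 0 \<and> M = 0 \<and> Y = 0 \<and> Z = 0"
      by (rule vector_quadratic_zero) (use W0(1) in \<open>simp add: fun_eq_iff\<close>)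
    moreover have "q0 = 0 \<and> Q1 = 0"
      by (rule affine_zero) (use W0(2) in \<open>simp add: fun_eq_iff\<close>)
    ultimately show "a = 0" by (simp add: a' zero_prod_def)
  qed simp
  also have "\<dots> = 42" by simp
  finally show "dim (W 2 K) = 42" .
qed

lemma facet_points:
  assumes "F facet_of K"
  obtains a b where "a \<in> F" "b \<in> F" "a \<noteq> b"
proof -
  obtain d where d: "d \<in> C" "F = convex hull (C - {d})"
    using assms unfolding facet_iff by (elim bexE)
  have "card (C - {d}) = 3" using card d(1) fin by simp
  then obtain a b c where "C - {d} = {a, b, c}" "a \<noteq> b" by (auto simp: card_3_iff)
  then have "a \<in> F" "b \<in> F" unfolding d(2) by (auto intro: hull_inc)
  with \<open>a \<noteq> b\<close> show ?thesis by (intro that)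
qed

text \<open>Six edges and four faces give 12 + 8 + 12 functionals for k = 1 and 18 + 12 + 12 for k =
  2.\<close>

lemma dof_count:
  assumes k: "k \<in> {1, 2}" and n: "\<And>F. F facet_of K \<Longrightarrow> unit_normal F (n F)"
  shows "(\<Sum>e | e edge_of K. dim (poly_on k e)) + (\<Sum>F | F facet_of K. dim (RM (k - 2) F (n F)))
    + (\<Sum>F | F facet_of K. dim (RT F (n F))) = (if k = 1 then 32 else 42)"
proof -
  have "dim (poly_on k e) = nat (k + 1)" if e: "e edge_of K" for e
  proof -
    obtain c where c: "card c = 2" "e = convex hull c" using e unfolding edge_iff by (elim exE conjE)
    obtain a b where ab: "c = {a, b}" "a \<noteq> b" using c(1) unfolding card_2_iff by (elim exE conjE)
    show ?thesis
      using dim_poly_on_segment[OF ab(2) k] unfolding c(2) ab(1) segment_convex_hull by linarith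
  qed
  then have 1: "(\<Sum>e | e edge_of K. dim (poly_on k e)) = 6 * nat (k + 1)"
    using card_edges by simp
  have "dim (RT F (n F)) = 3 \<and> dim (RM (k - 2) F (n F)) = (if k = 1 then 2 else 3)" if F: "F facet_of K" for F
  proof -
    obtain a b where ab: "a \<in> F" "b \<in> F" "a \<noteq> b" using F by (rule facet_points)
    show ?thesis
      using k dim_RT[OF ab n[OF F]] dim_RM_0[OF ab n[OF F]] dim_RM_neg[OF ab(1) n[OF F]] by auto
  qed
  then have "(\<Sum>F | F facet_of K. dim (RT F (n F))) = 12"
    "(\<Sum>F | F facet_of K. dim (RM (k - 2) F (n F))) = 4 * (if k = 1 then 2 else 3)"
    using card_facets by simp_all
  with 1 k show ?thesis by auto
qed

end

theorem lemma2p2: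
  fixes K :: "(real^3) set" and k :: int
    and t n :: "(real^3) set \<Rightarrow> real^3"
  assumes "3 simplex K" and "k \<in> {1, 2}"
    and "\<And>e. e edge_of K \<Longrightarrow> unit_tangent e (t e)"
    and "\<And>F. F facet_of K \<Longrightarrow> unit_normal F (n F)"
  shows "(\<Sum>e | e edge_of K. dim (poly_on k e))
          + (\<Sum>F | F facet_of K. dim (RM (k - 2) F (n F)))
          + (\<Sum>F | F facet_of K. dim (RT F (n F))) = dim (W k K)
      \<and> (\<forall>v\<in>W k K. \<forall>w\<in>W k K.
          (\<forall>e. e edge_of K \<longrightarrow> (\<forall>q\<in>poly_on k e.
             edge_integral e (\<lambda>x. (v x \<bullet> t e) * q x) = edge_integral e (\<lambda>x. (w x \<bullet> t e) * q x)))
        \<and> (\<forall>F. F facet_of K \<longrightarrow> (\<forall>q\<in>RM (k - 2) F (n F).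
             face_integral F (\<lambda>x. cross3 (v x) (n F) \<bullet> q x)
             = face_integral F (\<lambda>x. cross3 (w x) (n F) \<bullet> q x)))
        \<and> (\<forall>F. F facet_of K \<longrightarrow> (\<forall>q\<in>RT F (n F).
             face_integral F (\<lambda>x. cross3 (curl_in K v x) (n F) \<bullet> q x)
             = face_integral F (\<lambda>x. cross3 (curl_in K w x) (n F) \<bullet> q x)))
        \<longrightarrow> v = w)"
proof -
  obtain C l g where "tetra C K l g" using assms(1) by (rule tetra_exists)
  then interpret tetra C K l g .
  show ?thesis
  proof (intro conjI ballI impI)
    show "(\<Sum>e | e edge_of K. dim (poly_on k e)) + (\<Sum>F | F facet_of K. dim (RM (k - 2) F (n F)))
      + (\<Sum>F | F facet_of K. dim (RT F (n F))) = dim (W k K)"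
      using dof_count[OF assms(2,4)] dim_W[OF assms(3,4)] assms(2) by auto
  next
    fix v w assume v: "v \<in> W k K" and w: "w \<in> W k K"
    assume dofs: "(\<forall>e. e edge_of K \<longrightarrow> (\<forall>q\<in>poly_on k e.
             edge_integral e (\<lambda>x. (v x \<bullet> t e) * q x) = edge_integral e (\<lambda>x. (w x \<bullet> t e) * q x)))
        \<and> (\<forall>F. F facet_of K \<longrightarrow> (\<forall>q\<in>RM (k - 2) F (n F).
             face_integral F (\<lambda>x. cross3 (v x) (n F) \<bullet> q x)
             = face_integral F (\<lambda>x. cross3 (w x) (n F) \<bullet> q x)))
        \<and> (\<forall>F. F facet_of K \<longrightarrow> (\<forall>q\<in>RT F (n F).
             face_integral F (\<lambda>x. cross3 (curl_in K v x) (n F) \<bullet> q x)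
             = face_integral F (\<lambda>x. cross3 (curl_in K w x) (n F) \<bullet> q x)))"
    obtain u q where uq: "v = on_set K (\<lambda>x. u x + bub x *\<^sub>R q x)" "u \<in> nd_fields k" "q \<in> vpol 1"
      using v unfolding W_representation mem_Collect_eq by (elim exE conjE)
    obtain u' q' where uq': "w = on_set K (\<lambda>x. u' x + bub x *\<^sub>R q' x)" "u' \<in> nd_fields k" "q' \<in> vpol 1"
      using w unfolding W_representation mem_Collect_eq by (elim exE conjE)
    interpret equal_dofs C K l g k u u' q q' t n "\<lambda>x. u x + bub x *\<^sub>R q x" "\<lambda>x. u' x + bub x *\<^sub>R q' x"
    proof (unfold_locales, unfold uq(1)[symmetric] uq'(1)[symmetric])
      show "edge_integral e (\<lambda>x. (v x \<bullet> t e) * p x) = edge_integral e (\<lambda>x. (w x \<bullet> t e) * p x)"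
        if "e edge_of K" "p \<in> poly_on k e" for e p
        using dofs that by simp
      show "face_integral F (\<lambda>x. cross3 (v x) (n F) \<bullet> p x) = face_integral F (\<lambda>x. cross3 (w x) (n F) \<bullet> p x)"
        if "F facet_of K" "p \<in> RM (k - 2) F (n F)" for F p
        using dofs that by simp
      show "face_integral F (\<lambda>x. cross3 (curl_in K v x) (n F) \<bullet> p x) = face_integral F (\<lambda>x. cross3 (curl_in K w x) (n F) \<bullet> p x)"
        if "F facet_of K" "p \<in> RT F (n F)" for F p
        using dofs that by simp
    qed (fact uq uq' assms | rule assms refl | assumption)+
    show "v = w" unfolding uq(1) uq'(1) fields_eq ..
  qed
qed

end
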